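(* Let $(M,g,F)$ be a complete steady gradient Yamabe soliton with nonnegative scalar curvature. If the potential function $F$ is nonnegative and satisfies $F\in L^p(M)$ for some $p\ge 0$, then $(M,g,F)$ is trivial, i.e. $F$ is constant.
   Context: An $n$-dimensional Riemannian manifold $(M^n,g)$ is a gradient Yamabe soliton if there exist a smooth function $F$ on $M$ (the potential function) and a constant $\rho\in\mathbb{R}$ such that $\nabla\nabla F=(R-\rho)g$, where $\nabla\nabla F$ is the Hessian of $F$ and $R$ is the scalar curvature of $(M,g)$. It is steady if $\rho=0$, complete if $(M,g)$ is complete, and trivial if $F$ is constant. For a nonnegative function $f$ and a finite real number $p\geq 0$, $f\in L^p(M)$ means $\int_M f^p<+\infty$ with respect to the Riemannian volume (for $p=0$ the integrand is read as $1$ where $f>0$). *)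

theory Defs
  imports "HOL-Analysis.Analysis"
begin

section \<open>Smooth maps between open subsets of normed spaces\<close>

primrec Ck_on :: "nat \<Rightarrow> 'v::real_normed_vector set \<Rightarrow> ('v \<Rightarrow> 'w::real_normed_vector) \<Rightarrow> bool" where
  "Ck_on 0 S f \<longleftrightarrow> continuous_on S f"
| "Ck_on (Suc k) S f \<longleftrightarrow>
     (\<forall>x\<in>S. f differentiable (at x)) \<and> (\<forall>v. Ck_on k S (\<lambda>x. frechet_derivative f (at x) v))"

definition smooth_on :: "'v::real_normed_vector set \<Rightarrow> ('v \<Rightarrow> 'w::real_normed_vector) \<Rightarrow> bool" where
  "smooth_on S f \<longleftrightarrow> (\<forall>k. Ck_on k S f)"


section \<open>Manifolds\<close>

text \<open>The points of the manifold are all elements of a type \<open>'a\<close> that is a second countable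
  Hausdorff space.  A chart is a pair consisting of its domain and its coordinate map; the
  coordinate map is relevant on the domain only.\<close>

type_synonym ('a, 'n) chart = "'a set \<times> ('a \<Rightarrow> real ^ 'n)"

abbreviation cdom :: "('a, 'n) chart \<Rightarrow> 'a set" where
  "cdom c \<equiv> fst c"

abbreviation cmap :: "('a, 'n) chart \<Rightarrow> 'a \<Rightarrow> real ^ 'n" where
  "cmap c \<equiv> snd c"

abbreviation cinv :: "('a, 'n) chart \<Rightarrow> real ^ 'n \<Rightarrow> 'a" where
  "cinv c \<equiv> inv_into (cdom c) (cmap c)"

definition is_chart :: "('a::topological_space, 'n::finite) chart \<Rightarrow> bool" where
  "is_chart c \<longleftrightarrow> open (cdom c) \<and> open (cmap c ` cdom c) \<and>
     homeomorphism (cdom c) (cmap c ` cdom c) (cmap c) (cinv c)"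

definition smooth_atlas :: "('a::topological_space, 'n::finite) chart set \<Rightarrow> bool" where
  "smooth_atlas A \<longleftrightarrow> (\<forall>c\<in>A. is_chart c) \<and> (\<Union>c\<in>A. cdom c) = UNIV \<and>
     (\<forall>c\<in>A. \<forall>d\<in>A. smooth_on (cmap c ` (cdom c \<inter> cdom d)) (cmap d \<circ> cinv c))"

definition smooth_function :: "('a::topological_space, 'n::finite) chart set \<Rightarrow> ('a \<Rightarrow> real) \<Rightarrow> bool" where
  "smooth_function A F \<longleftrightarrow> (\<forall>c\<in>A. smooth_on (cmap c ` cdom c) (F \<circ> cinv c))"

text \<open>A Riemannian metric is given by its component matrices: \<open>g c x\<close> is the matrix
  \<open>(g\<^sub>i\<^sub>j)\<close> in the chart \<open>c\<close> at the coordinate point \<open>x\<close>.  The last clause is the transformation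
  law of a covariant 2-tensor, with \<open>J\<close> the Jacobian matrix of the change of charts.\<close>

definition riemannian_metric ::
  "('a::topological_space, 'n::finite) chart set \<Rightarrow> (('a, 'n) chart \<Rightarrow> real ^ 'n \<Rightarrow> real ^ 'n ^ 'n) \<Rightarrow> bool" where
  "riemannian_metric A g \<longleftrightarrow>
     (\<forall>c\<in>A. smooth_on (cmap c ` cdom c) (g c)) \<and>
     (\<forall>c\<in>A. \<forall>x\<in>cmap c ` cdom c. transpose (g c x) = g c x \<and> (\<forall>v. v \<noteq> 0 \<longrightarrow> v \<bullet> (g c x *v v) > 0)) \<and>
     (\<forall>c\<in>A. \<forall>d\<in>A. \<forall>x\<in>cmap c ` (cdom c \<inter> cdom d).
        let \<tau> = cmap d \<circ> cinv c; J = matrix (frechet_derivative \<tau> (at x))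
        in g c x = transpose J ** g d (\<tau> x) ** J)"

definition riemannian_manifold ::
  "('a::{t2_space, second_countable_topology}, 'n::finite) chart set \<Rightarrow>
   (('a, 'n) chart \<Rightarrow> real ^ 'n \<Rightarrow> real ^ 'n ^ 'n) \<Rightarrow> bool" where
  "riemannian_manifold A g \<longleftrightarrow>
     smooth_atlas A \<and> connected (UNIV :: 'a set) \<and> riemannian_metric A g"


section \<open>Curvature and Hessian in local coordinates\<close>

text \<open>Throughout this section \<open>G\<close> is the matrix function of the metric in one chart.\<close>

definition pd :: "'n::finite \<Rightarrow> (real ^ 'n \<Rightarrow> real) \<Rightarrow> real ^ 'n \<Rightarrow> real" where
  "pd i f x = frechet_derivative f (at x) (axis i 1)"

text \<open>\<open>christoffel G k i j\<close> is \<open>\<Gamma>\<^sup>k\<^sub>i\<^sub>j\<close> of the Levi-Civita connection.\<close>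

definition christoffel ::
  "(real ^ 'n \<Rightarrow> real ^ 'n ^ 'n) \<Rightarrow> 'n::finite \<Rightarrow> 'n \<Rightarrow> 'n \<Rightarrow> real ^ 'n \<Rightarrow> real" where
  "christoffel G k i j x =
     (\<Sum>l\<in>UNIV. matrix_inv (G x) $ k $ l *
        (pd i (\<lambda>y. G y $ j $ l) x + pd j (\<lambda>y. G y $ i $ l) x - pd l (\<lambda>y. G y $ i $ j) x)) / 2"

text \<open>\<open>riemann G l i j k\<close> is the component \<open>dx\<^sup>l(R(\<partial>\<^sub>i, \<partial>\<^sub>j) \<partial>\<^sub>k)\<close>, where
  \<open>R(X, Y) Z = \<nabla>\<^sub>X\<nabla>\<^sub>Y Z - \<nabla>\<^sub>Y\<nabla>\<^sub>X Z - \<nabla>\<^bsub>[X,Y]\<^esub> Z\<close>.  With \<open>Ric(Y, Z) = tr (X \<mapsto> R(X, Y) Z)\<close> round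
  spheres have positive scalar curvature.\<close>

definition riemann ::
  "(real ^ 'n \<Rightarrow> real ^ 'n ^ 'n) \<Rightarrow> 'n::finite \<Rightarrow> 'n \<Rightarrow> 'n \<Rightarrow> 'n \<Rightarrow> real ^ 'n \<Rightarrow> real" where
  "riemann G l i j k x =
     pd i (christoffel G l j k) x - pd j (christoffel G l i k) x +
     (\<Sum>m\<in>UNIV. christoffel G l i m x * christoffel G m j k x -
                 christoffel G l j m x * christoffel G m i k x)"

definition ricci ::
  "(real ^ 'n \<Rightarrow> real ^ 'n ^ 'n) \<Rightarrow> 'n::finite \<Rightarrow> 'n \<Rightarrow> real ^ 'n \<Rightarrow> real" where
  "ricci G j k x = (\<Sum>i\<in>UNIV. riemann G i i j k x)"

definition scalar_curvature :: "(real ^ 'n \<Rightarrow> real ^ 'n ^ 'n) \<Rightarrow> real ^ 'n::finite \<Rightarrow> real" where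
  "scalar_curvature G x = (\<Sum>j\<in>UNIV. \<Sum>k\<in>UNIV. matrix_inv (G x) $ j $ k * ricci G j k x)"

definition hessian ::
  "(real ^ 'n \<Rightarrow> real ^ 'n ^ 'n) \<Rightarrow> (real ^ 'n \<Rightarrow> real) \<Rightarrow> 'n::finite \<Rightarrow> 'n \<Rightarrow> real ^ 'n \<Rightarrow> real" where
  "hessian G f i j x = pd i (pd j f) x - (\<Sum>k\<in>UNIV. christoffel G k i j x * pd k f x)"


section \<open>Global notions on a Riemannian manifold\<close>

text \<open>All quantities below are tensorial, so requiring a property in every chart of the atlas amounts
  to requiring it on the manifold.\<close>

definition nonneg_scalar_curvature ::
  "('a, 'n::finite) chart set \<Rightarrow> (('a, 'n) chart \<Rightarrow> real ^ 'n \<Rightarrow> real ^ 'n ^ 'n) \<Rightarrow> bool" where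
  "nonneg_scalar_curvature A g \<longleftrightarrow> (\<forall>c\<in>A. \<forall>x\<in>cmap c ` cdom c. scalar_curvature (g c) x \<ge> 0)"

definition gradient_yamabe_soliton ::
  "('a::{t2_space, second_countable_topology}, 'n::finite) chart set \<Rightarrow>
   (('a, 'n) chart \<Rightarrow> real ^ 'n \<Rightarrow> real ^ 'n ^ 'n) \<Rightarrow> ('a \<Rightarrow> real) \<Rightarrow> real \<Rightarrow> bool" where
  "gradient_yamabe_soliton A g F \<rho> \<longleftrightarrow>
     riemannian_manifold A g \<and> smooth_function A F \<and>
     (\<forall>c\<in>A. \<forall>x\<in>cmap c ` cdom c. \<forall>i j.
        hessian (g c) (F \<circ> cinv c) i j x = (scalar_curvature (g c) x - \<rho>) * g c x $ i $ j)"

definition steady_gradient_yamabe_soliton ::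
  "('a::{t2_space, second_countable_topology}, 'n::finite) chart set \<Rightarrow>
   (('a, 'n) chart \<Rightarrow> real ^ 'n \<Rightarrow> real ^ 'n ^ 'n) \<Rightarrow> ('a \<Rightarrow> real) \<Rightarrow> bool" where
  "steady_gradient_yamabe_soliton A g F \<longleftrightarrow> gradient_yamabe_soliton A g F 0"

definition trivial_potential :: "('a \<Rightarrow> real) \<Rightarrow> bool" where
  "trivial_potential F \<longleftrightarrow> F constant_on UNIV"

text \<open>A geodesic defined on all of \<open>\<real>\<close>: in every chart
  \<open>u\<^sup>k'' + \<Gamma>\<^sup>k\<^sub>i\<^sub>j u\<^sup>i' u\<^sup>j' = 0\<close>.  The chart domains being open and \<open>\<gamma>\<close> continuous, \<open>u\<close> is a genuine
  coordinate curve near every \<open>t\<close> under consideration.\<close>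

definition geodesic_line ::
  "('a::topological_space, 'n::finite) chart set \<Rightarrow> (('a, 'n) chart \<Rightarrow> real ^ 'n \<Rightarrow> real ^ 'n ^ 'n) \<Rightarrow>
   (real \<Rightarrow> 'a) \<Rightarrow> bool" where
  "geodesic_line A g \<gamma> \<longleftrightarrow> continuous_on UNIV \<gamma> \<and>
     (\<forall>c\<in>A. \<forall>t. \<gamma> t \<in> cdom c \<longrightarrow>
        (let u = cmap c \<circ> \<gamma>; u' = (\<lambda>s. vector_derivative u (at s)) in
           u differentiable (at t) \<and>
           (u' has_vector_derivative
             (\<chi> k. - (\<Sum>i\<in>UNIV. \<Sum>j\<in>UNIV. christoffel (g c) k i j (u t) * u' t $ i * u' t $ j))) (at t)))"

text \<open>Completeness of a Riemannian manifold: geodesics with arbitrary initial data exist for all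
  times.  By the Hopf-Rinow theorem this agrees with completeness of the induced distance.\<close>

definition complete_riemannian ::
  "('a::topological_space, 'n::finite) chart set \<Rightarrow> (('a, 'n) chart \<Rightarrow> real ^ 'n \<Rightarrow> real ^ 'n ^ 'n) \<Rightarrow>
   bool" where
  "complete_riemannian A g \<longleftrightarrow>
     (\<forall>c\<in>A. \<forall>q\<in>cdom c. \<forall>v. \<exists>\<gamma>. geodesic_line A g \<gamma> \<and> \<gamma> 0 = q \<and>
        ((cmap c \<circ> \<gamma>) has_vector_derivative v) (at 0))"

text \<open>The Riemannian volume is the Borel measure with density \<open>sqrt (det (g\<^sub>i\<^sub>j))\<close> in every chart.
  Since countably many chart domains cover the manifold, this determines the measure.\<close>

definition riemannian_volume ::
  "('a::topological_space, 'n::finite) chart set \<Rightarrow> (('a, 'n) chart \<Rightarrow> real ^ 'n \<Rightarrow> real ^ 'n ^ 'n) \<Rightarrow>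
   'a measure \<Rightarrow> bool" where
  "riemannian_volume A g \<mu> \<longleftrightarrow> sets \<mu> = sets borel \<and>
     (\<forall>c\<in>A. \<forall>E\<in>sets borel. E \<subseteq> cdom c \<longrightarrow>
        emeasure \<mu> E = (\<integral>\<^sup>+ x\<in>cmap c ` E. ennreal (sqrt (det (g c x))) \<partial>lborel))"

text \<open>Membership of a nonnegative function in \<open>L\<^sup>p\<close> with respect to the (unique) Riemannian volume,
  for finite \<open>p \<ge> 0\<close>.  As \<open>0 powr 0 = 0\<close>, for \<open>p = 0\<close> the integrand is the indicator of \<open>{f > 0}\<close>.\<close>

definition in_Lp ::
  "('a::topological_space, 'n::finite) chart set \<Rightarrow> (('a, 'n) chart \<Rightarrow> real ^ 'n \<Rightarrow> real ^ 'n ^ 'n) \<Rightarrow>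
   ('a \<Rightarrow> real) \<Rightarrow> real \<Rightarrow> bool" where
  "in_Lp A g f p \<longleftrightarrow>
     (\<exists>\<mu>. riemannian_volume A g \<mu> \<and> (\<integral>\<^sup>+ q. ennreal (f q powr p) \<partial>\<mu>) < \<infinity>)"

end

theory Submission
  imports Defs
begin

text \<open>Suppose \<open>F\<close> is not constant and put \<open>X = \<nabla>F / |\<nabla>F|\<close> on the open set \<open>\<Omega>\<close> of regular points.  From
  \<open>\<nabla>\<nabla>F = R g\<close> one gets \<open>\<nabla>\<^bsub>w\<^esub> X = (R / |\<nabla>F|) (w - \<langle>w, X\<rangle> X)\<close>.  Hence the integral curves of \<open>X\<close> are unit
  speed geodesics, which exist for all positive times by completeness; along them \<open>|\<nabla>F|\<close> does not
  decrease, so that \<open>F\<close> grows at least linearly; and since \<open>R \<ge> 0\<close> the Lie derivative of \<open>g\<close> along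
  \<open>X\<close> is nonnegative, so that the flow does not decrease volume.  If \<open>U\<close> is a small open set of
  regular points, the flow pushes it into every superlevel set \<open>{F \<ge> m}\<close>, whose volume is therefore
  bounded below.  But \<open>F \<in> L\<^sup>p\<close> makes \<open>{F \<ge> 1}\<close> of finite volume, so the volume of \<open>{F \<ge> m}\<close> tends
  to \<open>0\<close>.

  Differentiability of the flow in the initial value is never needed: the expansion estimate for
  nearby trajectories (with the metric frozen at one of them) makes the inverse of the flow map
  almost \<open>1\<close>-Lipschitz, and volumes are compared by a Vitali covering argument.\<close>

section \<open>Lebesgue measure and expanding maps\<close>

text \<open>Two difficulties shape the argument. First, X degenerates at critical points of F, and
  nothing keeps a trajectory away from them backwards in time; forwards, the derivative of |grad F|
  along X is R, so |grad F| cannot fall to 0. This is why only nonnegative times occur and why a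
  complete geodesic with initial velocity X remains an integral curve forever. Second, the error in
  each volume comparison depends on the chart and on the point, and a trajectory may run through
  more and more charts. The estimate is therefore stated at a point and for every error e > 0:
  composing two steps with factor sqrt (1 + e) each gives 1 + e again, so nothing accumulates with
  time. Only afterwards is e = 1 fixed, once for the whole set U, which gives a factor 2 independent
  of m. The exponent p enters only through F^p >= 1 on {F >= 1}, which covers p = 0.\<close>

lemma measure_expanding_map:
  fixes f :: "'a::euclidean_space \<Rightarrow> 'a"
  assumes S: "S \<in> lmeasurable" and T: "T \<in> lmeasurable" and fST: "f ` S \<subseteq> T" and L: "L > 0"
    and exp: "\<And>x y. x \<in> S \<Longrightarrow> y \<in> S \<Longrightarrow> norm (x - y) \<le> L * norm (f x - f y)"
  shows "measure lebesgue S \<le> L ^ DIM('a) * measure lebesgue T"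
proof -
  let ?n = "DIM('a)" and ?\<mu> = "measure lebesgue"
  have inj: "inj_on f S"
    using exp by (intro inj_onI) fastforce
  \<comment> \<open>The inverse \<open>h\<close> is \<open>L\<close>-Lipschitz on the image of
    \<open>S\<close>: it sends the part of the image in a ball of radius r into a ball of radius
    \<open>L * r\<close>, with volume larger by \<open>L ^ ?n\<close>, and it sends null sets to
    null sets. Disjoint balls that cover the image up to a null set then bound the measure of
    \<open>S\<close>.\<close>
  define h where "h = inv_into S f"
  have h: "h (f x) = x" if "x \<in> S" for x
    using inj that by (simp add: h_def)
  have bound: "?\<mu> S \<le> L ^ ?n * (?\<mu> T + e)" if "e > 0" for e
  proof -
    \<comment> \<open>All covering balls are taken inside this \<open>W\<close>, so that together
      they exceed \<open>T\<close> by measure less than \<open>e\<close>.\<close>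
    obtain W where W: "open W" "T \<subseteq> W" "(W - T) \<in> lmeasurable" "emeasure lebesgue (W - T) < ennreal e"
      using sets_lebesgue_outer_open[of T e] T \<open>e > 0\<close> by blast
    have Wm: "W \<in> lmeasurable"
    proof -
      have "T \<union> (W - T) \<in> lmeasurable" using T W(3) by blast
      with W(2) show ?thesis by (simp add: Un_absorb1)
    qed
    have "?\<mu> (W - T) < e"
      using W(3,4) \<open>e > 0\<close> by (simp add: emeasure_eq_measure2 ennreal_less_iff)
    moreover have "?\<mu> W = ?\<mu> T + ?\<mu> (W - T)"
      using T W(2) Wm by (simp add: measurable_measure_Diff fmeasurableD)
    ultimately have Wle: "?\<mu> W \<le> ?\<mu> T + e" by simp
    define K where "K = {(y, r). y \<in> f ` S \<and> 0 < r \<and> ball y r \<subseteq> W}"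
    obtain C where C: "countable C" "C \<subseteq> K"
      "pairwise (\<lambda>i j. disjnt (ball (fst i) (snd i)) (ball (fst j) (snd j))) C"
      "negligible (f ` S - (\<Union>i \<in> C. ball (fst i) (snd i)))"
    proof (rule Vitali_covering_theorem_balls[of "f ` S" K fst snd])
      fix y and d :: real
      assume y: "y \<in> f ` S" and d: "d > 0"
      then obtain k where k: "k > 0" "ball y k \<subseteq> W"
        using W(1,2) fST by (meson open_contains_ball subsetD)
      have "(y, min k (d / 2)) \<in> K"
        using y d k by (auto simp: K_def)
      then show "\<exists>i. i \<in> K \<and> y \<in> ball (fst i) (snd i) \<and> snd i < d"
        using d k(1) by (intro exI[of _ "(y, min k (d / 2))"]) auto
    qed
    let ?N = "f ` S - (\<Union>i \<in> C. ball (fst i) (snd i))"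
    have hN: "negligible (h ` ?N)"
    proof (rule negligible_locally_Lipschitz_image[OF order_refl C(4)])
      fix y assume "y \<in> ?N"
      then obtain x where x: "x \<in> S" "y = f x" by auto
      have "norm (h z - h y) \<le> L * norm (z - y)" if "z \<in> ?N" for z
        using that x exp by (auto simp: h)
      then show "\<exists>T B. open T \<and> y \<in> T \<and> (\<forall>z\<in>?N \<inter> T. norm (h z - h y) \<le> B * norm (z - y))"
        by (intro exI[of _ UNIV] exI[of _ L]) auto
    qed
    let ?V = "\<lambda>i. cball (h (fst i)) (L * snd i)"
    have cover: "S \<subseteq> h ` ?N \<union> (\<Union>i\<in>C. ?V i)"
    proof
      fix x assume x: "x \<in> S"
      show "x \<in> h ` ?N \<union> (\<Union>i\<in>C. ?V i)"
      proof (cases "f x \<in> ?N")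
        case True
        then have "h (f x) \<in> h ` ?N" by (rule imageI)
        then show ?thesis unfolding h[OF x] by (rule UnI1)
      next
        case False
        then obtain i where i: "i \<in> C" "f x \<in> ball (fst i) (snd i)" using x by auto
        then obtain z where z: "z \<in> S" "fst i = f z" using C(2) by (auto simp: K_def)
        have "norm (z - x) \<le> L * norm (f z - f x)" using exp x z by auto
        also have "\<dots> \<le> L * snd i"
          using i(2) z L by (auto simp: dist_norm)
        finally show ?thesis using i(1) z h by (auto simp: dist_norm intro!: bexI[of _ i])
      qed
    qed
    \<comment> \<open>The enlarged balls need not be disjoint, so they are only subadditive;
      disjointness is used for the original balls. Finite subfamilies suffice to bound the countable
      union.\<close>
    have sumle: "?\<mu> (\<Union>i\<in>I. ?V i) \<le> L ^ ?n * ?\<mu> W" if I: "I \<subseteq> C" "finite I" for I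
    proof -
      have "?\<mu> (\<Union>i\<in>I. ?V i) \<le> (\<Sum>i\<in>I. ?\<mu> (?V i))"
        using I(2) by (intro measure_UNION_le) auto
      also have "\<dots> = (\<Sum>i\<in>I. L ^ ?n * ?\<mu> (ball (fst i) (snd i)))"
      proof (rule sum.cong[OF refl])
        fix i assume "i \<in> I"
        then have "snd i > 0" using I(1) C(2) by (auto simp: K_def)
        then show "?\<mu> (?V i) = L ^ ?n * ?\<mu> (ball (fst i) (snd i))"
          using L content_ball_conv_unit_ball[of "L * snd i" "h (fst i)"]
            content_ball_conv_unit_ball[of "snd i" "fst i"]
          by (simp add: content_cball_conv_ball power_mult_distrib)
      qed
      also have "\<dots> = L ^ ?n * ?\<mu> (\<Union>i\<in>I. ball (fst i) (snd i))"
      proof -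
        have "(\<Sum>i\<in>I. ?\<mu> (ball (fst i) (snd i))) = ?\<mu> (\<Union>i\<in>I. ball (fst i) (snd i))"
          by (rule measure_UNION'[symmetric]) (use I C(3) in \<open>auto intro: pairwise_subset\<close>)
        then show ?thesis by (simp only: flip: sum_distrib_left)
      qed
      also have "\<dots> \<le> L ^ ?n * ?\<mu> W"
      proof -
        have "?\<mu> (\<Union>i\<in>I. ball (fst i) (snd i)) \<le> ?\<mu> W"
        proof (rule measure_mono_fmeasurable)
          show "(\<Union>i\<in>I. ball (fst i) (snd i)) \<subseteq> W"
          proof (rule UN_least)
            fix i assume "i \<in> I"
            then have "i \<in> K" using I(1) C(2) by blast
            then show "ball (fst i) (snd i) \<subseteq> W" by (simp add: K_def split_beta)
          qed
        qed (use I Wm in auto)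
        then show ?thesis using L by simp
      qed
      finally show ?thesis .
    qed
    have V: "(\<Union>i\<in>C. ?V i) \<in> lmeasurable" "?\<mu> (\<Union>i\<in>C. ?V i) \<le> L ^ ?n * ?\<mu> W"
      by (rule fmeasurable_UN_bound[OF C(1)] measure_UN_bound[OF C(1)], rule lmeasurable_cball, erule (1) sumle)+
    have "?\<mu> S \<le> ?\<mu> (h ` ?N \<union> (\<Union>i\<in>C. ?V i))"
      using cover S V(1) hN by (intro measure_mono_fmeasurable) (auto simp: negligible_imp_measurable)
    also have "\<dots> \<le> ?\<mu> (h ` ?N) + ?\<mu> (\<Union>i\<in>C. ?V i)"
      using hN V(1) by (intro measure_Un_le) (auto simp: negligible_imp_measurable negligible_imp_sets)
    also have "\<dots> \<le> L ^ ?n * ?\<mu> W"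
      using V(2) hN by (simp add: negligible_imp_measure0)
    also have "\<dots> \<le> L ^ ?n * (?\<mu> T + e)"
      using Wle L by simp
    finally show ?thesis .
  qed
  show ?thesis
  proof (rule field_le_epsilon)
    fix e :: real assume "e > 0"
    have "?\<mu> S \<le> L ^ ?n * (?\<mu> T + e / L ^ ?n)"
      using \<open>e > 0\<close> L by (intro bound) simp
    then show "?\<mu> S \<le> L ^ ?n * ?\<mu> T + e"
      using L by (simp add: algebra_simps)
  qed
qed

section \<open>Positive definite quadratic forms and their square roots\<close>

lemma inner_transpose_matrix:
  fixes A :: "real ^ 'n ^ 'm"
  shows "x \<bullet> (A *v y) = (transpose A *v x) \<bullet> y"
  by (metis dot_lmul_matrix transpose_matrix_vector)

definition pos_def :: "real ^ 'n ^ 'n \<Rightarrow> bool" where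
  "pos_def M \<longleftrightarrow> transpose M = M \<and> (\<forall>v. v \<noteq> 0 \<longrightarrow> v \<bullet> (M *v v) > 0)"

lemma pos_def_inner_commute: "pos_def M \<Longrightarrow> v \<bullet> (M *v w) = w \<bullet> (M *v v)"
  by (metis inner_commute inner_transpose_matrix pos_def_def)

text \<open>A maximal orthonormal set of eigenvectors spans: otherwise its orthogonal complement is
  a nonzero \<open>M\<close>-invariant subspace, and a maximizer of the quadratic form on the unit
  sphere of that subspace is one more eigenvector.\<close>

lemma symmetric_matrix_eigenbasis:
  fixes M :: "real ^ 'n ^ 'n"
  assumes M: "transpose M = M"
  obtains h :: "'n \<Rightarrow> real ^ 'n" and d :: "'n \<Rightarrow> real"
  where "\<And>i j. h i \<bullet> h j = (if i = j then 1 else 0)" "\<And>i. M *v h i = d i *\<^sub>R h i"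
proof -
  have Ms: "v \<bullet> (M *v w) = (M *v v) \<bullet> w" for v w
    by (simp add: inner_transpose_matrix M)
  define ON where "ON B \<longleftrightarrow> finite B \<and> (\<forall>b\<in>B. \<forall>c\<in>B. b \<bullet> c = (if b = c then 1 else 0)) \<and>
    (\<forall>b\<in>B. \<exists>l. M *v b = l *\<^sub>R b)" for B :: "(real ^ 'n) set"
  have indep: "independent B" if "ON B" for B
  proof (rule pairwise_orthogonal_independent)
    show "pairwise orthogonal B" using that by (auto simp: ON_def pairwise_def orthogonal_def)
    show "0 \<notin> B" using that unfolding ON_def by (metis inner_zero_left zero_neq_one)
  qed
  have card: "card B \<le> CARD('n)" if "ON B" for B
    using independent_bound[OF indep[OF that]] by simp
  obtain B where B: "ON B" and max: "\<And>B'. ON B' \<Longrightarrow> card B' \<le> card B"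
  proof -
    have "ON {}" by (simp add: ON_def)
    then obtain B where "ON B \<and> (\<forall>B'. ON B' \<longrightarrow> card B' \<le> card B)"
      using ex_has_greatest_nat[of ON "{}" card "Suc CARD('n)"] card by (auto simp: less_Suc_eq_le)
    with that show ?thesis by blast
  qed
  have span: "span B = UNIV"
  proof (rule ccontr)
    assume "span B \<noteq> UNIV"
    define W where "W = {v. \<forall>b\<in>B. orthogonal b v}"
    have sub: "subspace W" unfolding W_def by (auto simp: subspace_def orthogonal_clauses)
    obtain a where a: "a \<noteq> 0" "a \<in> W"
    proof -
      obtain a where "a \<noteq> 0" "span B \<subseteq> {x. a \<bullet> x = 0}"
        using span_not_univ_subset_hyperplane[OF \<open>span B \<noteq> UNIV\<close>] by blast
      then have "b \<bullet> a = 0" if "b \<in> B" for b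
        using span_base[OF that] by (subst inner_commute) auto
      with that[OF \<open>a \<noteq> 0\<close>] show ?thesis by (simp add: W_def orthogonal_def)
    qed
    have Minv: "M *v v \<in> W" if "v \<in> W" for v
    proof -
      have "orthogonal b (M *v v)" if b: "b \<in> B" for b
      proof -
        obtain l where "M *v b = l *\<^sub>R b" using B b unfolding ON_def by blast
        then show ?thesis
          using \<open>v \<in> W\<close> b by (simp add: orthogonal_def Ms W_def)
      qed
      then show ?thesis by (simp add: W_def)
    qed
    let ?q = "\<lambda>v. v \<bullet> (M *v v)"
    have "closed W" by (rule closed_subspace[OF sub])
    then have "compact (sphere 0 1 \<inter> W)" by (simp add: compact_Int_closed)
    moreover have "(1 / norm a) *\<^sub>R a \<in> sphere 0 1 \<inter> W"
      using a sub by (simp add: subspace_scale)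
    moreover have "continuous_on (sphere 0 1 \<inter> W) ?q"
      by (intro continuous_on_inner continuous_on_id linear_continuous_on linear_conv_bounded_linear[THEN iffD1]) simp
    ultimately obtain v where v: "v \<in> sphere 0 1 \<inter> W" and vmax: "\<And>w. w \<in> sphere 0 1 \<inter> W \<Longrightarrow> ?q w \<le> ?q v"
      using continuous_attains_sup[of "sphere 0 1 \<inter> W" ?q] by blast
    have le: "?q w \<le> ?q v * (w \<bullet> w)" if "w \<in> W" for w
    proof (cases "w = 0")
      case False
      have "?q ((1 / norm w) *\<^sub>R w) \<le> ?q v"
        using that False sub by (intro vmax) (simp add: subspace_scale)
      moreover have "w \<bullet> w = (norm w)\<^sup>2" by (simp add: power2_norm_eq_inner)
      ultimately show ?thesis
        using False by (simp add: matrix_vector_mult_scaleR field_simps power2_eq_square)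
    qed (use v in auto)
    \<comment> \<open>\<open>u\<close> is the defect in the eigenvalue equation. Moving the
      maximizer \<open>v\<close> by \<open>t\<close> times \<open>u\<close> gains 2 t |u|^2 at first
      order, and everything else is of order t^2; small positive \<open>t\<close> therefore forces
      \<open>u\<close> to vanish.\<close>
    define u where "u = M *v v - ?q v *\<^sub>R v"
    have uW: "u \<in> W" unfolding u_def
      using v by (intro subspace_diff[OF sub] subspace_scale[OF sub] Minv) auto
    have ineq: "2 * t * (u \<bullet> u) \<le> t\<^sup>2 * (?q v * (u \<bullet> u) - ?q u)" for t
    proof -
      have "v + t *\<^sub>R u \<in> W" using v uW by (intro subspace_add[OF sub] subspace_scale[OF sub]) auto
      moreover have "?q (v + t *\<^sub>R u) = ?q v + 2 * t * (u \<bullet> (M *v v)) + t\<^sup>2 * ?q u"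
        by (simp add: matrix_vector_right_distrib matrix_vector_mult_scaleR inner_add_left inner_add_right
            Ms[of v u] inner_commute[of "M *v v" u] power2_eq_square algebra_simps)
      moreover have "(v + t *\<^sub>R u) \<bullet> (v + t *\<^sub>R u) = 1 + 2 * t * (u \<bullet> v) + t\<^sup>2 * (u \<bullet> u)"
        using v by (simp add: inner_add_left inner_add_right inner_commute power2_eq_square algebra_simps norm_eq_1)
      ultimately have "?q v + 2 * t * (u \<bullet> (M *v v)) + t\<^sup>2 * ?q u \<le> ?q v * (1 + 2 * t * (u \<bullet> v) + t\<^sup>2 * (u \<bullet> u))"
        using le by metis
      moreover have "u \<bullet> (M *v v) = u \<bullet> u + ?q v * (u \<bullet> v)"
      proof -
        have "u \<bullet> (M *v v - ?q v *\<^sub>R v) = u \<bullet> u" by (simp add: u_def)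
        then show ?thesis by (simp add: inner_diff_right)
      qed
      moreover have "2 * t * n \<le> t\<^sup>2 * (Q * n - q)"
        if "Q + 2 * t * a + t\<^sup>2 * q \<le> Q * (1 + 2 * t * s + t\<^sup>2 * n)" "a = n + Q * s" for Q q a n s :: real
        using that(1) unfolding that(2) by (simp add: algebra_simps)
      ultimately show ?thesis by blast
    qed
    have "u \<bullet> u = 0"
    proof (rule ccontr)
      assume "u \<bullet> u \<noteq> 0"
      then have pos: "u \<bullet> u > 0" by (simp add: inner_gt_zero_iff)
      \<comment> \<open>\<open>k\<close> is positive and dominates the coefficient of t^2, so
        \<open>t = (u \<bullet> u) / k\<close> makes the right side of \<open>ineq\<close> at most
        half of the left side.\<close>
      define k where "k = \<bar>?q v * (u \<bullet> u) - ?q u\<bar> + 1"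
      have "k > 0" by (simp add: k_def)
      have "2 * ((u \<bullet> u) / k) * (u \<bullet> u) \<le> ((u \<bullet> u) / k)\<^sup>2 * (?q v * (u \<bullet> u) - ?q u)" by (rule ineq)
      also have "\<dots> \<le> ((u \<bullet> u) / k)\<^sup>2 * k" by (intro mult_left_mono) (auto simp: k_def)
      also have "\<dots> = ((u \<bullet> u) / k) * (u \<bullet> u)" using \<open>k > 0\<close> by (simp add: power2_eq_square)
      finally have "2 * ((u \<bullet> u) / k) * (u \<bullet> u) \<le> ((u \<bullet> u) / k) * (u \<bullet> u)" .
      moreover have "((u \<bullet> u) / k) * (u \<bullet> u) > 0"
        using pos \<open>k > 0\<close> by (intro mult_pos_pos divide_pos_pos)
      ultimately show False by linarith
    qed
    then have eig: "M *v v = ?q v *\<^sub>R v" by (simp add: u_def)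
    have "v \<notin> B" using v by (auto simp: W_def orthogonal_def)
    moreover have "ON (insert v B)"
    proof -
      have "v \<bullet> v = 1" "\<And>b. b \<in> B \<Longrightarrow> b \<bullet> v = 0" "\<And>b. b \<in> B \<Longrightarrow> v \<bullet> b = 0"
        using v by (auto simp: W_def orthogonal_def norm_eq_1 inner_commute)
      moreover have "\<exists>l. M *v v = l *\<^sub>R v" using eig by blast
      ultimately show ?thesis using B \<open>v \<notin> B\<close> unfolding ON_def by (intro conjI) (simp, force, blast)
    qed
    ultimately show False using max[of "insert v B"] B by (simp add: ON_def)
  qed
  have "card B = CARD('n)"
    using basis_card_eq_dim[of B UNIV] span indep[OF B] by simp
  then obtain h where h: "bij_betw h (UNIV :: 'n set) B"
    using B by (metis ON_def finite_class.finite_UNIV finite_same_card_bij)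
  then have "\<forall>i. \<exists>l. M *v h i = l *\<^sub>R h i"
    using B by (auto simp: ON_def bij_betw_def)
  then obtain d where "\<And>i. M *v h i = d i *\<^sub>R h i" by metis
  moreover have "h i \<bullet> h j = (if i = j then 1 else 0)" for i j
    using B h by (auto simp: ON_def bij_betw_def inj_on_def)
  ultimately show ?thesis using that by blast
qed

text \<open>The library computes the measure of a linear image only for a well-ordered index type.  The factor
  \<open>P\<close> is therefore built from an isometry and a coordinate stretch.\<close>

lemma pos_def_factor:
  fixes M :: "real ^ 'n ^ 'n"
  assumes M: "pos_def M"
  obtains P :: "real ^ 'n \<Rightarrow> real ^ 'n"
  where "linear P" "inj P" "det M > 0" "\<And>v. norm (P v) = sqrt (v \<bullet> (M *v v))"
    "\<And>S. \<lbrakk>bounded S; S \<in> sets lebesgue\<rbrakk> \<Longrightarrow>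
      P ` S \<in> lmeasurable \<and> measure lebesgue (P ` S) = sqrt (det M) * measure lebesgue S"
proof -
  obtain h :: "'n \<Rightarrow> real ^ 'n" and d :: "'n \<Rightarrow> real"
    where h: "\<And>i j. h i \<bullet> h j = (if i = j then 1 else 0)" and d: "\<And>i. M *v h i = d i *\<^sub>R h i"
    by (rule symmetric_matrix_eigenbasis[of M]) (use M in \<open>auto simp: pos_def_def\<close>)
  have dpos: "d i > 0" for i
  proof -
    have "h i \<noteq> 0" using h[of i i] by auto
    then have "h i \<bullet> (M *v h i) > 0" using M by (simp add: pos_def_def)
    then show ?thesis by (simp add: d h)
  qed
  define E where "E = (\<chi> i j. h i $ j)"
  have row: "row i E = h i" for i by (simp add: row_def E_def vec_eq_iff)
  have orth: "orthogonal_matrix E"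
    unfolding orthogonal_matrix_orthonormal_rows row using h by (auto simp: norm_eq_1 orthogonal_def)
  then have E1: "transpose E ** E = mat 1" "E ** transpose E = mat 1"
    by (simp_all add: orthogonal_matrix_def)
  define D where "D = (\<chi> i j. if i = j then d i else 0)"
  have MD: "E ** M ** transpose E = D"
  proof -
    have "(E ** M ** transpose E) $ i $ j = D $ i $ j" for i j
    proof -
      have "(E ** M ** transpose E) $ i $ j = axis i 1 \<bullet> ((E ** (M ** transpose E)) *v axis j 1)"
        by (simp add: matrix_mul_assoc inner_axis' matrix_vector_mult_basis column_def)
      also have "\<dots> = (transpose E *v axis i 1) \<bullet> (M *v (transpose E *v axis j 1))"
        by (simp only: matrix_mul_assoc[symmetric] matrix_vector_mul_assoc[symmetric]
            inner_transpose_matrix[of _ E] transpose_transpose)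
      also have "\<dots> = h i \<bullet> (M *v h j)"
        by (simp add: matrix_vector_mult_basis column_transpose row)
      finally show ?thesis by (simp add: d h D_def)
    qed
    then show ?thesis by (simp add: vec_eq_iff)
  qed
  have detE: "det E * det E = 1"
    using E1(1) by (metis det_I det_mul det_transpose)
  have "det D = det M * (det E * det E)"
    unfolding MD[symmetric] by (simp add: det_mul)
  then have detM: "det M = (\<Prod>i\<in>UNIV. d i)"
    by (simp add: detE D_def det_diagonal)
  have lin: "linear ((*v) E)" by simp
  have normE: "norm (E *v x) = norm x" for x
    using orthogonal_transformation_matrix[of "(*v) E"] orth by (auto simp: orthogonal_transformation)
  have ET: "transpose E *v (E *v x) = x" for x
    by (simp add: matrix_vector_mul_assoc E1)
  let ?s = "\<lambda>x. \<chi> i. sqrt (d i) * x $ i"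
  \<comment> \<open>The rows of \<open>E\<close> are the eigenvectors, so \<open>P\<close> is the
    square root of the diagonal matrix \<open>D\<close> composed with \<open>E\<close>, and its
    transpose times \<open>P\<close> is \<open>M\<close>.\<close>
  define P where "P x = ?s (E *v x)" for x
  have linP: "linear P"
    by (rule linearI) (simp_all add: P_def vec_eq_iff matrix_vector_right_distrib matrix_vector_mult_scaleR algebra_simps)
  have sq: "sqrt (d i) * (sqrt (d i) * x) = d i * x" for i x
    using dpos[of i] by (simp flip: mult.assoc)
  have Dv: "(D *v y) $ i = d i * y $ i" for y i
    by (simp add: D_def matrix_vector_mult_def if_distrib[of "\<lambda>x. x * _"] cong: if_cong)
  have EME: "transpose E ** (E ** M ** transpose E) ** E = M"
  proof -
    have "transpose E ** (E ** M ** transpose E) ** E = (transpose E ** E) ** M ** (transpose E ** E)"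
      by (simp only: matrix_mul_assoc)
    then show ?thesis by (simp add: E1)
  qed
  have normP: "norm (P v) = sqrt (v \<bullet> (M *v v))" for v
  proof -
    have "v \<bullet> (M *v v) = v \<bullet> ((transpose E ** D ** E) *v v)"
      unfolding MD[symmetric]
      by (simp only: EME)
    also have "\<dots> = (E *v v) \<bullet> (D *v (E *v v))"
      by (simp only: matrix_mul_assoc[symmetric] matrix_vector_mul_assoc[symmetric]
            inner_transpose_matrix[of _ "transpose E"] transpose_transpose)
    also have "\<dots> = (\<Sum>i\<in>UNIV. d i * ((E *v v) $ i)\<^sup>2)"
      unfolding inner_vec_def by (simp add: Dv power2_eq_square algebra_simps)
    also have "\<dots> = (norm (P v))\<^sup>2"
      using dpos unfolding power2_norm_eq_inner inner_vec_def P_def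
      by (simp add: power2_eq_square algebra_simps sq)
    finally show ?thesis by simp
  qed
  have injP: "inj P"
  proof (subst linear_injective_0[OF linP], intro allI impI)
    fix v assume "P v = 0"
    then have "v \<bullet> (M *v v) = 0" using normP[of v] by simp
    then show "v = 0" using M unfolding pos_def_def by force
  qed
  have meas: "P ` S \<in> lmeasurable \<and> measure lebesgue (P ` S) = sqrt (det M) * measure lebesgue S"
    if S: "bounded S" "S \<in> sets lebesgue" for S
  proof -
    have Sm: "S \<in> lmeasurable" using S by (rule bounded_set_imp_lmeasurable)
    have "bounded ((*v) E ` S)" using S(1) lin by (simp add: bounded_linear_image linear_conv_bounded_linear)
    moreover have "(*v) E ` S \<in> sets lebesgue"
      using S(2) lin by (intro differentiable_image_in_sets_lebesgue) (auto intro: linear_imp_differentiable_on)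
    ultimately have Em: "(*v) E ` S \<in> lmeasurable" by (rule bounded_set_imp_lmeasurable)
    have diff: "norm (E *v x - E *v y) = norm (x - y)" for x y
      using normE[of "x - y"] by (simp add: matrix_vector_mult_diff_distrib)
    \<comment> \<open>An isometry preserves measure because it and its inverse are both expanding
      with constant 1.\<close>
    have "measure lebesgue S \<le> 1 ^ DIM(real^'n) * measure lebesgue ((*v) E ` S)"
      by (rule measure_expanding_map[OF Sm Em, of "(*v) E"]) (auto simp: diff)
    moreover have "measure lebesgue ((*v) E ` S) \<le> 1 ^ DIM(real^'n) * measure lebesgue S"
      by (rule measure_expanding_map[OF Em Sm, of "(*v) (transpose E)"])
        (auto simp: ET diff simp del: transpose_matrix_vector)
    ultimately have "measure lebesgue ((*v) E ` S) = measure lebesgue S" by simp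
    moreover have "P ` S = ?s ` (*v) E ` S" by (auto simp: P_def image_iff)
    moreover have "\<bar>\<Prod>i\<in>UNIV. sqrt (d i)\<bar> = sqrt (det M)"
    proof -
      have "(\<Prod>i\<in>UNIV. sqrt (d i))\<^sup>2 = (\<Prod>i\<in>UNIV. d i)"
        using dpos by (simp add: less_imp_le prod_power_distrib)
      then show ?thesis unfolding detM by (metis real_sqrt_abs)
    qed
    ultimately show ?thesis
      using measurable_stretch[OF Em, of "\<lambda>i. sqrt (d i)"] measure_stretch[OF Em, of "\<lambda>i. sqrt (d i)"] by simp
  qed
  have "det M > 0" unfolding detM using dpos by (intro prod_pos) auto
  with linP injP show ?thesis using normP meas by (rule that)
qed

text \<open>Factors of \<open>M\<close> and \<open>M'\<close> turn both quadratic forms into the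
  Euclidean norm, so \<open>measure_expanding_map\<close> applies to \<open>f\<close> conjugated by
  them; the square roots of the determinants are the Jacobians of the factors.\<close>

lemma measure_pos_def_expanding:
  fixes f :: "real ^ 'n \<Rightarrow> real ^ 'n" and M M' :: "real ^ 'n ^ 'n"
  assumes M: "pos_def M" and M': "pos_def M'"
    and S: "bounded S" "S \<in> sets lebesgue" and T: "bounded T" "T \<in> sets lebesgue"
    and fST: "f ` S \<subseteq> T" and L: "L > 0"
    and exp: "\<And>y z. y \<in> S \<Longrightarrow> z \<in> S \<Longrightarrow>
      sqrt ((y - z) \<bullet> (M *v (y - z))) \<le> L * sqrt ((f y - f z) \<bullet> (M' *v (f y - f z)))"
  shows "sqrt (det M) * measure lebesgue S \<le> L ^ CARD('n) * (sqrt (det M') * measure lebesgue T)"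
proof -
  obtain P :: "real ^ 'n \<Rightarrow> real ^ 'n" where P: "linear P" "inj P" "\<And>v. norm (P v) = sqrt (v \<bullet> (M *v v))"
    "\<And>S. \<lbrakk>bounded S; S \<in> sets lebesgue\<rbrakk> \<Longrightarrow>
      P ` S \<in> lmeasurable \<and> measure lebesgue (P ` S) = sqrt (det M) * measure lebesgue S"
    by (rule pos_def_factor[OF M]) (rule that)
  obtain P' :: "real ^ 'n \<Rightarrow> real ^ 'n" where P': "linear P'" "inj P'" "\<And>v. norm (P' v) = sqrt (v \<bullet> (M' *v v))"
    "\<And>S. \<lbrakk>bounded S; S \<in> sets lebesgue\<rbrakk> \<Longrightarrow>
      P' ` S \<in> lmeasurable \<and> measure lebesgue (P' ` S) = sqrt (det M') * measure lebesgue S"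
    by (rule pos_def_factor[OF M']) (rule that)
  define k where "k x = P' (f (inv P x))" for x
  have "measure lebesgue (P ` S) \<le> L ^ DIM(real^'n) * measure lebesgue (P' ` T)"
  proof (rule measure_expanding_map[where f = k])
    show "P ` S \<in> lmeasurable" "P' ` T \<in> lmeasurable" using P(4) P'(4) S T by auto
    show "k ` P ` S \<subseteq> P' ` T"
      using fST P(2) by (auto simp: k_def)
    fix x y assume "x \<in> P ` S" "y \<in> P ` S"
    then obtain a b where ab: "a \<in> S" "b \<in> S" "x = P a" "y = P b" by auto
    have "norm (x - y) = sqrt ((a - b) \<bullet> (M *v (a - b)))"
      by (simp add: ab flip: P(3) linear_diff[OF P(1)])
    also have "\<dots> \<le> L * norm (P' (f a - f b))" unfolding P'(3) by (rule exp[OF ab(1,2)])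
    also have "P' (f a - f b) = k x - k y" using P(2) by (simp add: k_def ab linear_diff[OF P'(1)])
    finally show "norm (x - y) \<le> L * norm (k x - k y)" .
  qed fact
  then show ?thesis using P(4)[OF S] P'(4)[OF T] by simp
qed
lemma pos_def_det_pos: "pos_def M \<Longrightarrow> det M > 0"
  by (elim pos_def_factor)

text \<open>Near one point the density is almost constant, so a comparison with frozen metrics
  yields Riemannian volumes up to \<open>1 + e\<close>. The hypothesis \<open>exp\<close> lets both
  points \<open>y\<close> and \<open>z\<close> vary but evaluates the metric at \<open>x\<close> and
  \<open>f x\<close> only; this is the form that a differential inequality for nearby trajectories
  supplies.\<close>

lemma nn_integral_expanding_map:
  fixes f :: "real ^ 'n \<Rightarrow> real ^ 'n" and G :: "real ^ 'n \<Rightarrow> real ^ 'n ^ 'n"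
  assumes V: "open V" and G: "\<And>y. y \<in> V \<Longrightarrow> pos_def (G y)" and contG: "continuous_on V G"
    and x: "x \<in> V" "f x \<in> V" and r: "r > 0" and contf: "continuous_on (ball x r) f"
    and exp: "\<And>e. e > 0 \<Longrightarrow> \<exists>d>0. \<forall>y\<in>ball x d. \<forall>z\<in>ball x d.
      (y - z) \<bullet> (G x *v (y - z)) \<le> (1 + e) * ((f y - f z) \<bullet> (G (f x) *v (f y - f z)))"
    and e: "e > 0"
  shows "\<exists>d>0. d \<le> r \<and> (\<forall>\<delta>. 0 < \<delta> \<and> \<delta> \<le> d \<longrightarrow> (\<forall>B\<in>sets borel. B \<subseteq> V \<longrightarrow>
    (\<integral>\<^sup>+ y\<in>ball x \<delta> \<inter> f -` B. ennreal (sqrt (det (G y))) \<partial>lborel) \<le>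
    ennreal (1 + e) * (\<integral>\<^sup>+ y\<in>B. ennreal (sqrt (det (G y))) \<partial>lborel)))"
proof -
  let ?n = "CARD('n)"
  define D where "D y = sqrt (det (G y))" for y
  have contD: "continuous_on V D"
    unfolding D_def det_def using contG by (intro continuous_intros) auto
  have Dpos: "D y > 0" if "y \<in> V" for y
    unfolding D_def using pos_def_det_pos[OF G[OF that]] by simp
  \<comment> \<open>\<open>?n\<close> factors \<open>q\<close> come from the Lipschitz constant in
    dimension \<open>?n\<close>, the other two from the oscillation of the density near
    \<open>x\<close> and near \<open>f x\<close>.\<close>
  define q where "q = root (?n + 2) (1 + e)"
  have q1: "q > 1" using e by (simp add: q_def)
  have qpow: "q ^ (?n + 2) = 1 + e" using e unfolding q_def by (intro real_root_pow_pos2) auto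
  have Dcont: "\<exists>d>0. ball y d \<subseteq> V \<and> (\<forall>z\<in>ball y d. D z \<le> q * D y \<and> D y \<le> q * D z)" if y: "y \<in> V" for y
  proof -
    have "isCont D y" using contD V y by (simp add: continuous_on_eq_continuous_at)
    then have lim: "(D \<longlongrightarrow> D y) (nhds y)"
      by (simp add: continuous_at tendsto_nhds_iff)
    have "D y < q * D y" "D y / q < D y" using Dpos[OF y] q1 by (auto simp: field_simps)
    then have "\<forall>\<^sub>F z in nhds y. D z < q * D y" "\<forall>\<^sub>F z in nhds y. D y / q < D z"
      using order_tendstoD[OF lim] by auto
    moreover have "\<forall>\<^sub>F z in nhds y. z \<in> V" using V y by (simp add: eventually_nhds_in_open)
    ultimately have "\<forall>\<^sub>F z in nhds y. z \<in> V \<and> D z < q * D y \<and> D y / q < D z"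
      by eventually_elim auto
    then obtain d where "d > 0" "\<forall>z. dist z y < d \<longrightarrow> z \<in> V \<and> D z < q * D y \<and> D y / q < D z"
      unfolding eventually_nhds_metric by blast
    then show ?thesis using q1
      by (intro exI[of _ d]) (force simp: dist_commute field_simps subset_eq)
  qed
  obtain d1 where d1: "d1 > 0" "ball x d1 \<subseteq> V" "\<And>z. z \<in> ball x d1 \<Longrightarrow> D z \<le> q * D x"
    using Dcont[OF x(1)] by blast
  obtain d2 where d2: "d2 > 0" "ball (f x) d2 \<subseteq> V" "\<And>z. z \<in> ball (f x) d2 \<Longrightarrow> D (f x) \<le> q * D z"
    using Dcont[OF x(2)] by blast
  have "q\<^sup>2 - 1 > 0" using q1 by (simp add: one_less_power)
  \<comment> \<open>\<open>exp\<close> concerns squared lengths, so a Lipschitz constant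
    \<open>q\<close> corresponds to the error q^2 - 1.\<close>
  from exp[OF this] obtain d3 where d3: "d3 > 0" "\<And>y z. y \<in> ball x d3 \<Longrightarrow> z \<in> ball x d3 \<Longrightarrow>
      (y - z) \<bullet> (G x *v (y - z)) \<le> q\<^sup>2 * ((f y - f z) \<bullet> (G (f x) *v (f y - f z)))"
    by auto
  have "isCont f x" using contf r by (simp add: continuous_on_eq_continuous_at)
  then obtain d4 where d4: "d4 > 0" "\<And>y. dist y x < d4 \<Longrightarrow> dist (f y) (f x) < d2"
    using d2(1) unfolding continuous_at_eps_delta by blast
  define d where "d = Min {r, d1, d3, d4}"
  have d: "d > 0" "d \<le> r" "d \<le> d1" "d \<le> d3" "d \<le> d4" using r d1 d3 d4 by (auto simp: d_def)
  have main: "(\<integral>\<^sup>+ y\<in>ball x \<delta> \<inter> f -` B. ennreal (D y) \<partial>lborel) \<le> ennreal (1 + e) * (\<integral>\<^sup>+ y\<in>B. ennreal (D y) \<partial>lborel)"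
    if \<delta>: "0 < \<delta>" "\<delta> \<le> d" and B: "B \<in> sets borel" "B \<subseteq> V" for \<delta> B
  proof -
    define S where "S = ball x \<delta> \<inter> f -` B"
    \<comment> \<open>\<open>S\<close> is so close to \<open>x\<close> that \<open>f\<close> maps it
      into this ball, on which the density is at least 1/q times its value at
      \<open>f x\<close>.\<close>
    define T where "T = B \<inter> ball (f x) d2"
    have Sb: "S \<in> sets borel"
    proof -
      have "continuous_on (ball x \<delta>) f" using contf \<delta> d by (auto elim: continuous_on_subset)
      then have "f \<in> borel_measurable (restrict_space borel (ball x \<delta>))"
        by (rule borel_measurable_continuous_on_restrict)
      from measurable_sets[OF this B(1)] show ?thesis
        unfolding S_def by (simp add: sets_restrict_space_iff space_restrict_space Int_commute)
    qed
    have Tb: "T \<in> sets borel" using B by (simp add: T_def)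
    have fST: "f ` S \<subseteq> T"
      using d4(2) \<delta> d by (auto simp: S_def T_def dist_commute)
    have bd: "bounded S" "bounded T" unfolding S_def T_def by (auto intro: bounded_subset)
    have le1: "D x * measure lebesgue S \<le> q ^ ?n * (D (f x) * measure lebesgue T)"
      unfolding D_def
    proof (rule measure_pos_def_expanding[OF G[OF x(1)] G[OF x(2)] bd(1) _ bd(2) _ fST])
      show "S \<in> sets lebesgue" "T \<in> sets lebesgue" using Sb Tb by auto
      show "q > 0" using q1 by simp
      fix y z assume "y \<in> S" "z \<in> S"
      then have "(y - z) \<bullet> (G x *v (y - z)) \<le> q\<^sup>2 * ((f y - f z) \<bullet> (G (f x) *v (f y - f z)))"
        using \<delta> d by (intro d3) (auto simp: S_def)
      from real_sqrt_le_mono[OF this] show "sqrt ((y - z) \<bullet> (G x *v (y - z))) \<le> q * sqrt ((f y - f z) \<bullet> (G (f x) *v (f y - f z)))"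
        using q1 by (simp add: real_sqrt_mult)
    qed
    have em: "emeasure lborel Y = ennreal (measure lebesgue Y)" if "bounded Y" "Y \<in> sets borel" for Y :: "(real ^ 'n) set"
    proof -
      have "Y \<in> lmeasurable" using that by (intro bounded_set_imp_lmeasurable) auto
      then have "emeasure lebesgue Y = ennreal (measure lebesgue Y)" by (simp add: emeasure_eq_measure2)
      then show ?thesis using that(2) by simp
    qed
    have "(\<integral>\<^sup>+ y\<in>S. ennreal (D y) \<partial>lborel) \<le> (\<integral>\<^sup>+ y\<in>S. ennreal (q * D x) \<partial>lborel)"
      using \<delta> d d1(3) by (intro nn_integral_mono) (auto simp: S_def indicator_def intro!: ennreal_leI)
    also have "\<dots> = ennreal (q * D x) * ennreal (measure lebesgue S)"
      using Sb by (simp add: nn_integral_cmult_indicator em bd)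
    also have "\<dots> = ennreal (q * (D x * measure lebesgue S))"
      using q1 Dpos[OF x(1)] by (simp add: mult.assoc flip: ennreal_mult')
    also have "\<dots> \<le> ennreal (q * (q ^ ?n * (D (f x) * measure lebesgue T)))"
      using le1 q1 by (intro ennreal_leI mult_left_mono) auto
    also have "\<dots> = ennreal ((1 + e) * (D (f x) / q * measure lebesgue T))"
      using q1 by (simp add: power2_eq_square power_add flip: qpow)
    also have "\<dots> = ennreal (1 + e) * (ennreal (D (f x) / q) * ennreal (measure lebesgue T))"
    proof -
      have em3: "ennreal (a * (b * c)) = ennreal a * (ennreal b * ennreal c)" if "a \<ge> 0" "b \<ge> 0" "c \<ge> 0" for a b c
        using that by (simp only: ennreal_mult mult_nonneg_nonneg)
      show ?thesis by (rule em3) (use q1 e Dpos[OF x(2)] in auto)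
    qed
    also have "ennreal (D (f x) / q) * ennreal (measure lebesgue T) = (\<integral>\<^sup>+ y\<in>T. ennreal (D (f x) / q) \<partial>lborel)"
      using Tb by (simp add: nn_integral_cmult_indicator em bd)
    also have "\<dots> \<le> (\<integral>\<^sup>+ y\<in>B. ennreal (D y) \<partial>lborel)"
      using d2(3) q1 by (intro nn_integral_mono) (auto simp: T_def indicator_def field_simps intro!: ennreal_leI)
    finally show ?thesis unfolding S_def by (simp add: mult_left_mono)
  qed
  show ?thesis
    using d(1,2) main unfolding D_def by blast
qed

section \<open>Curves and differential inequalities\<close>

text \<open>Induction along a half-line: the infimum of the failures is reached by
  \<open>limit\<close> and passed by \<open>right\<close>. It carries statements about trajectories,
  which are available chart by chart only, to all times.\<close>

lemma nonneg_real_induct [consumes 1, case_names zero right limit]: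
  fixes P :: "real \<Rightarrow> bool"
  assumes "t \<ge> 0" and zero: "P 0"
    and right: "\<And>t. t \<ge> 0 \<Longrightarrow> (\<And>s. 0 \<le> s \<Longrightarrow> s \<le> t \<Longrightarrow> P s) \<Longrightarrow> \<exists>d>0. \<forall>s. t < s \<and> s < t + d \<longrightarrow> P s"
    and limit: "\<And>t. t > 0 \<Longrightarrow> (\<And>s. 0 \<le> s \<Longrightarrow> s < t \<Longrightarrow> P s) \<Longrightarrow> P t"
  shows "P t"
proof (rule ccontr)
  assume "\<not> P t"
  define S where "S = {s. s \<ge> 0 \<and> \<not> P s}"
  define m where "m = Inf S"
  have S: "t \<in> S" "bdd_below S" using \<open>t \<ge> 0\<close> \<open>\<not> P t\<close> by (auto simp: S_def intro: bdd_belowI[of _ 0])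
  have m0: "m \<ge> 0" unfolding m_def using S by (intro cInf_greatest) (auto simp: S_def)
  have below: "P s" if "0 \<le> s" "s < m" for s
  proof (rule ccontr)
    assume "\<not> P s"
    then have "s \<in> S" using that(1) by (simp add: S_def)
    then have "m \<le> s" unfolding m_def using S(2) by (rule cInf_lower)
    then show False using that(2) by simp
  qed
  have Pm: "P m"
  proof (cases "m = 0")
    case False
    then have "m > 0" using m0 by simp
    then show ?thesis using below by (rule limit)
  next
    case True
    then show ?thesis using zero by simp
  qed
  then have upto: "P s" if "0 \<le> s" "s \<le> m" for s
    using that below[of s] by (cases "s = m") simp_all
  have "\<exists>d>0. \<forall>s. m < s \<and> s < m + d \<longrightarrow> P s"
    using m0 upto by (rule right)
  then obtain d where d: "d > 0" "\<And>s. m < s \<Longrightarrow> s < m + d \<Longrightarrow> P s" by metis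
  obtain s where "s \<in> S" "s < m + d"
    using cInf_lessD[of S "m + d"] S d(1) by (auto simp: m_def)
  then have "\<not> P s" by (simp add: S_def)
  have "s \<ge> m" unfolding m_def using \<open>s \<in> S\<close> S(2) by (rule cInf_lower)
  then consider "s = m" | "m < s" by linarith
  then show False using d(2)[of s] \<open>s < m + d\<close> \<open>\<not> P s\<close> Pm by cases simp_all
qed

text \<open>Gronwall's inequality: the derivative of \<open>p x * exp (K * x)\<close> is
  nonnegative.\<close>

lemma exp_lower_bound:
  fixes p :: "real \<Rightarrow> real"
  assumes d: "\<And>t. t \<in> {a..b} \<Longrightarrow> (p has_real_derivative p' t) (at t within {a..b})"
    and le: "\<And>t. t \<in> {a..b} \<Longrightarrow> p' t \<ge> - K * p t" and st: "a \<le> s" "s \<le> t" "t \<le> b"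
  shows "p t \<ge> exp (- K * (t - s)) * p s"
proof (cases "s = t")
  case False
  then have "s < t" using st by simp
  have "((\<lambda>x. p x * exp (K * x)) has_derivative (\<lambda>h. (p' x + K * p x) * exp (K * x) * h)) (at x within {s..t})"
    if "s \<le> x" "x \<le> t" for x
  proof -
    have "(p has_real_derivative p' x) (at x within {s..t})"
      using d[of x] that st by (auto intro: has_field_derivative_subset)
    then have "((\<lambda>x. p x * exp (K * x)) has_real_derivative (p' x + K * p x) * exp (K * x)) (at x within {s..t})"
      by (auto intro!: derivative_eq_intros simp: algebra_simps)
    then show ?thesis by (simp add: has_field_derivative_def)
  qed
  from mvt_simple[OF \<open>s < t\<close> this] obtain x where x: "x \<in> {s<..<t}"
    "p t * exp (K * t) - p s * exp (K * s) = (p' x + K * p x) * exp (K * x) * (t - s)" by auto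
  have "p' x + K * p x \<ge> 0" using le[of x] x(1) st by auto
  then have "(p' x + K * p x) * exp (K * x) * (t - s) \<ge> 0" using \<open>s < t\<close> by simp
  then have "p t * exp (K * t) \<ge> p s * exp (K * s)" using x(2) by simp
  then have "p t * exp (K * t) * exp (- K * t) \<ge> p s * exp (K * s) * exp (- K * t)"
    by (intro mult_right_mono) auto
  then show ?thesis by (simp add: algebra_simps flip: exp_add)
qed simp

lemma exp_upper_bound:
  fixes p :: "real \<Rightarrow> real"
  assumes d: "\<And>t. t \<in> {a..b} \<Longrightarrow> (p has_real_derivative p' t) (at t within {a..b})"
    and le: "\<And>t. t \<in> {a..b} \<Longrightarrow> p' t \<le> K * p t" and st: "a \<le> s" "s \<le> t" "t \<le> b"
  shows "p t \<le> exp (K * (t - s)) * p s"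
  using exp_lower_bound[of a b "\<lambda>t. - p t" "\<lambda>t. - p' t" "- K" s t] assms
  by (auto intro: derivative_intros)

text \<open>Gronwall's inequality for the squared norm, whose derivative is bounded in absolute
  value by \<open>2 * L\<close> times itself. Having both signs makes the estimate valid backwards
  in time too.\<close>

lemma norm_exp_bound:
  fixes D :: "real \<Rightarrow> 'a::real_inner"
  assumes d: "\<And>t. t \<in> {a..b} \<Longrightarrow> (D has_vector_derivative D' t) (at t within {a..b})"
    and le: "\<And>t. t \<in> {a..b} \<Longrightarrow> norm (D' t) \<le> L * norm (D t)"
    and st: "s \<in> {a..b}" "t \<in> {a..b}"
  shows "norm (D t) \<le> exp (L * \<bar>t - s\<bar>) * norm (D s)"
proof -
  define p where "p t = D t \<bullet> D t" for t
  have dp: "(p has_real_derivative 2 * (D t \<bullet> D' t)) (at t within {a..b})" if "t \<in> {a..b}" for t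
    using d[OF that] unfolding p_def has_real_derivative_iff_has_vector_derivative
    by (auto intro!: derivative_eq_intros simp: has_vector_derivative_def inner_commute algebra_simps)
  have bd: "\<bar>2 * (D t \<bullet> D' t)\<bar> \<le> 2 * L * p t" if "t \<in> {a..b}" for t
  proof -
    have "\<bar>D t \<bullet> D' t\<bar> \<le> norm (D t) * norm (D' t)" by (rule Cauchy_Schwarz_ineq2)
    also have "\<dots> \<le> norm (D t) * (L * norm (D t))" by (intro mult_left_mono le that) simp
    also have "\<dots> = L * p t" by (simp add: p_def dot_square_norm power2_eq_square)
    finally show ?thesis by simp
  qed
  have "p t \<le> exp (2 * L * \<bar>t - s\<bar>) * p s"
  proof (cases "s \<le> t")
    case True
    have "p t \<le> exp ((2 * L) * (t - s)) * p s"
    proof (rule exp_upper_bound[OF dp])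
      show "2 * (D u \<bullet> D' u) \<le> 2 * L * p u" if "u \<in> {a..b}" for u using bd[OF that] by linarith
    qed (use st True in auto)
    then show ?thesis using True by simp
  next
    case False
    have "p s \<ge> exp (- (2 * L) * (s - t)) * p t"
    proof (rule exp_lower_bound[OF dp])
      show "- (2 * L) * p u \<le> 2 * (D u \<bullet> D' u)" if "u \<in> {a..b}" for u using bd[OF that] by linarith
    qed (use st False in auto)
    then have "exp (2 * L * (s - t)) * (exp (- (2 * L) * (s - t)) * p t) \<le> exp (2 * L * (s - t)) * p s"
      by (intro mult_left_mono) auto
    then show ?thesis using False by (simp flip: mult.assoc exp_add)
  qed
  also have "exp (2 * L * \<bar>t - s\<bar>) * p s = (exp (L * \<bar>t - s\<bar>) * norm (D s))\<^sup>2"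
    by (simp add: p_def dot_square_norm power_mult_distrib mult.assoc flip: exp_double)
  finally show ?thesis
    by (simp add: p_def dot_square_norm abs_le_square_iff[symmetric])
qed

text \<open>Two moving points \<open>y\<close> and \<open>z\<close> are compared, with
  \<open>d\<close> uniform in \<open>x\<close>. The difference of two trajectories near a third one
  needs exactly this: it solves the equation linearized at the third one up to a small relative
  error.\<close>

lemma C1_uniformly_strongly_differentiable:
  fixes X :: "'a::euclidean_space \<Rightarrow> 'b::euclidean_space"
  assumes X: "\<And>x. x \<in> V \<Longrightarrow> (X has_derivative X' x) (at x)"
    and cont: "\<And>w. continuous_on V (\<lambda>x. X' x w)"
    and R: "cball x0 R' \<subseteq> V" "R < R'" and e: "e > 0"
  obtains d where "d > 0" "\<And>x y z. x \<in> cball x0 R \<Longrightarrow> y \<in> ball x d \<Longrightarrow> z \<in> ball x d \<Longrightarrow>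
    norm (X y - X z - X' x (y - z)) \<le> e * norm (y - z)"
proof -
  let ?K = "cball x0 R'" and ?n = "real DIM('a)"
  have "\<exists>d>0. \<forall>x\<in>?K. \<forall>y\<in>?K. dist y x < d \<longrightarrow> dist (X' y b) (X' x b) < e / ?n" for b
  proof -
    have "uniformly_continuous_on ?K (\<lambda>x. X' x b)"
      using cont[of b] R(1) by (intro compact_uniformly_continuous) (auto elim: continuous_on_subset)
    then show ?thesis using e by (simp add: uniformly_continuous_on_def)
  qed
  then obtain d where d: "\<And>b. d b > 0"
    "\<And>b x y. x \<in> ?K \<Longrightarrow> y \<in> ?K \<Longrightarrow> dist y x < d b \<Longrightarrow> dist (X' y b) (X' x b) < e / ?n" by metis
  \<comment> \<open>The margin \<open>R' - R\<close> keeps the small balls inside \<open>?K\<close>,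
    where continuity is uniform; each of the \<open>?n\<close> basis vectors may then contribute
    \<open>e / ?n\<close> to the operator norm.\<close>
  define d0 where "d0 = Min (insert (R' - R) (d ` (Basis :: 'a set)))"
  have "d0 > 0" "d0 \<le> R' - R" using d(1) R(2) by (auto simp: d0_def)
  moreover have "d0 \<le> d b" if "b \<in> Basis" for b
    unfolding d0_def using that by (intro Min_le) auto
  ultimately have d0: "d0 > 0" "d0 \<le> R' - R" "\<And>b. b \<in> Basis \<Longrightarrow> d0 \<le> d b" by auto
  show ?thesis
  proof (rule that[OF d0(1)])
    fix x y z assume x: "x \<in> cball x0 R" and yz: "y \<in> ball x d0" "z \<in> ball x d0"
    have sub: "ball x d0 \<subseteq> ?K"
    proof
      fix u assume "u \<in> ball x d0"
      then show "u \<in> ?K" using x d0(2) dist_triangle[of x0 u x] by simp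
    qed
    have "x \<in> ?K" using subsetD[OF sub, of x] d0(1) by simp
    have "norm (X y - X z - X' x (y - z)) \<le> norm (y - z) * e"
    proof (rule differentiable_bound_linearization[where S = "ball x d0"])
      fix t :: real assume "t \<in> {0..1}"
      then show "z + t *\<^sub>R (y - z) \<in> ball x d0"
        using convexD_alt[OF convex_ball yz(2,1), of t] by (simp add: algebra_simps)
    next
      fix u assume u: "u \<in> ball x d0"
      then have "u \<in> V" "u \<in> ?K" using sub R(1) by auto
      then show "(X has_derivative X' u) (at u within ball x d0)"
        using X by (blast intro: has_derivative_at_withinI)
      have lin: "linear (X' u)" "linear (X' x)"
        using X \<open>u \<in> V\<close> \<open>x \<in> ?K\<close> R(1) by (blast dest: has_derivative_linear)+
      show "onorm (X' u - X' x) \<le> e"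
      proof (rule onorm_le)
        fix w
        have "(X' u - X' x) w = (\<Sum>b\<in>Basis. (w \<bullet> b) *\<^sub>R (X' u b - X' x b))"
        proof -
          have "X' v w = (\<Sum>b\<in>Basis. (w \<bullet> b) *\<^sub>R X' v b)" if "linear (X' v)" for v
          proof -
            have "X' v w = X' v (\<Sum>b\<in>Basis. (w \<bullet> b) *\<^sub>R b)" by (simp add: euclidean_representation)
            then show ?thesis by (simp add: linear_sum[OF that] linear_scale[OF that])
          qed
          then show ?thesis using lin by (simp add: sum_subtractf scaleR_diff_right)
        qed
        also have "norm \<dots> \<le> (\<Sum>b\<in>(Basis :: 'a set). norm w * (e / ?n))"
        proof (rule sum_norm_le)
          fix b :: 'a assume b: "b \<in> Basis"
          have "dist u x < d b" using u d0(3)[OF b] by (simp add: dist_commute)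
          then have "norm (X' u b - X' x b) \<le> e / ?n"
            using d(2)[OF \<open>x \<in> ?K\<close> \<open>u \<in> ?K\<close>, of b] by (simp add: dist_norm)
          moreover have "\<bar>w \<bullet> b\<bar> \<le> norm w" using b by (rule Basis_le_norm)
          ultimately show "norm ((w \<bullet> b) *\<^sub>R (X' u b - X' x b)) \<le> norm w * (e / ?n)"
            unfolding norm_scaleR using e by (intro mult_mono) auto
        qed
        also have "\<dots> = e * norm w" by simp
        finally show "norm ((X' u - X' x) w) \<le> e * norm w" .
      qed
    qed (use d0(1) in auto)
    then show "norm (X y - X z - X' x (y - z)) \<le> e * norm (y - z)" by (simp add: mult.commute)
  qed
qed

lemma C1_Lipschitz_cball:
  fixes X :: "'a::euclidean_space \<Rightarrow> 'b::euclidean_space"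
  assumes X: "\<And>x. x \<in> V \<Longrightarrow> (X has_derivative X' x) (at x)"
    and cont: "\<And>w. continuous_on V (\<lambda>x. X' x w)"
    and R: "cball x0 R \<subseteq> V"
  obtains L where "L \<ge> 0" "\<And>y z. y \<in> cball x0 R \<Longrightarrow> z \<in> cball x0 R \<Longrightarrow> norm (X y - X z) \<le> L * norm (y - z)"
proof -
  have "\<exists>M\<ge>0. \<forall>x\<in>cball x0 R. norm (X' x b) \<le> M" for b
  proof -
    have "compact ((\<lambda>x. X' x b) ` cball x0 R)"
      using cont[of b] R by (intro compact_continuous_image) (auto elim: continuous_on_subset)
    then obtain M where "\<forall>y\<in>(\<lambda>x. X' x b) ` cball x0 R. norm y \<le> M"
      using compact_imp_bounded bounded_iff by metis
    then have "norm (X' x b) \<le> max M 0" if "x \<in> cball x0 R" for x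
      using that by (blast intro: order_trans[OF _ max.cobounded1])
    then show ?thesis by (intro exI[of _ "max M 0"]) auto
  qed
  then obtain M where M: "\<And>b. M b \<ge> 0" "\<And>b x. x \<in> cball x0 R \<Longrightarrow> norm (X' x b) \<le> M b" by metis
  show ?thesis
  proof (rule that[of "\<Sum>b\<in>Basis. M b"])
    fix y z assume yz: "y \<in> cball x0 R" "z \<in> cball x0 R"
    show "norm (X y - X z) \<le> (\<Sum>b\<in>Basis. M b) * norm (y - z)"
    proof (rule differentiable_bound[OF convex_cball _ _ yz])
      fix x assume x: "x \<in> cball x0 R"
      then have dx: "(X has_derivative X' x) (at x)" using X R by blast
      then show "(X has_derivative X' x) (at x within cball x0 R)"
        by (rule has_derivative_at_withinI)
      have lin: "linear (X' x)" using dx by (rule has_derivative_linear)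
      show "onorm (X' x) \<le> (\<Sum>b\<in>Basis. M b)"
      proof (rule onorm_le)
        fix w
        have "X' x w = X' x (\<Sum>b\<in>Basis. (w \<bullet> b) *\<^sub>R b)" by (simp add: euclidean_representation)
        also have "\<dots> = (\<Sum>b\<in>Basis. (w \<bullet> b) *\<^sub>R X' x b)" by (simp add: linear_sum[OF lin] linear_scale[OF lin])
        also have "norm \<dots> \<le> (\<Sum>b\<in>Basis. norm w * M b)"
          using M x by (intro sum_norm_le) (auto intro!: mult_mono Basis_le_norm)
        also have "\<dots> = (\<Sum>b\<in>Basis. M b) * norm w" by (simp add: sum_distrib_left mult.commute)
        finally show "norm (X' x w) \<le> (\<Sum>b\<in>Basis. M b) * norm w" .
      qed
    qed
  qed (use M in \<open>auto intro: sum_nonneg\<close>)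
qed

lemma has_vector_derivative_compose_has_derivative:
  assumes "(u has_vector_derivative u') (at s within S)" "(g has_derivative g') (at (u s))"
  shows "((\<lambda>s. g (u s)) has_vector_derivative g' u') (at s within S)"
proof -
  have "((\<lambda>s. g (u s)) has_derivative (\<lambda>h. g' (h *\<^sub>R u'))) (at s within S)"
    using has_derivative_compose[OF assms(1)[unfolded has_vector_derivative_def] assms(2)] .
  then show ?thesis
    unfolding has_vector_derivative_def by (simp add: linear_scale[OF has_derivative_linear[OF assms(2)]])
qed

text \<open>On a compact interval the operators are uniformly bounded through their values on a
  basis, so Gronwall's inequality started at the zero \<open>s\<close> applies in both time
  directions.\<close>

lemma linear_ODE_zero:
  fixes D :: "real \<Rightarrow> 'a::euclidean_space"
  assumes D: "\<And>t. t \<in> {a..b} \<Longrightarrow> (D has_vector_derivative A t (D t)) (at t within {a..b})"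
    and lin: "\<And>t. t \<in> {a..b} \<Longrightarrow> linear (A t)" and cont: "\<And>w. continuous_on {a..b} (\<lambda>t. A t w)"
    and zero: "s \<in> {a..b}" "D s = 0" and t: "t \<in> {a..b}"
  shows "D t = 0"
proof -
  have "\<exists>M\<ge>0. \<forall>t\<in>{a..b}. norm (A t w) \<le> M" for w
  proof -
    have "compact ((\<lambda>t. A t w) ` {a..b})" by (intro compact_continuous_image cont) simp
    then obtain M where "\<forall>y\<in>(\<lambda>t. A t w) ` {a..b}. norm y \<le> M"
      using compact_imp_bounded bounded_iff by metis
    then have "norm (A t w) \<le> max M 0" if "t \<in> {a..b}" for t
      using that by (blast intro: order_trans[OF _ max.cobounded1])
    then show ?thesis by (intro exI[of _ "max M 0"]) auto
  qed
  then obtain M where M: "\<And>w. M w \<ge> 0" "\<And>w t. t \<in> {a..b} \<Longrightarrow> norm (A t w) \<le> M w" by metis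
  have "norm (A t w) \<le> (\<Sum>i\<in>Basis. M i) * norm w" if t: "t \<in> {a..b}" for t w
  proof -
    have "A t w = A t (\<Sum>i\<in>Basis. (w \<bullet> i) *\<^sub>R i)" by (simp add: euclidean_representation)
    also have "\<dots> = (\<Sum>i\<in>Basis. (w \<bullet> i) *\<^sub>R A t i)" by (simp add: linear_sum[OF lin[OF t]] linear_scale[OF lin[OF t]])
    also have "norm \<dots> \<le> (\<Sum>i\<in>Basis. norm w * M i)"
      using M t by (intro sum_norm_le) (auto intro!: mult_mono Basis_le_norm)
    also have "\<dots> = (\<Sum>i\<in>Basis. M i) * norm w" by (simp add: sum_distrib_left mult.commute)
    finally show ?thesis .
  qed
  from norm_exp_bound[OF D this zero(1) t] show ?thesis by (simp add: zero(2))
qed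

section \<open>Matrix calculus\<close>

lemma bounded_bilinear_matrix_vector_mult:
  "bounded_bilinear ((*v) :: real ^ 'n ^ 'm \<Rightarrow> real ^ 'n \<Rightarrow> real ^ 'm)"
  by (subst bilinear_conv_bounded_bilinear[symmetric])
    (auto simp: bilinear_def matrix_vector_mult_add_rdistrib scaleR_matrix_vector_assoc intro!: linearI)

lemmas continuous_on_matrix_vector_mult [continuous_intros] =
  bounded_bilinear.continuous_on[OF bounded_bilinear_matrix_vector_mult]

lemma pos_def_invertible: "pos_def M \<Longrightarrow> invertible M"
  by (auto simp: invertible_det_nz dest: pos_def_det_pos)

lemma matrix_inv_mult_vector:
  assumes "invertible M"
  shows "M *v (matrix_inv M *v v) = v" "matrix_inv M *v (M *v v) = v"
proof -
  have "M ** matrix_inv M = mat 1 \<and> matrix_inv M ** M = mat 1"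
    using someI_ex[OF assms[unfolded invertible_def]] by (simp only: matrix_inv_def)
  then show "M *v (matrix_inv M *v v) = v" "matrix_inv M *v (M *v v) = v"
    by (simp_all add: matrix_vector_mul_assoc)
qed

text \<open>Cramer's rule writes every entry of the inverse as a quotient of determinants.\<close>

lemma continuous_on_matrix_inv:
  fixes G :: "'a::topological_space \<Rightarrow> real ^ 'n ^ 'n"
  assumes cont: "continuous_on S G" and inv: "\<And>x. x \<in> S \<Longrightarrow> invertible (G x)"
  shows "continuous_on S (\<lambda>x. matrix_inv (G x))"
proof (intro continuous_on_vec_lambda[where f = "\<lambda>k x. matrix_inv (G x) $ k", simplified vec_lambda_eta]
    continuous_on_vec_lambda[where f = "\<lambda>l x. matrix_inv (G x) $ k $ l" for k, simplified vec_lambda_eta])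
  fix k l :: 'n
  let ?M = "\<lambda>x. (\<chi> i j. if j = k then axis l 1 $ i else G x $ i $ j)"
  have detnz: "det (G x) \<noteq> 0" if "x \<in> S" for x
    using inv[OF that] by (simp add: invertible_det_nz)
  have eq: "matrix_inv (G x) $ k $ l = det (?M x) / det (G x)" if "x \<in> S" for x
  proof -
    have "matrix_inv (G x) *v axis l 1 =
      (\<chi> k. det (\<chi> i j. if j = k then axis l 1 $ i else G x $ i $ j) / det (G x))"
      by (rule iffD1[OF cramer[OF detnz[OF that]]]) (rule matrix_inv_mult_vector(1)[OF inv[OF that]])
    then have "(matrix_inv (G x) *v axis l 1) $ k = det (?M x) / det (G x)" by simp
    then show ?thesis by (simp add: matrix_vector_mult_basis column_def)
  qed
  have entry: "continuous_on S (\<lambda>x. ?M x $ i $ j)" for i j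
    using cont by (cases "j = k") (auto intro!: continuous_intros)
  have "continuous_on S (\<lambda>x. det (?M x) / det (G x))"
    unfolding det_def[of "?M _"] det_def[of "G _"]
  proof (intro continuous_on_divide continuous_on_sum continuous_on_mult continuous_on_prod continuous_on_const entry)
    show "continuous_on S (\<lambda>x. G x $ i $ p i)" for i p
      using cont by (auto intro!: continuous_intros)
    show "\<forall>x\<in>S. (\<Sum>p | p permutes UNIV. of_int (sign p) * (\<Prod>i\<in>UNIV. G x $ i $ p i)) \<noteq> 0"
      using detnz[unfolded det_def] by blast
  qed
  then show "continuous_on S (\<lambda>x. matrix_inv (G x) $ k $ l)"
    by (rule continuous_on_cong[THEN iffD2, rotated -1]) (auto simp: eq)
qed

text \<open>A product rule for a factor \<open>A\<close> that is merely continuous: the variation of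
  \<open>A\<close> is multiplied by \<open>h\<close>, which vanishes at \<open>x\<close>. With
  \<open>A\<close> the inverse metric, gradients can be differentiated without differentiating an
  inverse matrix.\<close>

lemma has_derivative_matrix_mult_zero:
  fixes A :: "'a::real_normed_vector \<Rightarrow> real ^ 'n ^ 'm"
  assumes h: "(h has_derivative h') (at x)" "h x = 0" and A: "isCont A x"
  shows "((\<lambda>y. A y *v h y) has_derivative (\<lambda>w. A x *v h' w)) (at x)"
proof -
  interpret b: bounded_bilinear "(*v) :: real ^ 'n ^ 'm \<Rightarrow> real ^ 'n \<Rightarrow> real ^ 'm"
    by (rule bounded_bilinear_matrix_vector_mult)
  obtain C where C: "C > 0" "\<And>(a :: real ^ 'n ^ 'm) b. norm (a *v b) \<le> norm a * norm b * C"
    using b.pos_bounded by blast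
  have bl: "bounded_linear h'" using h(1) by (rule has_derivative_bounded_linear)
  obtain M where M: "M > 0" "\<And>w. norm (h' w) \<le> norm w * M"
    using bounded_linear.pos_bounded[OF bl] by blast
  have rest: "((\<lambda>y. (A y - A x) *v h y) has_derivative (\<lambda>w. 0)) (at x)"
    unfolding has_derivative_at_alt
  proof (intro conjI allI impI)
    fix e :: real assume e: "e > 0"
    obtain d1 where d1: "d1 > 0" "\<And>y. norm (y - x) < d1 \<Longrightarrow> norm (h y - h x - h' (y - x)) \<le> 1 * norm (y - x)"
      using h(1) zero_less_one unfolding has_derivative_at_alt by blast
    obtain d2 where d2: "d2 > 0" "\<And>y. dist y x < d2 \<Longrightarrow> dist (A y) (A x) < e / ((M + 1) * C)"
    proof -
      have "e / ((M + 1) * C) > 0" using e M(1) C(1) by simp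
      with A that show ?thesis unfolding continuous_at_eps_delta by blast
    qed
    show "\<exists>d>0. \<forall>y. norm (y - x) < d \<longrightarrow>
        norm ((A y - A x) *v h y - (A x - A x) *v h x - 0) \<le> e * norm (y - x)"
    proof (intro exI[of _ "min d1 d2"] conjI allI impI)
      fix y assume y: "norm (y - x) < min d1 d2"
      have "norm (h y) \<le> norm (h y - h x - h' (y - x)) + norm (h' (y - x))"
        using norm_triangle_ineq[of "h y - h x - h' (y - x)" "h' (y - x)"] h(2) by simp
      also have "\<dots> \<le> (M + 1) * norm (y - x)"
        using d1(2)[of y] M(2)[of "y - x"] y by (simp add: algebra_simps)
      finally have hy: "norm (h y) \<le> (M + 1) * norm (y - x)" .
      have Ay: "norm (A y - A x) \<le> e / ((M + 1) * C)"
        using d2(2)[of y] y by (simp add: dist_norm)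
      have "norm ((A y - A x) *v h y) \<le> norm (A y - A x) * norm (h y) * C" by (rule C)
      also have "\<dots> \<le> (e / ((M + 1) * C)) * ((M + 1) * norm (y - x)) * C"
        using C(1) M(1) e Ay hy by (intro mult_right_mono mult_mono) auto
      also have "\<dots> = e * norm (y - x)" 
      proof -
        have "e / (K * C) * (K * r) * C = e * r" if "K > 0" for K r
          using that C(1) by (simp add: field_simps)
        then show ?thesis using M(1) by simp
      qed
      finally show "norm ((A y - A x) *v h y - (A x - A x) *v h x - 0) \<le> e * norm (y - x)"
        by (simp add: h(2))
    qed (use d1 d2 in auto)
  qed simp
  have "((\<lambda>y. A x *v h y) has_derivative (\<lambda>w. A x *v h' w)) (at x)"
    by (rule bounded_linear.has_derivative[OF b.bounded_linear_right h(1)])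
  from has_derivative_add[OF this rest] show ?thesis
    by (simp add: matrix_vector_mult_diff_rdistrib)
qed

lemma Ck_on_Suc_has_derivative:
  assumes "Ck_on (Suc k) S f" "x \<in> S"
  shows "(f has_derivative frechet_derivative f (at x)) (at x)"
  using assms by (simp add: frechet_derivative_works)

lemma linear_sum_axis:
  assumes "linear (L :: real ^ 'n \<Rightarrow> 'b::real_vector)"
  shows "L w = (\<Sum>i\<in>UNIV. w $ i *\<^sub>R L (axis i 1))"
proof -
  have "L w = L (\<Sum>i\<in>UNIV. w $ i *s axis i 1)" by (simp add: basis_expansion)
  then show ?thesis
    by (simp add: linear_sum[OF assms] linear_scale[OF assms] scalar_mult_eq_scaleR)
qed

section \<open>The unit gradient field of a soliton potential in a chart\<close>

text \<open>The Christoffel part of the covariant derivative: in coordinates the covariant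
  derivative of a field b along a is its directional derivative plus this vector.\<close>

definition connection_term :: "(real ^ 'n \<Rightarrow> real ^ 'n ^ 'n) \<Rightarrow> real ^ 'n \<Rightarrow> real ^ 'n \<Rightarrow> real ^ 'n \<Rightarrow> real ^ 'n" where
  "connection_term G x a b = (\<chi> k. \<Sum>i\<in>UNIV. \<Sum>j\<in>UNIV. christoffel G k i j x * a $ i * b $ j)"

definition coord_grad :: "(real ^ 'n \<Rightarrow> real) \<Rightarrow> real ^ 'n \<Rightarrow> real ^ 'n" where
  "coord_grad f x = (\<chi> i. pd i f x)"

definition riem_grad :: "(real ^ 'n \<Rightarrow> real ^ 'n ^ 'n) \<Rightarrow> (real ^ 'n \<Rightarrow> real) \<Rightarrow> real ^ 'n \<Rightarrow> real ^ 'n" where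
  "riem_grad G f x = matrix_inv (G x) *v coord_grad f x"

definition grad_norm :: "(real ^ 'n \<Rightarrow> real ^ 'n ^ 'n) \<Rightarrow> (real ^ 'n \<Rightarrow> real) \<Rightarrow> real ^ 'n \<Rightarrow> real" where
  "grad_norm G f x = sqrt (coord_grad f x \<bullet> riem_grad G f x)"

definition unit_grad :: "(real ^ 'n \<Rightarrow> real ^ 'n ^ 'n) \<Rightarrow> (real ^ 'n \<Rightarrow> real) \<Rightarrow> real ^ 'n \<Rightarrow> real ^ 'n" where
  "unit_grad G f x = (1 / grad_norm G f x) *\<^sub>R riem_grad G f x"

lemma connection_term_bilinear:
  "linear (connection_term G x a)" "linear (\<lambda>a. connection_term G x a b)"
  by (auto intro!: linearI simp: connection_term_def vec_eq_iff algebra_simps sum.distrib sum_distrib_left)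

text \<open>\<open>R\<close> stands for the scalar curvature, of which only the sign and the role as
  factor in the Hessian equation are kept; its continuity is recovered from that equation in
  \<open>cont_R\<close>.\<close>

locale soliton_chart =
  fixes V :: "(real ^ 'n) set" and G :: "real ^ 'n \<Rightarrow> real ^ 'n ^ 'n" and f :: "real ^ 'n \<Rightarrow> real"
    and R :: "real ^ 'n \<Rightarrow> real"
  assumes open_V: "open V" and smooth_G: "smooth_on V G" and smooth_f: "smooth_on V f"
    and pos: "x \<in> V \<Longrightarrow> pos_def (G x)"
    and hess: "x \<in> V \<Longrightarrow> hessian G f i j x = R x * G x $ i $ j"
    and R_nonneg: "x \<in> V \<Longrightarrow> R x \<ge> 0"
begin

abbreviation "\<Gamma> \<equiv> connection_term G"
abbreviation "Z \<equiv> riem_grad G f"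
abbreviation "N \<equiv> grad_norm G f"
abbreviation "X \<equiv> unit_grad G f"
abbreviation "\<omega> \<equiv> coord_grad f"

definition G' where "G' x = frechet_derivative G (at x)"
text \<open>The first summand is the covariant derivative of \<open>X\<close> in direction
  \<open>w\<close>; removing the Christoffel part leaves the plain coordinate derivative, as
  \<open>X_deriv\<close> confirms.\<close>

definition X' where "X' x w = (R x / N x) *\<^sub>R (w - (w \<bullet> (G x *v X x)) *\<^sub>R X x) - \<Gamma> x w (X x)"
definition V1 where "V1 = {x \<in> V. \<omega> x \<noteq> 0}"

section \<open>Identities of the Levi-Civita connection in a chart\<close>

lemma inner_G_commute: "x \<in> V \<Longrightarrow> v \<bullet> (G x *v w) = w \<bullet> (G x *v v)"
  by (rule pos_def_inner_commute[OF pos])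

lemma inner_G_pos: "x \<in> V \<Longrightarrow> v \<noteq> 0 \<Longrightarrow> v \<bullet> (G x *v v) > 0"
  using pos by (simp add: pos_def_def)

lemma inner_G_eqI:
  assumes "x \<in> V" "\<And>v. v \<bullet> (G x *v a) = v \<bullet> (G x *v b)"
  shows "a = b"
proof (rule ccontr)
  assume "a \<noteq> b"
  then have "(a - b) \<bullet> (G x *v (a - b)) > 0" using inner_G_pos assms(1) by simp
  then show False using assms(2)[of "a - b"] by (simp add: matrix_vector_mult_diff_distrib inner_diff_right)
qed

lemma G_inv: "x \<in> V \<Longrightarrow> G x *v (matrix_inv (G x) *v v) = v"
  by (rule matrix_inv_mult_vector[OF pos_def_invertible[OF pos]])

lemma G_Z: "x \<in> V \<Longrightarrow> G x *v Z x = \<omega> x"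
  by (simp add: riem_grad_def G_inv)

lemma G_deriv: "x \<in> V \<Longrightarrow> (G has_derivative G' x) (at x)"
  unfolding G'_def using smooth_G Ck_on_Suc_has_derivative[of 0 V G x] unfolding smooth_on_def by blast

lemma cont_G: "continuous_on V G"
  using smooth_G unfolding smooth_on_def by (metis Ck_on.simps(1))

lemma cont_G': "continuous_on V (\<lambda>x. G' x w)"
proof -
  have "Ck_on (Suc 0) V G" using smooth_G by (simp add: smooth_on_def)
  then show ?thesis by (simp add: G'_def)
qed

lemma G'_linear: "x \<in> V \<Longrightarrow> linear (G' x)"
  using G_deriv has_derivative_linear by blast

lemma G'_sym:
  assumes x: "x \<in> V"
  shows "a \<bullet> (G' x w *v b) = b \<bullet> (G' x w *v a)"
proof -
  have d: "((\<lambda>y. a \<bullet> (G y *v b)) has_derivative (\<lambda>w. a \<bullet> (G' x w *v b))) (at x)" for a b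
    by (intro has_derivative_inner_right bounded_linear.has_derivative[OF bounded_bilinear.bounded_linear_left
      [OF bounded_bilinear_matrix_vector_mult]] G_deriv x)
  have "((\<lambda>y. a \<bullet> (G y *v b)) has_derivative (\<lambda>w. b \<bullet> (G' x w *v a))) (at x)"
    using d[of b a] open_V x by (rule has_derivative_transform_within_open) (rule inner_G_commute)
  from fun_cong[OF has_derivative_unique[OF d this], of w] show ?thesis by simp
qed

lemma pd_G:
  assumes x: "x \<in> V"
  shows "pd i (\<lambda>y. G y $ j $ l) x = axis j 1 \<bullet> (G' x (axis i 1) *v axis l 1)"
proof -
  have "((\<lambda>y. G y $ j $ l) has_derivative (\<lambda>w. G' x w $ j $ l)) (at x)"
    using G_deriv[OF x] by (intro bounded_linear.has_derivative[OF bounded_linear_vec_nth])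
  then have "pd i (\<lambda>y. G y $ j $ l) x = G' x (axis i 1) $ j $ l"
    unfolding pd_def by (subst frechet_derivative_at[symmetric]) auto
  then show ?thesis by (simp add: inner_axis' matrix_vector_mult_basis column_def)
qed

lemma cont_christoffel: "continuous_on V (christoffel G k i j)"
proof -
  have "continuous_on V (\<lambda>x. \<Sum>l\<in>UNIV. matrix_inv (G x) $ k $ l *
      (axis j 1 \<bullet> (G' x (axis i 1) *v axis l 1) + axis i 1 \<bullet> (G' x (axis j 1) *v axis l 1)
        - axis i 1 \<bullet> (G' x (axis l 1) *v axis j 1)))"
    by (intro continuous_intros cont_G' continuous_on_matrix_inv cont_G pos_def_invertible pos)
  then have "continuous_on V (\<lambda>x. (\<Sum>l\<in>UNIV. matrix_inv (G x) $ k $ l *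
      (axis j 1 \<bullet> (G' x (axis i 1) *v axis l 1) + axis i 1 \<bullet> (G' x (axis j 1) *v axis l 1)
        - axis i 1 \<bullet> (G' x (axis l 1) *v axis j 1))) / 2)"
    by (rule continuous_on_divide[OF _ continuous_on_const]) simp
  then show ?thesis
    by (rule continuous_on_cong[THEN iffD2, rotated -1]) (auto simp: christoffel_def pd_G)
qed

text \<open>Lowering the index cancels the inverse matrix in the Christoffel symbols and leaves the
  Koszul formula for constant coordinate fields. Symmetry and metric compatibility of the connection
  then follow by comparing terms.\<close>

lemma inner_G_connection:
  assumes x: "x \<in> V"
  shows "v \<bullet> (G x *v \<Gamma> x a b) =
    (b \<bullet> (G' x a *v v) + a \<bullet> (G' x b *v v) - a \<bullet> (G' x v *v b)) / 2"
proof -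
  let ?P = "\<lambda>i j l. axis j 1 \<bullet> (G' x (axis i 1) *v axis l 1)"
  have exp: "b \<bullet> (G' x a *v v) = (\<Sum>i\<in>UNIV. \<Sum>j\<in>UNIV. \<Sum>l\<in>UNIV. a $ i * b $ j * v $ l * ?P i j l)" for a b v
  proof -
    have "b \<bullet> (G' x a *v v) = (\<Sum>i\<in>UNIV. a $ i * (b \<bullet> (G' x (axis i 1) *v v)))"
      by (subst linear_sum_axis[of "\<lambda>a. b \<bullet> (G' x a *v v)"])
        (auto intro!: linearI simp: linear_add[OF G'_linear[OF x]] linear_scale[OF G'_linear[OF x]]
          matrix_vector_mult_add_rdistrib inner_add_right scaleR_matrix_vector_assoc[symmetric])
    moreover have "b \<bullet> (M *v v) = (\<Sum>j\<in>UNIV. b $ j * (axis j 1 \<bullet> (M *v v)))" for M :: "real ^ 'n ^ 'n"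
      by (subst inner_vec_def) (simp add: inner_axis')
    moreover have "axis j 1 \<bullet> (M *v v) = (\<Sum>l\<in>UNIV. v $ l * (axis j 1 \<bullet> (M *v axis l 1)))" for M :: "real ^ 'n ^ 'n" and j
    proof -
      have "axis j 1 \<bullet> (M *v axis l 1) = M $ j $ l" for l
        by (simp add: inner_axis' matrix_vector_mult_basis column_def)
      then show ?thesis by (simp add: inner_axis' matrix_vector_mult_def[of M v] mult.commute)
    qed
    ultimately show ?thesis by (simp add: sum_distrib_left mult.assoc)
  qed
  define C where "C i j = (\<chi> k. christoffel G k i j x)" for i j
  have GC: "(G x *v C i j) $ l = (?P i j l + ?P j i l - ?P l i j) / 2" for i j l
  proof -
    have "C i j = matrix_inv (G x) *v (\<chi> l. (?P i j l + ?P j i l - ?P l i j) / 2)"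
      by (simp add: C_def vec_eq_iff christoffel_def pd_G[OF x] matrix_vector_mult_def sum_divide_distrib)
    then show ?thesis by (simp add: G_inv[OF x])
  qed
  have "\<Gamma> x a b = (\<Sum>i\<in>UNIV. \<Sum>j\<in>UNIV. (a $ i * b $ j) *\<^sub>R C i j)"
    by (simp add: connection_term_def C_def vec_eq_iff algebra_simps)
  then have "v \<bullet> (G x *v \<Gamma> x a b) = (\<Sum>i\<in>UNIV. \<Sum>j\<in>UNIV. (a $ i * b $ j) * (v \<bullet> (G x *v C i j)))"
    by (simp add: linear_sum[OF matrix_vector_mul_linear] matrix_vector_mult_scaleR inner_sum_right)
  also have "\<dots> = (\<Sum>i\<in>UNIV. \<Sum>j\<in>UNIV. \<Sum>l\<in>UNIV. a $ i * b $ j * v $ l * ((?P i j l + ?P j i l - ?P l i j) / 2))"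
    by (simp add: inner_vec_def[of v] GC sum_distrib_left mult.assoc)
  also have "\<dots> = (\<Sum>i\<in>UNIV. \<Sum>j\<in>UNIV. \<Sum>l\<in>UNIV.
      (a $ i * b $ j * v $ l * ?P i j l + a $ i * b $ j * v $ l * ?P j i l - a $ i * b $ j * v $ l * ?P l i j) / 2)"
    by (intro sum.cong refl) (simp add: distrib_left right_diff_distrib)
  also have "\<dots> = ((\<Sum>i\<in>UNIV. \<Sum>j\<in>UNIV. \<Sum>l\<in>UNIV. a $ i * b $ j * v $ l * ?P i j l)
      + (\<Sum>i\<in>UNIV. \<Sum>j\<in>UNIV. \<Sum>l\<in>UNIV. a $ i * b $ j * v $ l * ?P j i l)
      - (\<Sum>i\<in>UNIV. \<Sum>j\<in>UNIV. \<Sum>l\<in>UNIV. a $ i * b $ j * v $ l * ?P l i j)) / 2"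
    by (simp only: sum_divide_distrib[symmetric] sum.distrib sum_subtractf)
  also have "(\<Sum>i\<in>UNIV. \<Sum>j\<in>UNIV. \<Sum>l\<in>UNIV. a $ i * b $ j * v $ l * ?P j i l) = a \<bullet> (G' x b *v v)"
    unfolding exp[of a b v] by (subst sum.swap) (simp add: mult.commute)
  also have "(\<Sum>i\<in>UNIV. \<Sum>j\<in>UNIV. \<Sum>l\<in>UNIV. a $ i * b $ j * v $ l * ?P l i j) = a \<bullet> (G' x v *v b)"
  proof -
    have "(\<Sum>i\<in>UNIV. \<Sum>j\<in>UNIV. \<Sum>l\<in>UNIV. a $ i * b $ j * v $ l * ?P l i j) =
      (\<Sum>i\<in>UNIV. \<Sum>l\<in>UNIV. \<Sum>j\<in>UNIV. a $ i * b $ j * v $ l * ?P l i j)"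
      by (intro sum.cong refl sum.swap)
    also have "\<dots> = (\<Sum>l\<in>UNIV. \<Sum>i\<in>UNIV. \<Sum>j\<in>UNIV. a $ i * b $ j * v $ l * ?P l i j)"
      by (rule sum.swap)
    finally show ?thesis unfolding exp[of a v b] by (simp add: mult_ac)
  qed
  finally show ?thesis unfolding exp[of b a v] .
qed

lemma connection_sym:
  assumes "x \<in> V"
  shows "\<Gamma> x a b = \<Gamma> x b a"
proof (rule inner_G_eqI[OF assms])
  fix v
  show "v \<bullet> (G x *v \<Gamma> x a b) = v \<bullet> (G x *v \<Gamma> x b a)"
    using G'_sym[OF assms, of a v b] by (simp add: inner_G_connection[OF assms])
qed

lemma metric_compatible:
  assumes "x \<in> V"
  shows "a \<bullet> (G' x w *v b) = \<Gamma> x w a \<bullet> (G x *v b) + a \<bullet> (G x *v \<Gamma> x w b)"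
  using G'_sym[OF assms, of a w b] G'_sym[OF assms, of w a b] G'_sym[OF assms, of w b a]
  unfolding inner_G_commute[OF assms, of "\<Gamma> x w a" b] inner_G_connection[OF assms] by (simp add: field_simps)

section \<open>Derivatives of the potential, its gradient and the unit gradient field\<close>

lemma f_deriv: "x \<in> V \<Longrightarrow> (f has_derivative (\<lambda>w. \<omega> x \<bullet> w)) (at x)"
proof -
  assume x: "x \<in> V"
  have d: "(f has_derivative frechet_derivative f (at x)) (at x)"
    using smooth_f Ck_on_Suc_has_derivative[of 0 V f x] x unfolding smooth_on_def by blast
  have "frechet_derivative f (at x) = (\<lambda>w. \<omega> x \<bullet> w)"
  proof
    fix w show "frechet_derivative f (at x) w = \<omega> x \<bullet> w"
      unfolding linear_sum_axis[OF has_derivative_linear[OF d], of w]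
      by (simp add: inner_vec_def coord_grad_def pd_def mult.commute)
  qed
  with d show ?thesis by simp
qed

lemma Ck_pd: "Ck_on k V (pd i f)"
proof -
  have "Ck_on (Suc k) V f" using smooth_f by (simp add: smooth_on_def)
  then have "Ck_on k V (\<lambda>x. frechet_derivative f (at x) (axis i 1))" by simp
  moreover have "pd i f = (\<lambda>x. frechet_derivative f (at x) (axis i 1))" by (simp add: pd_def fun_eq_iff)
  ultimately show ?thesis by simp
qed

lemma pd_deriv: "x \<in> V \<Longrightarrow> (pd i f has_derivative (\<lambda>w. \<Sum>j\<in>UNIV. w $ j * pd j (pd i f) x)) (at x)"
proof -
  assume x: "x \<in> V"
  have d: "(pd i f has_derivative frechet_derivative (pd i f) (at x)) (at x)"
    using Ck_on_Suc_has_derivative[OF Ck_pd x] .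
  have "frechet_derivative (pd i f) (at x) = (\<lambda>w. \<Sum>j\<in>UNIV. w $ j * pd j (pd i f) x)"
  proof
    fix w show "frechet_derivative (pd i f) (at x) w = (\<Sum>j\<in>UNIV. w $ j * pd j (pd i f) x)"
      unfolding linear_sum_axis[OF has_derivative_linear[OF d], of w] by (simp add: pd_def[of _ "pd i f"])
  qed
  with d show ?thesis by simp
qed

lemma cont_pd: "continuous_on V (pd i f)" "continuous_on V (pd j (pd i f))"
proof -
  show "continuous_on V (pd i f)" using Ck_pd[of 0] by simp
  have "continuous_on V (\<lambda>x. frechet_derivative (pd i f) (at x) (axis j 1))"
    using Ck_pd[of "Suc 0" i] by simp
  moreover have "pd j (pd i f) = (\<lambda>x. frechet_derivative (pd i f) (at x) (axis j 1))" by (simp add: pd_def fun_eq_iff)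
  ultimately show "continuous_on V (pd j (pd i f))" by simp
qed

lemma cont_grad: "continuous_on V \<omega>"
  unfolding coord_grad_def[abs_def] by (intro continuous_on_vec_lambda cont_pd)

text \<open>The diagonal entries of the metric are positive, so a diagonal entry of the Hessian
  equation can be solved for \<open>R\<close>.\<close>

lemma cont_R: "continuous_on V R"
proof -
  fix i :: 'n
  have Gii: "G x $ i $ i \<noteq> 0" if "x \<in> V" for x
    using inner_G_pos[OF that, of "axis i 1"]
    by (simp add: inner_axis' matrix_vector_mult_basis column_def axis_eq_0_iff)
  have "continuous_on V (\<lambda>x. hessian G f i i x / G x $ i $ i)"
    unfolding hessian_def using Gii
    by (intro continuous_intros cont_pd cont_christoffel cont_G) auto
  then show ?thesis
    by (rule continuous_on_cong[THEN iffD2, rotated -1]) (use hess Gii in \<open>auto simp: hess\<close>)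
qed

text \<open>This is the Hessian equation solved for the second partial derivatives. Only pairings
  with \<open>D w\<close> are recorded, since the later computations compare vectors by pairing
  them.\<close>

lemma grad_deriv:
  assumes x: "x \<in> V"
  obtains D where "(\<omega> has_derivative D) (at x)"
    "\<And>v w. v \<bullet> D w = R x * (v \<bullet> (G x *v w)) + \<Gamma> x w v \<bullet> \<omega> x"
proof
  let ?D = "\<lambda>w. \<chi> i. \<Sum>j\<in>UNIV. w $ j * pd j (pd i f) x"
  show "(\<omega> has_derivative ?D) (at x)"
    by (subst has_derivative_componentwise_within)
      (auto simp: Basis_vec_def inner_axis coord_grad_def intro: pd_deriv[OF x])
  fix v w
  have "pd j (pd i f) x = R x * G x $ i $ j + (\<Sum>k\<in>UNIV. christoffel G k j i x * pd k f x)" for i j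
  proof -
    have "G x $ i $ j = G x $ j $ i"
      using inner_G_commute[OF x, of "axis i 1" "axis j 1"]
      by (simp add: inner_axis' matrix_vector_mult_basis column_def)
    then show ?thesis using hess[OF x, of j i] by (simp add: hessian_def)
  qed
  then have "v \<bullet> ?D w = (\<Sum>i\<in>UNIV. \<Sum>j\<in>UNIV. R x * (v $ i * G x $ i $ j * w $ j))
      + (\<Sum>i\<in>UNIV. \<Sum>j\<in>UNIV. \<Sum>k\<in>UNIV. christoffel G k j i x * w $ j * v $ i * pd k f x)"
    by (simp add: inner_vec_def sum_distrib_left sum_distrib_right distrib_left distrib_right sum.distrib mult_ac)
  also have "(\<Sum>i\<in>UNIV. \<Sum>j\<in>UNIV. R x * (v $ i * G x $ i $ j * w $ j)) = R x * (v \<bullet> (G x *v w))"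
    by (simp add: inner_vec_def matrix_vector_mult_def sum_distrib_left mult.assoc)
  also have "(\<Sum>i\<in>UNIV. \<Sum>j\<in>UNIV. \<Sum>k\<in>UNIV. christoffel G k j i x * w $ j * v $ i * pd k f x) = \<Gamma> x w v \<bullet> \<omega> x"
  proof -
    have "\<Gamma> x w v \<bullet> \<omega> x = (\<Sum>k\<in>UNIV. \<Sum>j\<in>UNIV. \<Sum>i\<in>UNIV. christoffel G k j i x * w $ j * v $ i * pd k f x)"
      by (simp add: inner_vec_def connection_term_def coord_grad_def sum_distrib_right)
    also have "\<dots> = (\<Sum>j\<in>UNIV. \<Sum>k\<in>UNIV. \<Sum>i\<in>UNIV. christoffel G k j i x * w $ j * v $ i * pd k f x)"
      by (rule sum.swap)
    also have "\<dots> = (\<Sum>j\<in>UNIV. \<Sum>i\<in>UNIV. \<Sum>k\<in>UNIV. christoffel G k j i x * w $ j * v $ i * pd k f x)"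
      by (intro sum.cong refl sum.swap)
    also have "\<dots> = (\<Sum>i\<in>UNIV. \<Sum>j\<in>UNIV. \<Sum>k\<in>UNIV. christoffel G k j i x * w $ j * v $ i * pd k f x)"
      by (rule sum.swap)
    finally show ?thesis by simp
  qed
  finally show "v \<bullet> ?D w = R x * (v \<bullet> (G x *v w)) + \<Gamma> x w v \<bullet> \<omega> x" .
qed

text \<open>In covariant terms: the soliton equation with one index raised says that the covariant
  derivative of the gradient is \<open>R\<close> times the identity.\<close>

lemma Z_deriv:
  assumes x: "x \<in> V"
  shows "(Z has_derivative (\<lambda>w. R x *\<^sub>R w - \<Gamma> x w (Z x))) (at x)"
proof -
  obtain D where D: "(\<omega> has_derivative D) (at x)"
    "\<And>v w. v \<bullet> D w = R x * (v \<bullet> (G x *v w)) + \<Gamma> x w v \<bullet> \<omega> x"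
    by (rule grad_deriv[OF x]) blast
  \<comment> \<open>\<open>?h\<close> vanishes at \<open>x\<close>, and
    \<open>matrix_inv (G y)\<close> applied to \<open>?h y\<close> is \<open>Z y - Z x\<close>, so
    the inverse metric has to be continuous only.\<close>
  let ?h = "\<lambda>y. \<omega> y - \<omega> x - (G y - G x) *v Z x" and ?h' = "\<lambda>w. D w - G' x w *v Z x"
  have h: "(?h has_derivative ?h') (at x)"
  proof -
    have "(?h has_derivative (\<lambda>w. (D w - 0) - (G' x w - 0) *v Z x)) (at x)"
      by (intro has_derivative_diff has_derivative_const D(1) G_deriv[OF x]
        bounded_linear.has_derivative[OF bounded_bilinear.bounded_linear_left[OF bounded_bilinear_matrix_vector_mult]])
    then show ?thesis by simp
  qed
  have "isCont (\<lambda>y. matrix_inv (G y)) x"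
    using continuous_on_matrix_inv[OF cont_G] pos_def_invertible[OF pos] open_V x
    by (simp add: continuous_on_eq_continuous_at)
  from has_derivative_matrix_mult_zero[OF h _ this]
  have "((\<lambda>y. matrix_inv (G y) *v ?h y) has_derivative (\<lambda>w. matrix_inv (G x) *v ?h' w)) (at x)" by simp
  then have "((\<lambda>y. Z y - Z x) has_derivative (\<lambda>w. matrix_inv (G x) *v ?h' w)) (at x)"
    using open_V x
  proof (rule has_derivative_transform_within_open)
    fix y assume y: "y \<in> V"
    have h: "?h y = \<omega> y - G y *v Z x"
      by (simp add: matrix_vector_mult_diff_rdistrib G_Z[OF x])
    show "matrix_inv (G y) *v ?h y = Z y - Z x"
      unfolding h by (simp add: matrix_vector_mult_diff_distrib riem_grad_def[of G f y]
          matrix_inv_mult_vector(2)[OF pos_def_invertible[OF pos[OF y]]])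
  qed
  from has_derivative_add[OF this has_derivative_const[of "Z x"]]
  have "(Z has_derivative (\<lambda>w. matrix_inv (G x) *v ?h' w)) (at x)" by simp
  moreover have "matrix_inv (G x) *v ?h' w = R x *\<^sub>R w - \<Gamma> x w (Z x)" for w
  proof (rule inner_G_eqI[OF x])
    fix v
    show "v \<bullet> (G x *v (matrix_inv (G x) *v ?h' w)) = v \<bullet> (G x *v (R x *\<^sub>R w - \<Gamma> x w (Z x)))"
      by (simp add: G_inv[OF x] inner_diff_right D(2) metric_compatible[OF x] G_Z[OF x]
          matrix_vector_mult_diff_distrib matrix_vector_mult_scaleR)
  qed
  ultimately show ?thesis by simp
qed

lemma grad_Z: "x \<in> V \<Longrightarrow> \<omega> x \<bullet> Z x = Z x \<bullet> (G x *v Z x)"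
  by (simp add: G_Z inner_commute)

lemma N_sq:
  assumes x: "x \<in> V"
  shows "Z x \<bullet> (G x *v Z x) = N x * N x"
proof -
  have "Z x \<bullet> (G x *v Z x) \<ge> 0" using inner_G_pos[OF x, of "Z x"] by (cases "Z x = 0") auto
  then show ?thesis by (simp add: grad_norm_def grad_Z[OF x])
qed

lemma V1_sub: "x \<in> V1 \<Longrightarrow> x \<in> V" by (simp add: V1_def)

lemma N_pos: "x \<in> V1 \<Longrightarrow> N x > 0"
proof -
  assume x: "x \<in> V1"
  then have "Z x \<noteq> 0" using G_Z[OF V1_sub[OF x]] by (auto simp: V1_def)
  then have "Z x \<bullet> (G x *v Z x) > 0" using inner_G_pos V1_sub[OF x] by blast
  then show ?thesis by (simp add: grad_norm_def grad_Z[OF V1_sub[OF x]])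
qed

lemma open_V1: "open V1"
proof -
  have "open (V \<inter> \<omega> -` (- {0}))"
    by (rule continuous_open_preimage[OF cont_grad open_V]) auto
  moreover have "V \<inter> \<omega> -` (- {0}) = V1" by (auto simp: V1_def)
  ultimately show ?thesis by simp
qed

text \<open>In the derivative of |grad F|^2 = dF(grad F) the Christoffel terms from the covector and
  from the vector cancel, which leaves 2 R dF(w).\<close>

lemma N_deriv:
  assumes x: "x \<in> V1"
  shows "(N has_derivative (\<lambda>w. R x * (w \<bullet> (G x *v X x)))) (at x)"
proof -
  have xV: "x \<in> V" using x by (rule V1_sub)
  obtain D where D: "(\<omega> has_derivative D) (at x)"
    "\<And>v w. v \<bullet> D w = R x * (v \<bullet> (G x *v w)) + \<Gamma> x w v \<bullet> \<omega> x"
    by (rule grad_deriv[OF xV]) blast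
  have pos: "\<omega> x \<bullet> Z x > 0" using N_pos[OF x] by (simp add: grad_norm_def)
  have d1: "((\<lambda>y. \<omega> y \<bullet> Z y) has_derivative (\<lambda>w. \<omega> x \<bullet> (R x *\<^sub>R w - \<Gamma> x w (Z x)) + D w \<bullet> Z x)) (at x)"
    by (intro has_derivative_inner D(1) Z_deriv[OF xV])
  have d2: "\<omega> x \<bullet> (R x *\<^sub>R w - \<Gamma> x w (Z x)) + D w \<bullet> Z x = 2 * R x * (w \<bullet> \<omega> x)" for w
  proof -
    have "D w \<bullet> Z x = R x * (w \<bullet> \<omega> x) + \<Gamma> x w (Z x) \<bullet> \<omega> x"
      using D(2)[of "Z x" w] inner_G_commute[OF xV, of "Z x" w] by (simp only: inner_commute[of "D w"] G_Z[OF xV])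
    moreover have "\<omega> x \<bullet> (R x *\<^sub>R w - \<Gamma> x w (Z x)) = R x * (w \<bullet> \<omega> x) - \<Gamma> x w (Z x) \<bullet> \<omega> x"
      by (subst inner_commute) (simp add: inner_diff_left)
    ultimately show ?thesis by simp
  qed
  have "((\<lambda>y. \<omega> y \<bullet> Z y) has_derivative (\<lambda>w. 2 * R x * (w \<bullet> \<omega> x))) (at x)"
    using d1 unfolding d2 .
  from DERIV_compose_FDERIV[OF DERIV_real_sqrt[OF pos] this]
  have A: "(N has_derivative (\<lambda>w. 2 * R x * (w \<bullet> \<omega> x) * (inverse (sqrt (\<omega> x \<bullet> Z x)) / 2))) (at x)"
    by (simp only: grad_norm_def[abs_def])
  have B: "2 * R x * (w \<bullet> \<omega> x) * (inverse (sqrt (\<omega> x \<bullet> Z x)) / 2) = R x * (w \<bullet> (G x *v X x))" for w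
  proof -
    have "w \<bullet> (G x *v X x) = (w \<bullet> \<omega> x) * inverse (N x)"
      by (simp add: unit_grad_def matrix_vector_mult_scaleR G_Z[OF xV] divide_inverse)
    moreover have "sqrt (\<omega> x \<bullet> Z x) = N x" by (simp only: grad_norm_def)
    ultimately show ?thesis by simp
  qed
  show ?thesis using A unfolding B .
qed

lemma N_X: "x \<in> V1 \<Longrightarrow> N x *\<^sub>R X x = Z x"
  using N_pos[of x] by (simp add: unit_grad_def)

lemma X_unit: "x \<in> V1 \<Longrightarrow> X x \<bullet> (G x *v X x) = 1"
  using N_pos[of x] by (simp add: unit_grad_def matrix_vector_mult_scaleR N_sq[OF V1_sub])

lemma grad_X: "x \<in> V1 \<Longrightarrow> \<omega> x \<bullet> X x = N x"
  using N_pos[of x] by (simp add: unit_grad_def grad_norm_def real_div_sqrt)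

lemma X_deriv:
  assumes x: "x \<in> V1"
  shows "(X has_derivative X' x) (at x)"
proof -
  have xV: "x \<in> V" using x by (rule V1_sub)
  have N0: "N x \<noteq> 0" using N_pos[OF x] by simp
  have eqX: "X = (\<lambda>y. inverse (N y) *\<^sub>R Z y)"
    by (simp add: fun_eq_iff unit_grad_def divide_inverse)
  have der: "((\<lambda>y. inverse (N y) *\<^sub>R Z y) has_derivative
      (\<lambda>w. inverse (N x) *\<^sub>R (R x *\<^sub>R w - \<Gamma> x w (Z x)) +
        (- (inverse (N x) * (R x * (w \<bullet> (G x *v X x))) * inverse (N x))) *\<^sub>R Z x)) (at x)"
    by (rule has_derivative_scaleR[OF Deriv.has_derivative_inverse[OF N0 N_deriv[OF x]] Z_deriv[OF xV]])
  have eqX': "inverse (N x) *\<^sub>R (R x *\<^sub>R w - \<Gamma> x w (Z x)) +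
        (- (inverse (N x) * (R x * (w \<bullet> (G x *v X x))) * inverse (N x))) *\<^sub>R Z x = X' x w" for w
  proof -
    have "\<Gamma> x w (Z x) = N x *\<^sub>R \<Gamma> x w (X x)"
      unfolding N_X[OF x, symmetric] by (rule linear_scale[OF connection_term_bilinear(1)])
    moreover have "Z x = N x *\<^sub>R X x" using N_X[OF x] by simp
    ultimately show ?thesis
      using N0 by (simp add: X'_def scaleR_diff_right divide_inverse mult.commute)
  qed
  have "(X has_derivative (\<lambda>w. X' x w)) (at x)" using der unfolding eqX' eqX[symmetric] .
  then show ?thesis .
qed

lemma cont_X: "continuous_on V1 X"
  using X_deriv by (intro continuous_at_imp_continuous_on ballI has_derivative_continuous)

lemma cont_N: "continuous_on V1 N"
  using N_deriv by (intro continuous_at_imp_continuous_on ballI has_derivative_continuous)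

lemma continuous_on_connection:
  assumes "continuous_on S u" "u ` S \<subseteq> V" "continuous_on S a" "continuous_on S b"
  shows "continuous_on S (\<lambda>s. \<Gamma> (u s) (a s) (b s))"
proof -
  have "continuous_on S (\<lambda>s. christoffel G k i j (u s))" for k i j
    using cont_christoffel assms(1,2) by (rule continuous_on_compose2)
  then show ?thesis
    unfolding connection_term_def using assms by (intro continuous_on_vec_lambda continuous_intros)
qed

lemma cont_X': "continuous_on V1 (\<lambda>x. X' x w)"
proof -
  have sub: "V1 \<subseteq> V" by (auto simp: V1_def)
  have N0: "\<forall>x\<in>V1. N x \<noteq> 0" by (auto dest: N_pos)
  show ?thesis
    unfolding X'_def
    by (intro continuous_intros continuous_on_connection cont_X cont_N continuous_on_subset[OF cont_R sub]
        continuous_on_subset[OF cont_G sub]) (simp_all add: sub N0)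
qed

lemma X'_linear: "x \<in> V1 \<Longrightarrow> linear (X' x)"
  using X_deriv has_derivative_linear by blast

text \<open>The direction \<open>X x\<close> has no component orthogonal to itself, so the covariant
  derivative of \<open>X\<close> along \<open>X\<close> vanishes: integral curves of
  \<open>X\<close> are geodesics.\<close>

lemma X'_X: "x \<in> V1 \<Longrightarrow> X' x (X x) = - \<Gamma> x (X x) (X x)"
  by (simp add: X'_def X_unit)

text \<open>The left-hand side is the Lie derivative of the metric along the unit gradient field, evaluated at \<open>(w, w)\<close>.\<close>

lemma expanding:
  assumes x: "x \<in> V1"
  shows "2 * (w \<bullet> (G x *v X' x w)) + w \<bullet> (G' x (X x) *v w) \<ge> 0"
proof -
  have xV: "x \<in> V" using x by (rule V1_sub)
  let ?c = "w \<bullet> (G x *v X x)"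
  have "w \<bullet> (G' x (X x) *v w) = 2 * (w \<bullet> (G x *v \<Gamma> x w (X x)))"
    by (simp add: metric_compatible[OF xV] inner_G_commute[OF xV, of "\<Gamma> x w (X x)" w] connection_sym[OF xV, of "X x"])
  then have eq: "2 * (w \<bullet> (G x *v X' x w)) + w \<bullet> (G' x (X x) *v w) = 2 * (R x / N x) * (w \<bullet> (G x *v w) - ?c\<^sup>2)"
    by (simp add: X'_def matrix_vector_mult_diff_distrib matrix_vector_mult_scaleR inner_diff_right
        power2_eq_square algebra_simps)
  \<comment> \<open>The squared length of the component of \<open>w\<close> orthogonal to the unit
    vector \<open>X x\<close>; its sign is the Cauchy-Schwarz inequality for the metric.\<close>
  have "(w - ?c *\<^sub>R X x) \<bullet> (G x *v (w - ?c *\<^sub>R X x)) \<ge> 0"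
    using inner_G_pos[OF xV, of "w - ?c *\<^sub>R X x"] by (cases "w - ?c *\<^sub>R X x = 0") auto
  then have "w \<bullet> (G x *v w) - ?c\<^sup>2 \<ge> 0"
    by (simp add: matrix_vector_mult_diff_distrib matrix_vector_mult_scaleR inner_diff_right inner_diff_left
        X_unit[OF x] inner_G_commute[OF xV, of "X x" w] power2_eq_square)
  then show ?thesis unfolding eq using R_nonneg[OF xV] N_pos[OF x] by simp
qed

subsection \<open>Trajectories inside a coordinate ball\<close>

lemma integral_curves_agree:
  assumes R: "cball x0 r \<subseteq> V1"
    and u: "\<And>s. s \<in> {a..b} \<Longrightarrow> u s \<in> cball x0 r" "\<And>s. s \<in> {a..b} \<Longrightarrow> (u has_vector_derivative X (u s)) (at s within {a..b})"
    and v: "\<And>s. s \<in> {a..b} \<Longrightarrow> v s \<in> cball x0 r" "\<And>s. s \<in> {a..b} \<Longrightarrow> (v has_vector_derivative X (v s)) (at s within {a..b})"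
    and st: "s \<in> {a..b}" "u s = v s" "t \<in> {a..b}"
  shows "u t = v t"
proof -
  obtain L where L: "L \<ge> 0" "\<And>y z. y \<in> cball x0 r \<Longrightarrow> z \<in> cball x0 r \<Longrightarrow> norm (X y - X z) \<le> L * norm (y - z)"
    by (rule C1_Lipschitz_cball[OF X_deriv cont_X' R]) (assumption, rule that)
  have "norm (u t - v t) \<le> exp (L * \<bar>t - s\<bar>) * norm (u s - v s)"
  proof (rule norm_exp_bound[OF _ _ st(1,3)])
    show "((\<lambda>t. u t - v t) has_vector_derivative X (u t) - X (v t)) (at t within {a..b})" if "t \<in> {a..b}" for t
      using u(2)[OF that] v(2)[OF that] by (rule has_vector_derivative_diff)
    show "norm (X (u t) - X (v t)) \<le> L * norm (u t - v t)" if "t \<in> {a..b}" for t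
      using L(2) u(1) v(1) that by blast
  qed
  then show ?thesis by (simp add: st(2))
qed

text \<open>Since integral curves of \<open>X\<close> are geodesics, the defect between the velocity
  of a geodesic and \<open>X\<close> solves a homogeneous linear equation; it vanishes at
  \<open>s\<close> and hence everywhere.\<close>

lemma geodesic_is_integral_curve:
  assumes u: "\<And>s. s \<in> {a..b} \<Longrightarrow> u s \<in> V1" "\<And>s. s \<in> {a..b} \<Longrightarrow> (u has_vector_derivative u' s) (at s within {a..b})"
    and u': "\<And>s. s \<in> {a..b} \<Longrightarrow> (u' has_vector_derivative - \<Gamma> (u s) (u' s) (u' s)) (at s within {a..b})"
    and st: "s \<in> {a..b}" "u' s = X (u s)" "t \<in> {a..b}"
  shows "u' t = X (u t)"
proof -
  define D where "D s = u' s - X (u s)" for s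
  \<comment> \<open>Expanding the geodesic equation around \<open>X\<close> leaves a term quadratic
    in \<open>D\<close>. Reading one of its two factors as a known coefficient along the curve makes
    the equation linear.\<close>
  define A where "A s w = - 2 *\<^sub>R \<Gamma> (u s) (X (u s)) w - \<Gamma> (u s) (D s) w - X' (u s) w" for s w
  have cu: "continuous_on {a..b} u" "continuous_on {a..b} u'"
    using continuous_on_vector_derivative[OF u(2)] continuous_on_vector_derivative[OF u'] by auto
  have uV: "u ` {a..b} \<subseteq> V1" using u(1) by auto
  have uV': "u ` {a..b} \<subseteq> V" using uV by (auto dest: V1_sub)
  have cX: "continuous_on {a..b} (\<lambda>s. X (u s))" using cont_X cu(1) uV by (rule continuous_on_compose2)
  have cD: "continuous_on {a..b} D" unfolding D_def using cu(2) cX by (rule continuous_on_diff)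
  have "D t = 0"
  proof (rule linear_ODE_zero[where A = A, OF _ _ _ st(1) _ st(3)])
    fix s assume s: "s \<in> {a..b}"
    have x: "u s \<in> V1" "u s \<in> V" using u(1)[OF s] V1_sub by auto
    have lin1: "linear (\<Gamma> (u s) a)" for a by (rule connection_term_bilinear)
    have lin2: "linear (\<lambda>a. \<Gamma> (u s) a b)" for b by (rule connection_term_bilinear)
    show "linear (A s)" unfolding A_def[abs_def]
      by (intro linear_compose_sub linear_compose_scale_right lin1 X'_linear x)
    have "(D has_vector_derivative - \<Gamma> (u s) (u' s) (u' s) - X' (u s) (u' s)) (at s within {a..b})"
      unfolding D_def[abs_def]
      by (intro has_vector_derivative_diff u' s has_vector_derivative_compose_has_derivative[OF u(2)[OF s] X_deriv[OF x(1)]])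
    moreover have "- \<Gamma> (u s) (u' s) (u' s) - X' (u s) (u' s) = A s (D s)"
    proof -
      let ?X = "X (u s)"
      have eq: "u' s = ?X + D s" by (simp add: D_def)
      have "\<Gamma> (u s) (u' s) (u' s) = \<Gamma> (u s) ?X ?X + \<Gamma> (u s) ?X (D s) + (\<Gamma> (u s) (D s) ?X + \<Gamma> (u s) (D s) (D s))"
        unfolding eq linear_add[OF lin1] linear_add[OF lin2] by (simp add: algebra_simps)
      moreover have "X' (u s) (u' s) = - \<Gamma> (u s) ?X ?X + X' (u s) (D s)"
        unfolding eq linear_add[OF X'_linear[OF x(1)]] X'_X[OF x(1)] ..
      moreover have "\<Gamma> (u s) (D s) ?X = \<Gamma> (u s) ?X (D s)" by (rule connection_sym[OF x(2)])
      ultimately show ?thesis by (simp add: A_def scaleR_2)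
    qed
    ultimately show "(D has_vector_derivative A s (D s)) (at s within {a..b})" by simp
  next
    show "continuous_on {a..b} (\<lambda>t. A t w)" for w
      unfolding A_def
      by (intro continuous_intros continuous_on_connection cu cX cD uV' continuous_on_compose2[OF cont_X' cu(1) uV])
  qed (simp add: D_def st(2))
  then show ?thesis by (simp add: D_def)
qed

text \<open>Along a trajectory the derivative of \<open>N\<close> is \<open>R\<close>, and the
  derivative of \<open>f\<close> is \<open>N\<close>.\<close>

lemma along_integral_curve:
  assumes u: "\<And>s. s \<in> {a..b} \<Longrightarrow> u s \<in> V1" "\<And>s. s \<in> {a..b} \<Longrightarrow> (u has_vector_derivative X (u s)) (at s within {a..b})"
    and st: "a \<le> s" "s \<le> t" "t \<le> b"
  shows "N (u s) \<le> N (u t)" "f (u t) - f (u s) \<ge> N (u s) * (t - s)"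
proof -
  have dN: "((\<lambda>s. N (u s)) has_real_derivative R (u s)) (at s within {a..b})" if "s \<in> {a..b}" for s
    using has_vector_derivative_compose_has_derivative[OF u(2)[OF that] N_deriv[OF u(1)[OF that]]]
    by (simp add: X_unit[OF u(1)[OF that]] has_real_derivative_iff_has_vector_derivative)
  have mono: "N (u s) \<le> N (u t)" if "a \<le> s" "s \<le> t" "t \<le> b" for s t
    using exp_lower_bound[OF dN, of "0" s t] that R_nonneg u(1) by (simp add: V1_sub)
  then show "N (u s) \<le> N (u t)" using st by blast
  have df: "((\<lambda>r. f (v r) - k * r) has_real_derivative N (v r) - k) (at r within S)"
    if v: "(v has_vector_derivative X (v r)) (at r within S)" "v r \<in> V1" for v r k S
  proof -
    have "((\<lambda>r. f (v r)) has_real_derivative N (v r)) (at r within S)"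
      using has_vector_derivative_compose_has_derivative[OF v(1) f_deriv[OF V1_sub[OF v(2)]]]
      by (simp add: grad_X[OF v(2)] has_real_derivative_iff_has_vector_derivative)
    then show ?thesis by (auto intro!: derivative_eq_intros)
  qed
  \<comment> \<open>Plain monotonicity, obtained as the case \<open>K = 0\<close> of the exponential
    bound.\<close>
  have "exp (- 0 * (t - s)) * (f (u s) - N (u s) * s) \<le> f (u t) - N (u s) * t"
  proof (rule exp_lower_bound[of s t "\<lambda>r. f (u r) - N (u s) * r" "\<lambda>r. N (u r) - N (u s)"])
    fix r assume r: "r \<in> {s..t}"
    then have r': "r \<in> {a..b}" using st by auto
    have "(u has_vector_derivative X (u r)) (at r within {s..t})"
      using u(2)[OF r'] by (rule has_vector_derivative_within_subset) (use st in auto)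
    then show "((\<lambda>r. f (u r) - N (u s) * r) has_real_derivative N (u r) - N (u s)) (at r within {s..t})"
      by (rule df) (rule u(1)[OF r'])
    show "- 0 * (f (u r) - N (u s) * r) \<le> N (u r) - N (u s)"
      using mono[of s r] r st by simp
  qed (use st in auto)
  then show "f (u t) - f (u s) \<ge> N (u s) * (t - s)" by (simp add: algebra_simps)
qed

lemma G_bounds:
  assumes r: "cball x0 r \<subseteq> V"
  obtains c C where "c > 0" "C > 0" "\<And>x w. x \<in> cball x0 r \<Longrightarrow> c * (norm w)\<^sup>2 \<le> w \<bullet> (G x *v w)"
    "\<And>x w. x \<in> cball x0 r \<Longrightarrow> norm (G x *v w) \<le> C * norm w"
proof -
  let ?K = "cball x0 r"
  have contG: "continuous_on ?K G" using cont_G r by (rule continuous_on_subset)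
  have "compact (G ` ?K)" using contG by (intro compact_continuous_image) auto
  then obtain B where B: "\<And>x. x \<in> ?K \<Longrightarrow> norm (G x) \<le> B"
    using compact_imp_bounded bounded_iff by (metis image_eqI)
  obtain M where M: "M > 0" "\<And>(a :: real ^ 'n ^ 'n) b. norm (a *v b) \<le> norm a * norm b * M"
    using bounded_bilinear.pos_bounded[OF bounded_bilinear_matrix_vector_mult] by blast
  have C: "norm (G x *v w) \<le> (max B 1 * M) * norm w" if "x \<in> ?K" for x w
  proof -
    have "norm (G x *v w) \<le> norm (G x) * norm w * M" by (rule M(2))
    also have "\<dots> \<le> max B 1 * norm w * M"
      using B[OF that] M(1) by (intro mult_right_mono) auto
    finally show ?thesis by (simp add: mult_ac)
  qed
  have "\<exists>c>0. \<forall>x\<in>?K. \<forall>w. c * (norm w)\<^sup>2 \<le> w \<bullet> (G x *v w)"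
  proof (cases "?K = {}")
    case False
    let ?S = "?K \<times> sphere (0 :: real ^ 'n) 1"
    let ?q = "\<lambda>p. snd p \<bullet> (G (fst p) *v snd p)"
    have cp: "compact ?S" by (intro compact_Times) auto
    have "axis undefined 1 \<in> sphere (0 :: real ^ 'n) 1" by simp
    then have ne: "?S \<noteq> {}" using False by blast
    have "continuous_on ?S (\<lambda>p. G (fst p))"
      by (rule continuous_on_compose2[OF contG]) (auto intro: continuous_intros)
    then have "continuous_on ?S ?q"
      by (intro continuous_on_inner continuous_on_matrix_vector_mult continuous_on_snd continuous_on_id)
    from continuous_attains_inf[OF cp ne this] obtain p where p: "p \<in> ?S" "\<And>q. q \<in> ?S \<Longrightarrow> ?q p \<le> ?q q" by blast
    have c: "?q p > 0" using p(1) r by (intro inner_G_pos) auto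
    have "?q p * (norm w)\<^sup>2 \<le> w \<bullet> (G x *v w)" if x: "x \<in> ?K" for x w
    proof (cases "w = 0")
      case False
      have "?q p \<le> ?q (x, (1 / norm w) *\<^sub>R w)" by (rule p(2)) (use x False in auto)
      then show ?thesis using False by (simp add: matrix_vector_mult_scaleR field_simps power2_eq_square)
    qed simp
    with c show ?thesis by blast
  qed (auto intro: exI[of _ 1])
  then obtain c where "c > 0" "\<And>x w. x \<in> ?K \<Longrightarrow> c * (norm w)\<^sup>2 \<le> w \<bullet> (G x *v w)" by blast
  with C show ?thesis using M(1) by (intro that[of c "max B 1 * M"]) auto
qed

text \<open>Confinement to \<open>K\<close> belongs to the notion, so that one Lipschitz constant
  and one uniform linearization on a ball serve all trajectories at once.\<close>

definition traj :: "(real ^ 'n) set \<Rightarrow> real \<Rightarrow> (real \<Rightarrow> real ^ 'n) \<Rightarrow> bool" where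
  "traj K t u \<longleftrightarrow> (\<forall>s\<in>{0..t}. u s \<in> K \<and> (u has_vector_derivative X (u s)) (at s within {0..t}))"

lemma traj_Lipschitz:
  assumes "cball x0 r \<subseteq> V1"
  obtains L where "L \<ge> 0" "\<And>t u v s. traj (cball x0 r) t u \<Longrightarrow> traj (cball x0 r) t v \<Longrightarrow> s \<in> {0..t} \<Longrightarrow>
    norm (u s - v s) \<le> exp (L * s) * norm (u 0 - v 0)"
proof -
  obtain L where L: "L \<ge> 0" "\<And>y z. y \<in> cball x0 r \<Longrightarrow> z \<in> cball x0 r \<Longrightarrow> norm (X y - X z) \<le> L * norm (y - z)"
    by (rule C1_Lipschitz_cball[OF X_deriv cont_X' assms]) (assumption, rule that)
  show ?thesis
  proof (rule that[OF L(1)])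
    fix t u v s assume u: "traj (cball x0 r) t u" and v: "traj (cball x0 r) t v" and s: "s \<in> {0..t}"
    have "norm (u s - v s) \<le> exp (L * \<bar>s - 0\<bar>) * norm (u 0 - v 0)"
    proof (rule norm_exp_bound[of 0 t "\<lambda>s. u s - v s" "\<lambda>s. X (u s) - X (v s)"])
      show "((\<lambda>t. u t - v t) has_vector_derivative X (u q) - X (v q)) (at q within {0..t})" if "q \<in> {0..t}" for q
        using u v that by (intro has_vector_derivative_diff) (auto simp: traj_def)
      show "norm (X (u q) - X (v q)) \<le> L * norm (u q - v q)" if "q \<in> {0..t}" for q
        using L(2) u v that by (auto simp: traj_def)
    qed (use s in auto)
    then show "norm (u s - v s) \<le> exp (L * s) * norm (u 0 - v 0)" using s by simp
  qed
qed

text \<open>The squared length \<open>W\<close> of the difference of \<open>v\<close> and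
  \<open>w\<close>, measured by the metric at the third trajectory \<open>u\<close>, has as
  derivative the Lie derivative of the metric, which is nonnegative, plus an error from linearizing
  \<open>X\<close> at \<open>u\<close>. Near \<open>u\<close> this error is at most
  \<open>k * W\<close>, so \<open>W\<close> loses at most a factor
  \<open>exp (k * t)\<close>.\<close>

lemma trajectories_expand:
  assumes r: "cball x0 r' \<subseteq> V1" "r < r'" and T: "T \<ge> 0" and e: "e > 0"
  obtains d where "d > 0" "\<And>t u v w. \<lbrakk>0 \<le> t; t \<le> T; traj (cball x0 r) t u; traj (cball x0 r) t v; traj (cball x0 r) t w;
    norm (v 0 - u 0) < d; norm (w 0 - u 0) < d\<rbrakk> \<Longrightarrow>
    (v 0 - w 0) \<bullet> (G (u 0) *v (v 0 - w 0)) \<le> (1 + e) * ((v t - w t) \<bullet> (G (u t) *v (v t - w t)))"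
proof -
  have rV1: "cball x0 r \<subseteq> V1" using r by (auto simp: subset_eq)
  then have rV: "cball x0 r \<subseteq> V" by (auto simp: V1_def)
  obtain c C where cC: "c > 0" "C > 0" "\<And>x w. x \<in> cball x0 r \<Longrightarrow> c * (norm w)\<^sup>2 \<le> w \<bullet> (G x *v w)"
    "\<And>x w. x \<in> cball x0 r \<Longrightarrow> norm (G x *v w) \<le> C * norm w"
    by (rule G_bounds[OF rV]) (rule that)
  obtain L where L: "L \<ge> 0" "\<And>t u v s. traj (cball x0 r) t u \<Longrightarrow> traj (cball x0 r) t v \<Longrightarrow> s \<in> {0..t} \<Longrightarrow>
    norm (u s - v s) \<le> exp (L * s) * norm (u 0 - v 0)"
    by (rule traj_Lipschitz[OF rV1]) (rule that)
  \<comment> \<open>Chosen so that \<open>exp (k * t)\<close> stays below \<open>1 + e\<close> up to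
    time \<open>T\<close>; the denominator \<open>T + 1\<close> admits \<open>T = 0\<close>.\<close>
  define k where "k = ln (1 + e) / (T + 1)"
  have k: "k > 0" using e T by (simp add: k_def)
  have kT: "exp (k * t) \<le> 1 + e" if "0 \<le> t" "t \<le> T" for t
  proof -
    have "k * t = ln (1 + e) * (t / (T + 1))" by (simp add: k_def)
    also have "\<dots> \<le> ln (1 + e) * 1" using that T e by (intro mult_left_mono) auto
    finally have "exp (k * t) \<le> exp (ln (1 + e))" by simp
    then show ?thesis using e by simp
  qed
  \<comment> \<open>Chosen so that the bound \<open>2 * C * e1\<close> times |z|^2 for the error
    equals \<open>k * c\<close> times |z|^2, which is at most \<open>k * W\<close>.\<close>
  define e1 where "e1 = k * c / (2 * C)"
  have e1: "e1 > 0" using k cC by (simp add: e1_def)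
  obtain d1 where d1: "d1 > 0" "\<And>x y z. x \<in> cball x0 r \<Longrightarrow> y \<in> ball x d1 \<Longrightarrow> z \<in> ball x d1 \<Longrightarrow>
    norm (X y - X z - X' x (y - z)) \<le> e1 * norm (y - z)"
    by (rule C1_uniformly_strongly_differentiable[OF X_deriv cont_X' r e1]) (assumption, rule that)
  \<comment> \<open>Trajectories separate by a factor of at most \<open>exp (L * T)\<close>, so
    starting within \<open>d\<close> of \<open>u\<close> they stay within the radius
    \<open>d1\<close> on which the linearization is valid.\<close>
  define d where "d = d1 / exp (L * T)"
  have d: "d > 0" using d1 by (simp add: d_def)
  show ?thesis
  proof (rule that[OF d])
    fix t u v w
    assume t: "0 \<le> t" "t \<le> T" and tr: "traj (cball x0 r) t u" "traj (cball x0 r) t v" "traj (cball x0 r) t w"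
      and init: "norm (v 0 - u 0) < d" "norm (w 0 - u 0) < d"
    define z where "z s = v s - w s" for s
    define z' where "z' s = X (v s) - X (w s)" for s
    define W where "W s = z s \<bullet> (G (u s) *v z s)" for s
    have close: "y s \<in> ball (u s) d1" if y: "traj (cball x0 r) t y" "norm (y 0 - u 0) < d" and s: "s \<in> {0..t}" for y s
    proof -
      have "norm (y s - u s) \<le> exp (L * s) * norm (y 0 - u 0)" by (rule L(2)[OF y(1) tr(1) s])
      also have "\<dots> \<le> exp (L * T) * norm (y 0 - u 0)"
        using s t L(1) by (intro mult_right_mono) (auto intro: mult_left_mono)
      also have "\<dots> < exp (L * T) * d" using y(2) by simp
      finally show ?thesis by (simp add: d_def dist_norm norm_minus_commute)
    qed
    have dW: "(W has_real_derivative z s \<bullet> (G (u s) *v z' s + G' (u s) (X (u s)) *v z s) + z' s \<bullet> (G (u s) *v z s))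
        (at s within {0..t})" if s: "s \<in> {0..t}" for s
    proof -
      have "u s \<in> V" using tr(1) s rV by (auto simp: traj_def)
      have du: "(u has_vector_derivative X (u s)) (at s within {0..t})" using tr(1) s by (auto simp: traj_def)
      have dz: "(z has_vector_derivative z' s) (at s within {0..t})"
        unfolding z_def[abs_def] z'_def using tr(2,3) s by (intro has_vector_derivative_diff) (auto simp: traj_def)
      have "((\<lambda>s. G (u s) *v z s) has_vector_derivative G (u s) *v z' s + G' (u s) (X (u s)) *v z s) (at s within {0..t})"
        by (rule bounded_bilinear.has_vector_derivative[OF bounded_bilinear_matrix_vector_mult
          has_vector_derivative_compose_has_derivative[OF du G_deriv[OF \<open>u s \<in> V\<close>]] dz])
      from bounded_bilinear.has_vector_derivative[OF bounded_bilinear_inner dz this]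
      show ?thesis by (simp add: W_def[abs_def] has_real_derivative_iff_has_vector_derivative)
    qed
    have leW: "z s \<bullet> (G (u s) *v z' s + G' (u s) (X (u s)) *v z s) + z' s \<bullet> (G (u s) *v z s) \<ge> - k * W s"
      if s: "s \<in> {0..t}" for s
    proof -
      have us: "u s \<in> cball x0 r" "u s \<in> V1" "u s \<in> V" using tr(1) s rV rV1 by (auto simp: traj_def)
      define q where "q = z' s - X' (u s) (z s)"
      have q: "norm q \<le> e1 * norm (z s)"
        unfolding q_def z'_def z_def
        by (rule d1(2)[OF us(1) close[OF tr(2) init(1) s] close[OF tr(3) init(2) s]])
      have "z s \<bullet> (G (u s) *v z' s + G' (u s) (X (u s)) *v z s) + z' s \<bullet> (G (u s) *v z s)
        = (2 * (z s \<bullet> (G (u s) *v X' (u s) (z s))) + z s \<bullet> (G' (u s) (X (u s)) *v z s)) + 2 * (z s \<bullet> (G (u s) *v q))"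
        by (simp add: q_def inner_G_commute[OF us(3), of "z' s" "z s"] inner_add_right
            matrix_vector_mult_diff_distrib inner_diff_right)
      moreover have "\<bar>z s \<bullet> (G (u s) *v q)\<bar> \<le> norm (z s) * (C * (e1 * norm (z s)))"
      proof -
        have "\<bar>z s \<bullet> (G (u s) *v q)\<bar> \<le> norm (z s) * norm (G (u s) *v q)" by (rule Cauchy_Schwarz_ineq2)
        also have "\<dots> \<le> norm (z s) * (C * norm q)" by (intro mult_left_mono cC(4) us) simp
        also have "\<dots> \<le> norm (z s) * (C * (e1 * norm (z s)))"
          using q cC(2) by (intro mult_left_mono) auto
        finally show ?thesis .
      qed
      moreover have "2 * (norm (z s) * (C * (e1 * norm (z s)))) = k * (c * (norm (z s))\<^sup>2)"
        using cC(2) by (simp add: e1_def power2_eq_square)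
      moreover have "k * (c * (norm (z s))\<^sup>2) \<le> k * W s"
        unfolding W_def using k by (intro mult_left_mono cC(3) us) simp
      moreover have "2 * (z s \<bullet> (G (u s) *v X' (u s) (z s))) + z s \<bullet> (G' (u s) (X (u s)) *v z s) \<ge> 0"
        by (rule expanding[OF us(2)])
      ultimately show ?thesis by linarith
    qed
    have "exp (- k * (t - 0)) * W 0 \<le> W t"
      by (rule exp_lower_bound[OF dW leW]) (use t in auto)
    then have "exp (k * t) * (exp (- k * t) * W 0) \<le> exp (k * t) * W t" by (intro mult_left_mono) auto
    then have "W 0 \<le> exp (k * t) * W t" by (simp flip: mult.assoc exp_add)
    also have "\<dots> \<le> (1 + e) * W t"
    proof (rule mult_right_mono[OF kT[OF t]])
      have "u t \<in> cball x0 r" using tr(1) t by (auto simp: traj_def)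
      from cC(3)[OF this, of "z t"] show "0 \<le> W t"
        unfolding W_def using cC(1) by (smt (verit) mult_nonneg_nonneg zero_le_power2)
    qed
    finally show "(v 0 - w 0) \<bullet> (G (u 0) *v (v 0 - w 0)) \<le> (1 + e) * ((v t - w t) \<bullet> (G (u t) *v (v t - w t)))"
      by (simp add: W_def z_def)
  qed
qed

text \<open>\<open>trajectories_expand\<close> around the trajectory of \<open>x\<close> is the
  two-point hypothesis of \<open>nn_integral_expanding_map\<close> for the time-\<open>t\<close>
  map, with the metric frozen at \<open>x\<close> and at \<open>\<phi> x\<close>.\<close>

lemma flow_map_measure:
  assumes r: "cball x0 r' \<subseteq> V1" "r < r'" and t: "t \<ge> 0" and q: "q > 0"
    and flow: "\<And>y. y \<in> ball x q \<Longrightarrow> \<exists>u. traj (cball x0 r) t u \<and> u 0 = y \<and> u t = \<phi> y"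
  shows "continuous_on (ball x q) \<phi>"
    and "e > 0 \<Longrightarrow> \<exists>d>0. d \<le> q \<and> (\<forall>\<delta>. 0 < \<delta> \<and> \<delta> \<le> d \<longrightarrow> (\<forall>B\<in>sets borel. B \<subseteq> V1 \<longrightarrow>
      (\<integral>\<^sup>+ y\<in>ball x \<delta> \<inter> \<phi> -` B. ennreal (sqrt (det (G y))) \<partial>lborel) \<le>
      ennreal (1 + e) * (\<integral>\<^sup>+ y\<in>B. ennreal (sqrt (det (G y))) \<partial>lborel)))"
proof -
  have rV1: "cball x0 r \<subseteq> V1" using r by (auto simp: subset_eq)
  have sub: "V1 \<subseteq> V" by (auto simp: V1_def)
  obtain U where U: "\<And>y. y \<in> ball x q \<Longrightarrow> traj (cball x0 r) t (U y) \<and> U y 0 = y \<and> U y t = \<phi> y"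
    using flow by metis
  obtain L where L: "L \<ge> 0" "\<And>t u v s. traj (cball x0 r) t u \<Longrightarrow> traj (cball x0 r) t v \<Longrightarrow> s \<in> {0..t} \<Longrightarrow>
    norm (u s - v s) \<le> exp (L * s) * norm (u 0 - v 0)"
    by (rule traj_Lipschitz[OF rV1]) (rule that)
  have Lip: "norm (\<phi> y - \<phi> z) \<le> exp (L * t) * norm (y - z)" if "y \<in> ball x q" "z \<in> ball x q" for y z
    using L(2)[of t "U y" "U z" t] U[OF that(1)] U[OF that(2)] t by simp
  show cont: "continuous_on (ball x q) \<phi>"
  proof (rule continuous_on_iff[THEN iffD2], intro ballI allI impI)
    fix y and \<epsilon> :: real assume y: "y \<in> ball x q" and \<epsilon>: "\<epsilon> > 0"
    show "\<exists>d>0. \<forall>z\<in>ball x q. dist z y < d \<longrightarrow> dist (\<phi> z) (\<phi> y) < \<epsilon>"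
    proof (intro exI[of _ "\<epsilon> / exp (L * t)"] conjI ballI impI)
      fix z assume z: "z \<in> ball x q" "dist z y < \<epsilon> / exp (L * t)"
      have "dist (\<phi> z) (\<phi> y) \<le> exp (L * t) * dist z y" using Lip[OF z(1) y] by (simp add: dist_norm)
      also have "\<dots> < \<epsilon>" using z(2) by (simp add: field_simps)
      finally show "dist (\<phi> z) (\<phi> y) < \<epsilon>" .
    qed (use \<epsilon> in auto)
  qed
  have xq: "x \<in> ball x q" using q by simp
  have Ux: "traj (cball x0 r) t (U x)" "U x 0 = x" "U x t = \<phi> x" using U[OF xq] by auto
  then have xV: "x \<in> V1" "\<phi> x \<in> V1" using rV1 t unfolding traj_def by (metis atLeastAtMost_iff order_refl subsetD)+
  show "\<exists>d>0. d \<le> q \<and> (\<forall>\<delta>. 0 < \<delta> \<and> \<delta> \<le> d \<longrightarrow> (\<forall>B\<in>sets borel. B \<subseteq> V1 \<longrightarrow>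
      (\<integral>\<^sup>+ y\<in>ball x \<delta> \<inter> \<phi> -` B. ennreal (sqrt (det (G y))) \<partial>lborel) \<le>
      ennreal (1 + e) * (\<integral>\<^sup>+ y\<in>B. ennreal (sqrt (det (G y))) \<partial>lborel)))" if e: "e > 0"
  proof (rule nn_integral_expanding_map[OF open_V1 _ continuous_on_subset[OF cont_G sub] xV q cont _ e])
    fix e' :: real assume "e' > 0"
    obtain d where d: "d > 0" "\<And>s u v w. \<lbrakk>0 \<le> s; s \<le> t; traj (cball x0 r) s u; traj (cball x0 r) s v; traj (cball x0 r) s w;
      norm (v 0 - u 0) < d; norm (w 0 - u 0) < d\<rbrakk> \<Longrightarrow>
      (v 0 - w 0) \<bullet> (G (u 0) *v (v 0 - w 0)) \<le> (1 + e') * ((v s - w s) \<bullet> (G (u s) *v (v s - w s)))"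
      by (rule trajectories_expand[OF r t \<open>e' > 0\<close>]) (rule that)
    show "\<exists>d>0. \<forall>y\<in>ball x d. \<forall>z\<in>ball x d.
      (y - z) \<bullet> (G x *v (y - z)) \<le> (1 + e') * ((\<phi> y - \<phi> z) \<bullet> (G (\<phi> x) *v (\<phi> y - \<phi> z)))"
    proof (intro exI[of _ "min d q"] conjI ballI)
      fix y z assume "y \<in> ball x (min d q)" "z \<in> ball x (min d q)"
      then have yz: "y \<in> ball x q" "z \<in> ball x q" "norm (y - x) < d" "norm (z - x) < d"
        by (auto simp: dist_norm norm_minus_commute)
      show "(y - z) \<bullet> (G x *v (y - z)) \<le> (1 + e') * ((\<phi> y - \<phi> z) \<bullet> (G (\<phi> x) *v (\<phi> y - \<phi> z)))"
        using d(2)[OF t order_refl, of "U x" "U y" "U z"] Ux U[OF yz(1)] U[OF yz(2)] yz(3,4) by simp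
    qed (use d q in auto)
  qed (rule pos[OF V1_sub])
qed

lemma cont_Z: "continuous_on V Z"
  using Z_deriv by (intro continuous_at_imp_continuous_on ballI has_derivative_continuous)

text \<open>Unlike in \<open>cont_N\<close>, critical points are included: this continuity will show
  that a limit point of a trajectory is still regular.\<close>

lemma cont_N_V: "continuous_on V N"
  unfolding grad_norm_def[abs_def]
  by (intro continuous_on_real_sqrt continuous_on_inner cont_grad cont_Z)

lemma V1_if_N_pos: "x \<in> V \<Longrightarrow> N x > 0 \<Longrightarrow> x \<in> V1"
  by (auto simp: V1_def grad_norm_def)

end

section \<open>The flow of the unit gradient field on the manifold\<close>

lemma continuous_curve_near:
  fixes \<gamma> :: "real \<Rightarrow> 'a::topological_space"
  assumes "continuous_on UNIV \<gamma>" "open W" "\<gamma> t \<in> W"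
  obtains \<epsilon> where "\<epsilon> > 0" "\<And>s. \<bar>s - t\<bar> \<le> \<epsilon> \<Longrightarrow> \<gamma> s \<in> W"
proof -
  have "open (\<gamma> -` W)" using assms(1,2) by (simp add: continuous_on_open_vimage)
  then obtain d where d: "d > 0" "ball t d \<subseteq> \<gamma> -` W"
    using assms(3) by (meson open_contains_ball vimageI)
  show ?thesis
  proof (rule that[of "d / 2"])
    fix s assume "\<bar>s - t\<bar> \<le> d / 2"
    then have "s \<in> ball t d" using d(1) by (simp add: dist_real_def abs_minus_commute)
    then show "\<gamma> s \<in> W" using d(2) by blast
  qed (use d(1) in simp)
qed

text \<open>The coincidence set is closed because the space is Hausdorff and open by
  \<open>loc\<close>, and the half-line is connected.\<close>

lemma connected_eq_curves:
  fixes u v :: "real \<Rightarrow> 'a::t2_space"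
  assumes cont: "continuous_on UNIV u" "continuous_on UNIV v"
    and loc: "\<And>t. t \<ge> 0 \<Longrightarrow> u t = v t \<Longrightarrow> \<exists>e>0. \<forall>s\<ge>0. \<bar>s - t\<bar> \<le> e \<longrightarrow> u s = v s"
    and t0: "t0 \<ge> 0" "u t0 = v t0" and t: "t \<ge> 0"
  shows "u t = v t"
proof -
  define E where "E = {t. u t = v t} \<inter> {0..}"
  have "closed {t. u t = v t}" using cont by (rule closed_Collect_eq)
  then have "closedin (top_of_set {0..}) E"
    unfolding E_def by (subst Int_commute) (rule closedin_closed_Int)
  moreover have "openin (top_of_set {0..}) E"
    unfolding openin_contains_ball
  proof (intro conjI ballI)
    fix s assume s: "s \<in> E"
    then obtain e where e: "e > 0" "\<forall>r\<ge>0. \<bar>r - s\<bar> \<le> e \<longrightarrow> u r = v r"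
      using loc[of s] by (auto simp: E_def)
    have "ball s e \<inter> {0..} \<subseteq> E"
      using e(2) by (auto simp: E_def dist_real_def abs_minus_commute less_imp_le)
    with e(1) show "\<exists>e>0. ball s e \<inter> {0..} \<subseteq> E" by blast
  qed (simp add: E_def)
  moreover have "t0 \<in> E" using t0 by (simp add: E_def)
  ultimately have "E = {0..}"
    using connected_clopen[of "{0::real..}"] by (metis convex_connected convex_real_interval(1) empty_iff)
  then show ?thesis using t by (auto simp: E_def)
qed

locale steady_soliton =
  fixes A :: "('a::{t2_space, second_countable_topology}, 'n::finite) chart set"
    and g :: "('a, 'n) chart \<Rightarrow> real ^ 'n \<Rightarrow> real ^ 'n ^ 'n" and F :: "'a \<Rightarrow> real"
  assumes soliton: "steady_gradient_yamabe_soliton A g F"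
    and complete: "complete_riemannian A g" and nonneg: "nonneg_scalar_curvature A g"
begin

abbreviation "V c \<equiv> cmap c ` cdom c"
abbreviation "Fc c \<equiv> F \<circ> cinv c"
abbreviation "N c \<equiv> grad_norm (g c) (Fc c)"
abbreviation "X c \<equiv> unit_grad (g c) (Fc c)"
abbreviation "V1 c \<equiv> soliton_chart.V1 (V c) (Fc c)"

section \<open>Changes of charts, regular points and the gradient norm on the manifold\<close>

lemma atlas: "smooth_atlas A" "connected (UNIV :: 'a set)" "riemannian_metric A g" "smooth_function A F"
  using soliton unfolding steady_gradient_yamabe_soliton_def gradient_yamabe_soliton_def riemannian_manifold_def
  by blast+

lemma chart_at: obtains c where "c \<in> A" "q \<in> cdom c"
  using atlas(1) unfolding smooth_atlas_def by (metis UNIV_I UN_E)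

lemma is_chart: "c \<in> A \<Longrightarrow> is_chart c"
  using atlas(1) by (simp add: smooth_atlas_def)

lemma
  assumes "c \<in> A"
  shows open_cdom: "open (cdom c)" and open_V: "open (V c)"
    and cont_cmap: "continuous_on (cdom c) (cmap c)" and cont_cinv: "continuous_on (V c) (cinv c)"
    and cinv_cmap: "q \<in> cdom c \<Longrightarrow> cinv c (cmap c q) = q"
    and cmap_cinv: "x \<in> V c \<Longrightarrow> cmap c (cinv c x) = x" and cinv_in: "x \<in> V c \<Longrightarrow> cinv c x \<in> cdom c"
  using is_chart[OF assms] by (auto simp: is_chart_def homeomorphism_def inv_into_into)

lemma chart: "c \<in> A \<Longrightarrow> soliton_chart (V c) (g c) (Fc c) (scalar_curvature (g c))"
proof
  assume c: "c \<in> A"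
  show "open (V c)" by (rule open_V[OF c])
  show "smooth_on (V c) (g c)" using atlas(3) c by (simp add: riemannian_metric_def)
  show "smooth_on (V c) (Fc c)" using atlas(4) c by (simp add: smooth_function_def)
  fix x assume x: "x \<in> V c"
  show "pos_def (g c x)" using atlas(3) c x unfolding riemannian_metric_def pos_def_def by blast
  show "scalar_curvature (g c) x \<ge> 0" using nonneg c x unfolding nonneg_scalar_curvature_def by blast
  show "hessian (g c) (Fc c) i j x = scalar_curvature (g c) x * g c x $ i $ j" for i j
    using soliton c x unfolding steady_gradient_yamabe_soliton_def gradient_yamabe_soliton_def
    by (metis diff_zero)
qed

lemma open_chart_preimage:
  assumes c: "c \<in> A" and W: "open W"
  shows "open {q \<in> cdom c. cmap c q \<in> W}"
  using continuous_open_preimage[OF cont_cmap[OF c] open_cdom[OF c] W] by (simp add: vimage_def Int_def)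

text \<open>The differential of F and the metric pull back by \<open>J\<close>, so the gradient
  pushes forward by \<open>J\<close> and its length is unchanged. Hence \<open>\<Omega>\<close>,
  \<open>speed\<close> and integral curves do not depend on the chart.\<close>

lemma transition:
  assumes c: "c \<in> A" and d: "d \<in> A" and q: "q \<in> cdom c" "q \<in> cdom d"
  obtains J where "((cmap d \<circ> cinv c) has_derivative J) (at (cmap c q))"
    "grad_norm (g c) (Fc c) (cmap c q) = grad_norm (g d) (Fc d) (cmap d q)"
    "J (X c (cmap c q)) = X d (cmap d q)"
    "coord_grad (Fc c) (cmap c q) \<noteq> 0 \<Longrightarrow> coord_grad (Fc d) (cmap d q) \<noteq> 0"
proof -
  interpret C: soliton_chart "V c" "g c" "Fc c" "scalar_curvature (g c)" by (rule chart[OF c])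
  interpret D: soliton_chart "V d" "g d" "Fc d" "scalar_curvature (g d)" by (rule chart[OF d])
  let ?\<tau> = "cmap d \<circ> cinv c" and ?x = "cmap c q" and ?y = "cmap d q"
  let ?O = "cmap c ` (cdom c \<inter> cdom d)"
  have xV: "?x \<in> V c" "?y \<in> V d" "?x \<in> ?O" using q by auto
  have \<tau>x: "?\<tau> ?x = ?y" using cinv_cmap[OF c q(1)] by simp
  have "smooth_on ?O ?\<tau>" using atlas(1) c d by (simp add: smooth_atlas_def)
  then have "Ck_on (Suc 0) ?O ?\<tau>" by (simp only: smooth_on_def)
  from Ck_on_Suc_has_derivative[OF this xV(3)]
  have J: "(?\<tau> has_derivative frechet_derivative ?\<tau> (at ?x)) (at ?x)" .
  define J where "J = frechet_derivative ?\<tau> (at ?x)"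
  have J': "(?\<tau> has_derivative J) (at ?x)" using J by (simp only: J_def)
  have lin: "linear J" using J' by (rule has_derivative_linear)
  define M where "M = matrix J"
  have M: "M *v w = J w" for w unfolding M_def by (rule fun_cong[OF matrix_vector_mul(2)[OF lin]])
  have gM: "g c ?x = transpose M ** g d ?y ** M"
    using atlas(3) c d xV(3) \<tau>x unfolding riemannian_metric_def Let_def M_def J_def by metis
  have openO: "open ?O"
  proof -
    have "?O = V c \<inter> cinv c -` (cdom d)"
      using cinv_cmap[OF c] cmap_cinv[OF c] cinv_in[OF c] by force
    then show ?thesis
      using continuous_open_preimage[OF cont_cinv[OF c] open_V[OF c] open_cdom[OF d]] by simp
  qed
  have "((\<lambda>x. Fc d (?\<tau> x)) has_derivative (\<lambda>w. coord_grad (Fc d) ?y \<bullet> J w)) (at ?x)"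
    using has_derivative_compose[OF J', of "Fc d"] D.f_deriv[OF xV(2)] \<tau>x by metis
  then have "(Fc c has_derivative (\<lambda>w. coord_grad (Fc d) ?y \<bullet> J w)) (at ?x)"
    using openO xV(3)
    by (rule has_derivative_transform_within_open) (use cinv_cmap[OF c] cinv_cmap[OF d] in auto)
  from fun_cong[OF has_derivative_unique[OF C.f_deriv[OF xV(1)] this]]
  have grad: "coord_grad (Fc c) ?x \<bullet> w = coord_grad (Fc d) ?y \<bullet> J w" for w .
  \<comment> \<open>The tensor law itself forces the Jacobian to be invertible, since the metric in
    chart \<open>c\<close> has nonzero determinant.\<close>
  have "det M \<noteq> 0"
  proof
    assume "det M = 0"
    then have "det (g c ?x) = 0" by (simp add: gM det_mul)
    then show False using pos_def_det_pos[OF C.pos[OF xV(1)]] by simp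
  qed
  then obtain M' where M': "M ** M' = mat 1" by (auto simp: invertible_det_nz[symmetric] invertible_def)
  let ?Zc = "riem_grad (g c) (Fc c) ?x" and ?Zd = "riem_grad (g d) (Fc d) ?y"
  \<comment> \<open>The gradient is determined by its pairings with all vectors, and by
    invertibility every vector in chart \<open>d\<close> is the image of some
    \<open>w\<close>.\<close>
  have JZ: "J ?Zc = ?Zd"
  proof (rule D.inner_G_eqI[OF xV(2)])
    fix v
    define w where "w = M' *v v"
    have v: "v = M *v w" by (simp add: w_def matrix_vector_mul_assoc M')
    have "v \<bullet> (g d ?y *v J ?Zc) = w \<bullet> (g c ?x *v ?Zc)"
      unfolding v gM
      by (simp only: matrix_mul_assoc[symmetric] matrix_vector_mul_assoc[symmetric]
            inner_transpose_matrix[of _ "transpose M"] transpose_transpose M)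
    also have "\<dots> = coord_grad (Fc d) ?y \<bullet> J w" by (simp add: C.G_Z[OF xV(1)] inner_commute[of w] grad)
    also have "\<dots> = v \<bullet> (g d ?y *v ?Zd)" by (simp add: D.G_Z[OF xV(2)] v M inner_commute)
    finally show "v \<bullet> (g d ?y *v J ?Zc) = v \<bullet> (g d ?y *v ?Zd)" .
  qed
  have Neq: "N c ?x = N d ?y"
    by (simp add: grad_norm_def grad JZ)
  have "J (X c ?x) = X d ?y"
    by (simp only: unit_grad_def linear_scale[OF lin] JZ Neq)
  moreover have "coord_grad (Fc d) ?y \<noteq> 0" if "coord_grad (Fc c) ?x \<noteq> 0"
  proof
    assume "coord_grad (Fc d) ?y = 0"
    then have "coord_grad (Fc c) ?x \<bullet> coord_grad (Fc c) ?x = 0" by (simp add: grad)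
    then show False using that by simp
  qed
  ultimately show ?thesis using that J' Neq by blast
qed

definition \<Omega> :: "'a set" where
  "\<Omega> = {q. \<exists>c\<in>A. q \<in> cdom c \<and> cmap c q \<in> V1 c}"

lemma V1_eq: "c \<in> A \<Longrightarrow> V1 c = {x \<in> V c. coord_grad (Fc c) x \<noteq> 0}"
  using soliton_chart.V1_def[OF chart] .

lemma \<Omega>_iff:
  assumes d: "d \<in> A" "q \<in> cdom d"
  shows "q \<in> \<Omega> \<longleftrightarrow> cmap d q \<in> V1 d"
proof
  assume "q \<in> \<Omega>"
  then obtain c where c: "c \<in> A" "q \<in> cdom c" "coord_grad (Fc c) (cmap c q) \<noteq> 0"
    by (auto simp: \<Omega>_def V1_eq)
  have "coord_grad (Fc d) (cmap d q) \<noteq> 0"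
    by (rule transition[OF c(1) d(1) c(2) d(2)]) (use c(3) in blast)
  then show "cmap d q \<in> V1 d" using d by (simp add: V1_eq)
qed (use d in \<open>auto simp: \<Omega>_def\<close>)

lemma open_V1: "c \<in> A \<Longrightarrow> open (V1 c)"
  using soliton_chart.open_V1[OF chart] .

lemma V1_subset: "c \<in> A \<Longrightarrow> V1 c \<subseteq> V c"
  by (auto simp: V1_eq)

lemma open_\<Omega>: "open \<Omega>"
proof -
  have "\<Omega> = (\<Union>c\<in>A. {q \<in> cdom c. cmap c q \<in> V1 c})" by (auto simp: \<Omega>_def)
  then show ?thesis using open_chart_preimage open_V1 by auto
qed

definition speed :: "'a \<Rightarrow> real" where
  "speed q = (let c = SOME c. c \<in> A \<and> q \<in> cdom c in N c (cmap c q))"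

lemma speed_eq:
  assumes d: "d \<in> A" "q \<in> cdom d"
  shows "speed q = N d (cmap d q)"
proof -
  define c where "c = (SOME c. c \<in> A \<and> q \<in> cdom c)"
  have c: "c \<in> A \<and> q \<in> cdom c" unfolding c_def by (rule someI[of _ d]) (simp add: d)
  have "N c (cmap c q) = N d (cmap d q)"
    by (rule transition[of c d q]) (use c d in auto)
  then show ?thesis unfolding speed_def Let_def c_def .
qed

lemma speed_pos:
  assumes "q \<in> \<Omega>"
  shows "speed q > 0"
proof -
  obtain c where c: "c \<in> A" "q \<in> cdom c" "cmap c q \<in> V1 c"
    using assms unfolding \<Omega>_def by blast
  from soliton_chart.N_pos[OF chart[OF c(1)] c(3)] show ?thesis
    unfolding speed_eq[OF c(1,2)] .
qed

lemma cont_speed: "continuous_on UNIV speed"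
proof -
  have "continuous_on (\<Union>c\<in>A. cdom c) speed"
  proof (rule continuous_on_open_UN)
    fix c assume c: "c \<in> A"
    show "open (cdom c)" by (rule open_cdom[OF c])
    have "continuous_on (cdom c) (\<lambda>q. N c (cmap c q))"
      using soliton_chart.cont_N_V[OF chart[OF c]] cont_cmap[OF c] by (rule continuous_on_compose2) auto
    then show "continuous_on (cdom c) speed"
      by (rule continuous_on_cong[THEN iffD2, rotated -1]) (auto simp: speed_eq c)
  qed
  moreover have "(\<Union>c\<in>A. cdom c) = UNIV" using atlas(1) by (simp add: smooth_atlas_def)
  ultimately show ?thesis by simp
qed

lemma cont_F: "continuous_on UNIV F"
proof -
  have "continuous_on (\<Union>c\<in>A. cdom c) F"
  proof (rule continuous_on_open_UN)
    fix c assume c: "c \<in> A"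
    show "open (cdom c)" by (rule open_cdom[OF c])
    have "continuous_on (V c) (Fc c)"
      using soliton_chart.f_deriv[OF chart[OF c]]
      by (intro continuous_at_imp_continuous_on ballI has_derivative_continuous)
    then have "continuous_on (cdom c) (\<lambda>q. Fc c (cmap c q))"
      using cont_cmap[OF c] by (rule continuous_on_compose2) auto
    then show "continuous_on (cdom c) F"
      by (rule continuous_on_cong[THEN iffD2, rotated -1]) (auto simp: cinv_cmap[OF c])
  qed
  moreover have "(\<Union>c\<in>A. cdom c) = UNIV" using atlas(1) by (simp add: smooth_atlas_def)
  ultimately show ?thesis by simp
qed

section \<open>Integral curves of the unit gradient field\<close>

definition integral_at :: "(real \<Rightarrow> 'a) \<Rightarrow> real \<Rightarrow> bool" where
  "integral_at \<gamma> t \<longleftrightarrow> \<gamma> t \<in> \<Omega> \<and>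
    (\<forall>c\<in>A. \<gamma> t \<in> cdom c \<longrightarrow> ((cmap c \<circ> \<gamma>) has_vector_derivative X c (cmap c (\<gamma> t))) (at t))"

text \<open>The equation is demanded for nonnegative times only: backwards, the underlying geodesic
  may run into a critical point of \<open>F\<close>.\<close>

definition integral_curve :: "(real \<Rightarrow> 'a) \<Rightarrow> bool" where
  "integral_curve \<gamma> \<longleftrightarrow> continuous_on UNIV \<gamma> \<and> (\<forall>t\<ge>0. integral_at \<gamma> t)"

text \<open>One chart suffices, because the derivative of a change of charts carries the unit
  gradient field to itself.\<close>

lemma integral_atI:
  assumes \<gamma>: "continuous_on UNIV \<gamma>" "\<gamma> t \<in> \<Omega>" and c: "c \<in> A" "\<gamma> t \<in> cdom c"
    and d: "((cmap c \<circ> \<gamma>) has_vector_derivative X c (cmap c (\<gamma> t))) (at t)"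
  shows "integral_at \<gamma> t"
  unfolding integral_at_def
proof (intro conjI ballI impI)
  fix e assume e: "e \<in> A" "\<gamma> t \<in> cdom e"
  obtain J where J: "((cmap e \<circ> cinv c) has_derivative J) (at (cmap c (\<gamma> t)))"
    "J (X c (cmap c (\<gamma> t))) = X e (cmap e (\<gamma> t))"
    by (rule transition[OF c(1) e(1) c(2) e(2)]) (rule that)
  have der: "((\<lambda>s. (cmap e \<circ> cinv c) ((cmap c \<circ> \<gamma>) s)) has_vector_derivative X e (cmap e (\<gamma> t))) (at t)"
    using has_vector_derivative_compose_has_derivative[OF d, of "cmap e \<circ> cinv c" J] J by simp
  obtain \<epsilon> where \<epsilon>: "\<epsilon> > 0" "\<And>s. \<bar>s - t\<bar> \<le> \<epsilon> \<Longrightarrow> \<gamma> s \<in> cdom c"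
    by (rule continuous_curve_near[OF \<gamma>(1) open_cdom[OF c(1)] c(2)]) (rule that)
  show "((cmap e \<circ> \<gamma>) has_vector_derivative X e (cmap e (\<gamma> t))) (at t)"
  proof (rule has_vector_derivative_transform_within_open[OF der open_ball])
    fix s assume "s \<in> ball t \<epsilon>"
    then have "\<gamma> s \<in> cdom c" using \<epsilon>(2) by (simp add: dist_real_def abs_minus_commute)
    then show "(cmap e \<circ> cinv c) ((cmap c \<circ> \<gamma>) s) = (cmap e \<circ> \<gamma>) s" by (simp add: cinv_cmap[OF c(1)])
  qed (use \<epsilon> in auto)
qed fact

lemma integral_at_chart:
  assumes "integral_at \<gamma> t" "c \<in> A" "\<gamma> t \<in> cdom c"
  shows "cmap c (\<gamma> t) \<in> V1 c"
    "((\<lambda>t. cmap c (\<gamma> t)) has_vector_derivative X c (cmap c (\<gamma> t))) (at t within S)"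
  using assms \<Omega>_iff by (auto simp: integral_at_def o_def has_vector_derivative_at_within)

lemma along_curve:
  assumes c: "c \<in> A" and ab: "\<And>s. s \<in> {a..b} \<Longrightarrow> integral_at \<gamma> s \<and> \<gamma> s \<in> cdom c" and le: "a \<le> b"
  shows "speed (\<gamma> a) \<le> speed (\<gamma> b)" "F (\<gamma> b) \<ge> F (\<gamma> a) + speed (\<gamma> a) * (b - a)"
proof -
  interpret C: soliton_chart "V c" "g c" "Fc c" "scalar_curvature (g c)" by (rule chart[OF c])
  have u: "cmap c (\<gamma> s) \<in> V1 c"
    "((\<lambda>t. cmap c (\<gamma> t)) has_vector_derivative X c (cmap c (\<gamma> s))) (at s within {a..b})" if "s \<in> {a..b}" for s
    using integral_at_chart[of \<gamma> s c] ab[OF that] c by auto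
  have end': "\<gamma> a \<in> cdom c" "\<gamma> b \<in> cdom c" using ab le by auto
  show "speed (\<gamma> a) \<le> speed (\<gamma> b)"
    using C.along_integral_curve(1)[of a b "\<lambda>t. cmap c (\<gamma> t)" a b] u le end' by (simp add: speed_eq[OF c])
  show "F (\<gamma> b) \<ge> F (\<gamma> a) + speed (\<gamma> a) * (b - a)"
    using C.along_integral_curve(2)[of a b "\<lambda>t. cmap c (\<gamma> t)" a b] u le end'
    by (simp add: speed_eq[OF c] cinv_cmap[OF c])
qed

lemma geodesic_line_chart:
  assumes \<gamma>: "geodesic_line A g \<gamma>" and c: "c \<in> A" "\<gamma> t \<in> cdom c"
  defines "u \<equiv> cmap c \<circ> \<gamma>"
  shows "(u has_vector_derivative vector_derivative u (at t)) (at t)"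
    "((\<lambda>s. vector_derivative u (at s)) has_vector_derivative
      - connection_term (g c) (u t) (vector_derivative u (at t)) (vector_derivative u (at t))) (at t)"
proof -
  have *: "u differentiable (at t)" "((\<lambda>s. vector_derivative u (at s)) has_vector_derivative
    (\<chi> k. - (\<Sum>i\<in>UNIV. \<Sum>j\<in>UNIV. christoffel (g c) k i j (u t) * vector_derivative u (at t) $ i * vector_derivative u (at t) $ j))) (at t)"
    using \<gamma> c unfolding geodesic_line_def u_def Let_def by blast+
  show "(u has_vector_derivative vector_derivative u (at t)) (at t)"
    using *(1) by (simp add: vector_derivative_works)
  have "(\<chi> k. - (\<Sum>i\<in>UNIV. \<Sum>j\<in>UNIV. christoffel (g c) k i j (u t) * vector_derivative u (at t) $ i * vector_derivative u (at t) $ j)) =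
    - connection_term (g c) (u t) (vector_derivative u (at t)) (vector_derivative u (at t))"
    by (simp add: connection_term_def vec_eq_iff)
  with *(2) show "((\<lambda>s. vector_derivative u (at s)) has_vector_derivative
      - connection_term (g c) (u t) (vector_derivative u (at t)) (vector_derivative u (at t))) (at t)" by simp
qed

text \<open>The equation is propagated along the complete geodesic with initial velocity
  \<open>X\<close>. To the right this is \<open>geodesic_is_integral_curve\<close>; at a limit time,
  monotonicity of \<open>speed\<close> keeps the point regular, and the equation passes to the
  limit.\<close>

lemma integral_curve_exists:
  assumes q: "q \<in> \<Omega>"
  obtains \<gamma> where "integral_curve \<gamma>" "\<gamma> 0 = q"
proof -
  obtain c0 where c0: "c0 \<in> A" "q \<in> cdom c0" by (rule chart_at)
  obtain \<gamma> where \<gamma>: "geodesic_line A g \<gamma>" "\<gamma> 0 = q"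
    "((cmap c0 \<circ> \<gamma>) has_vector_derivative X c0 (cmap c0 q)) (at 0)"
    using complete c0 unfolding complete_riemannian_def by blast
  have cont: "continuous_on UNIV \<gamma>" using \<gamma>(1) by (simp add: geodesic_line_def)
  have "integral_at \<gamma> t" if "t \<ge> 0" for t
    using that
  proof (induction t rule: nonneg_real_induct)
    case zero
    show ?case by (rule integral_atI[OF cont _ c0(1)]) (use \<gamma> q c0 in auto)
  next
    case (right t)
    obtain c where c: "c \<in> A" "\<gamma> t \<in> cdom c" by (rule chart_at)
    interpret C: soliton_chart "V c" "g c" "Fc c" "scalar_curvature (g c)" by (rule chart[OF c(1)])
    define u where "u = cmap c \<circ> \<gamma>"
    have it: "integral_at \<gamma> t" using right by simp
    have "open (cdom c \<inter> \<Omega>)" "\<gamma> t \<in> cdom c \<inter> \<Omega>"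
      using open_cdom[OF c(1)] open_\<Omega> c(2) it by (auto simp: integral_at_def)
    then obtain \<epsilon> where \<epsilon>: "\<epsilon> > 0" "\<And>s. \<bar>s - t\<bar> \<le> \<epsilon> \<Longrightarrow> \<gamma> s \<in> cdom c \<inter> \<Omega>"
      using continuous_curve_near[OF cont] by metis
    have "integral_at \<gamma> s" if s: "t < s" "s < t + \<epsilon>" for s
    proof (rule integral_atI[OF cont _ c(1)])
      show in': "\<gamma> s \<in> \<Omega>" "\<gamma> s \<in> cdom c" using \<epsilon>(2)[of s] s by auto
      have dom: "\<gamma> r \<in> cdom c" "\<gamma> r \<in> \<Omega>" if "r \<in> {t..s}" for r using \<epsilon>(2)[of r] that s by auto
      have "vector_derivative u (at s) = X c (u s)"
      proof (rule C.geodesic_is_integral_curve[of t s u "\<lambda>r. vector_derivative u (at r)" t])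
        fix r assume r: "r \<in> {t..s}"
        show "u r \<in> V1 c" using \<Omega>_iff[OF c(1)] dom[OF r] by (simp add: u_def)
        show "(u has_vector_derivative vector_derivative u (at r)) (at r within {t..s})"
          using geodesic_line_chart(1)[OF \<gamma>(1) c(1) dom(1)[OF r]] unfolding u_def
          by (rule has_vector_derivative_at_within)
        show "((\<lambda>r. vector_derivative u (at r)) has_vector_derivative
            - connection_term (g c) (u r) (vector_derivative u (at r)) (vector_derivative u (at r))) (at r within {t..s})"
          using geodesic_line_chart(2)[OF \<gamma>(1) c(1) dom(1)[OF r]] unfolding u_def
          by (rule has_vector_derivative_at_within)
      next
        show "vector_derivative u (at t) = X c (u t)"
          using it c unfolding integral_at_def u_def by (auto intro: vector_derivative_at)
      qed (use s in auto)
      then show "((cmap c \<circ> \<gamma>) has_vector_derivative X c (cmap c (\<gamma> s))) (at s)"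
        using geodesic_line_chart(1)[OF \<gamma>(1) c(1) in'(2)] by (simp add: u_def)
    qed
    with \<epsilon>(1) show ?case by blast
  next
    case (limit t)
    obtain c where c: "c \<in> A" "\<gamma> t \<in> cdom c" by (rule chart_at)
    interpret C: soliton_chart "V c" "g c" "Fc c" "scalar_curvature (g c)" by (rule chart[OF c(1)])
    define u where "u = cmap c \<circ> \<gamma>"
    obtain \<epsilon> where \<epsilon>: "\<epsilon> > 0" "\<And>s. \<bar>s - t\<bar> \<le> \<epsilon> \<Longrightarrow> \<gamma> s \<in> cdom c"
      using continuous_curve_near[OF cont open_cdom[OF c(1)] c(2)] by metis
    \<comment> \<open>An earlier time from which the curve stays in the chart \<open>c\<close> until
      \<open>t\<close>, so that \<open>along_curve\<close> applies.\<close>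
    define s0 where "s0 = max 0 (t - \<epsilon>)"
    have s0: "0 \<le> s0" "s0 < t" "t - \<epsilon> \<le> s0" using \<epsilon>(1) limit(1) by (auto simp: s0_def)
    have int: "integral_at \<gamma> s" if "s0 \<le> s" "s < t" for s using limit(2) that s0 by simp
    have ev: "\<forall>\<^sub>F s in at_left t. s0 < s \<and> s < t"
      using eventually_at_left_real[OF s0(2)] by (simp add: greaterThanLessThan_iff)
    have mono: "speed (\<gamma> s0) \<le> speed (\<gamma> s)" if "s0 < s" "s < t" for s
      by (rule along_curve[OF c(1)]) (use that int \<epsilon>(2) s0 in auto)
    have "((\<lambda>s. speed (\<gamma> s)) \<longlongrightarrow> speed (\<gamma> t)) (at_left t)"
    proof -
      have "continuous_on UNIV (\<lambda>s. speed (\<gamma> s))"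
        using cont_speed cont by (rule continuous_on_compose2) auto
      then have "isCont (\<lambda>s. speed (\<gamma> s)) t" by (simp add: continuous_on_eq_continuous_at)
      then show ?thesis by (simp add: continuous_within filterlim_at_split)
    qed
    moreover have "\<forall>\<^sub>F s in at_left t. speed (\<gamma> s0) \<le> speed (\<gamma> s)"
      using ev by eventually_elim (use mono in auto)
    ultimately have "speed (\<gamma> s0) \<le> speed (\<gamma> t)" by (intro tendsto_lowerbound) auto
    moreover have "speed (\<gamma> s0) > 0" using int[of s0] s0 by (intro speed_pos) (simp add: integral_at_def)
    ultimately have "N c (cmap c (\<gamma> t)) > 0" using c by (simp add: speed_eq)
    then have V1: "cmap c (\<gamma> t) \<in> V1 c" using c(2) by (intro C.V1_if_N_pos) auto
    \<comment> \<open>Velocity and \<open>X\<close> agree just before \<open>t\<close>. Both are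
      continuous at \<open>t\<close>, the field because the point is now known to be regular, so
      they agree at \<open>t\<close>.\<close>
    have lim1: "((\<lambda>s. vector_derivative u (at s)) \<longlongrightarrow> vector_derivative u (at t)) (at_left t)"
    proof -
      have "isCont (\<lambda>s. vector_derivative u (at s)) t"
        using geodesic_line_chart(2)[OF \<gamma>(1) c] unfolding u_def by (rule has_vector_derivative_continuous)
      then show ?thesis by (simp add: continuous_within filterlim_at_split)
    qed
    have lim2: "((\<lambda>s. X c (u s)) \<longlongrightarrow> X c (u t)) (at_left t)"
    proof -
      have "isCont u t"
        using geodesic_line_chart(1)[OF \<gamma>(1) c] unfolding u_def by (rule has_vector_derivative_continuous)
      moreover have "isCont (X c) (u t)"
        using has_derivative_continuous[OF C.X_deriv[OF V1]] by (simp add: u_def)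
      ultimately have "isCont (\<lambda>s. X c (u s)) t" by (rule isCont_o2)
      then show ?thesis by (simp add: continuous_within filterlim_at_split)
    qed
    have "\<forall>\<^sub>F s in at_left t. vector_derivative u (at s) = X c (u s)"
      using ev
    proof eventually_elim
      case (elim s)
      then have "integral_at \<gamma> s" "\<gamma> s \<in> cdom c" using int \<epsilon>(2)[of s] s0 by auto
      then show ?case using c(1) unfolding integral_at_def u_def by (auto intro: vector_derivative_at)
    qed
    then have "((\<lambda>s. X c (u s)) \<longlongrightarrow> vector_derivative u (at t)) (at_left t)"
      by (rule Lim_transform_eventually[OF lim1])
    then have vd: "vector_derivative u (at t) = X c (u t)"
      using lim2 by (rule tendsto_unique[OF trivial_limit_at_left_real])
    have "(u has_vector_derivative X c (u t)) (at t)"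
      using geodesic_line_chart(1)[OF \<gamma>(1) c] unfolding u_def[symmetric] vd .
    then have "((cmap c \<circ> \<gamma>) has_vector_derivative X c (cmap c (\<gamma> t))) (at t)"
      by (simp only: u_def o_apply)
    moreover have "\<gamma> t \<in> \<Omega>" using V1 \<Omega>_iff[OF c] by simp
    ultimately show ?case using c by (intro integral_atI[OF cont]) auto
  qed
  with cont have "integral_curve \<gamma>" by (simp add: integral_curve_def)
  then show ?thesis using \<gamma>(2) by (rule that)
qed

text \<open>\<open>t0\<close> may be later than \<open>t\<close>: uniqueness backwards in time is
  what makes the flow injective.\<close>

lemma integral_curve_unique:
  assumes ic: "integral_curve \<gamma>" "integral_curve \<eta>" and t0: "t0 \<ge> 0" "\<gamma> t0 = \<eta> t0" and t: "t \<ge> 0"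
  shows "\<gamma> t = \<eta> t"
proof (rule connected_eq_curves[of \<gamma> \<eta> t0 t])
  show cont: "continuous_on UNIV \<gamma>" "continuous_on UNIV \<eta>" using ic by (auto simp: integral_curve_def)
  fix t assume t: "t \<ge> (0::real)" and eq: "\<gamma> t = \<eta> t"
  obtain c where c: "c \<in> A" "\<gamma> t \<in> cdom c" by (rule chart_at)
  interpret C: soliton_chart "V c" "g c" "Fc c" "scalar_curvature (g c)" by (rule chart[OF c(1)])
  have "integral_at \<gamma> t" using ic t by (simp add: integral_curve_def)
  then have "cmap c (\<gamma> t) \<in> V1 c" using c by (rule integral_at_chart)
  then obtain r where r: "r > 0" "cball (cmap c (\<gamma> t)) r \<subseteq> V1 c"
    using open_V1[OF c(1)] unfolding open_contains_cball by auto
  define W where "W = {q \<in> cdom c. cmap c q \<in> ball (cmap c (\<gamma> t)) r}"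
  have W: "open W" "\<gamma> t \<in> W" using open_chart_preimage[OF c(1) open_ball] c r by (auto simp: W_def)
  obtain e1 where e1: "e1 > 0" "\<And>s. \<bar>s - t\<bar> \<le> e1 \<Longrightarrow> \<gamma> s \<in> W"
    by (rule continuous_curve_near[OF cont(1) W]) (rule that)
  obtain e2 where e2: "e2 > 0" "\<And>s. \<bar>s - t\<bar> \<le> e2 \<Longrightarrow> \<eta> s \<in> W"
    by (rule continuous_curve_near[OF cont(2) W(1) W(2)[unfolded eq]]) (rule that)
  show "\<exists>e>0. \<forall>s\<ge>0. \<bar>s - t\<bar> \<le> e \<longrightarrow> \<gamma> s = \<eta> s"
  proof (intro exI[of _ "min e1 e2"] conjI allI impI)
    fix s assume s: "s \<ge> 0" "\<bar>s - t\<bar> \<le> min e1 e2"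
    define a b where "a = min s t" and "b = max s t"
    have W': "\<gamma> r \<in> W" "\<eta> r \<in> W" "r \<ge> 0" if "r \<in> {a..b}" for r
      using that s t e1(2)[of r] e2(2)[of r] by (auto simp: a_def b_def)
    have "cmap c (\<gamma> s) = cmap c (\<eta> s)"
    proof (rule C.integral_curves_agree[OF r(2), of a b "\<lambda>s. cmap c (\<gamma> s)" "\<lambda>s. cmap c (\<eta> s)" t s])
      fix p assume p: "p \<in> {a..b}"
      show "cmap c (\<gamma> p) \<in> cball (cmap c (\<gamma> t)) r" "cmap c (\<eta> p) \<in> cball (cmap c (\<gamma> t)) r"
        using W'[OF p] by (auto simp: W_def less_imp_le)
      have "integral_at \<gamma> p" "integral_at \<eta> p" "\<gamma> p \<in> cdom c" "\<eta> p \<in> cdom c"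
        using ic W'[OF p] by (auto simp: W_def integral_curve_def)
      then show "((\<lambda>s. cmap c (\<gamma> s)) has_vector_derivative X c (cmap c (\<gamma> p))) (at p within {a..b})"
        "((\<lambda>s. cmap c (\<eta> s)) has_vector_derivative X c (cmap c (\<eta> p))) (at p within {a..b})"
        using c(1) by (auto intro: integral_at_chart)
    qed (use eq in \<open>auto simp: a_def b_def\<close>)
    moreover have "\<gamma> s \<in> cdom c" "\<eta> s \<in> cdom c"
      using W'[of s] by (auto simp: W_def a_def b_def)
    ultimately show "\<gamma> s = \<eta> s" using cinv_cmap[OF c(1)] by metis
  qed (use e1 e2 in auto)
qed (use t0 t in auto)

subsection \<open>Volume growth along the flow\<close>

text \<open>The value is determined for regular \<open>q\<close> and \<open>t \<ge> 0\<close> only;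
  at negative times it follows the continuous extension that happens to be chosen.\<close>

definition flow :: "real \<Rightarrow> 'a \<Rightarrow> 'a" where
  "flow t q = (SOME \<gamma>. integral_curve \<gamma> \<and> \<gamma> 0 = q) t"

lemma flow_curve:
  assumes q: "q \<in> \<Omega>"
  shows "integral_curve (\<lambda>t. flow t q)" "flow 0 q = q"
proof -
  obtain \<gamma> where \<gamma>: "integral_curve \<gamma>" "\<gamma> 0 = q" by (rule integral_curve_exists[OF q])
  have "integral_curve (SOME \<gamma>. integral_curve \<gamma> \<and> \<gamma> 0 = q) \<and> (SOME \<gamma>. integral_curve \<gamma> \<and> \<gamma> 0 = q) 0 = q"
    by (rule someI[of _ \<gamma>]) (simp add: \<gamma>)
  then show "integral_curve (\<lambda>t. flow t q)" "flow 0 q = q" by (simp_all add: flow_def)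
qed

lemma flow_eq:
  assumes "integral_curve \<gamma>" "t \<ge> 0"
  shows "flow t (\<gamma> 0) = \<gamma> t"
proof -
  have "\<gamma> 0 \<in> \<Omega>" using assms(1) by (simp add: integral_curve_def integral_at_def)
  from flow_curve[OF this] show ?thesis
    using integral_curve_unique[of "\<lambda>t. flow t (\<gamma> 0)" \<gamma> 0 t] assms by simp
qed

lemma flow_integral_at: "q \<in> \<Omega> \<Longrightarrow> t \<ge> 0 \<Longrightarrow> integral_at (\<lambda>t. flow t q) t"
  using flow_curve(1) by (simp add: integral_curve_def)

lemma flow_in: "q \<in> \<Omega> \<Longrightarrow> t \<ge> 0 \<Longrightarrow> flow t q \<in> \<Omega>"
  using flow_integral_at unfolding integral_at_def by blast

lemma cont_flow: "q \<in> \<Omega> \<Longrightarrow> continuous_on UNIV (\<lambda>t. flow t q)"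
  using flow_curve(1) by (simp add: integral_curve_def)

lemma integral_curve_shift:
  assumes \<gamma>: "integral_curve \<gamma>" and s: "s \<ge> 0"
  shows "integral_curve (\<lambda>t. \<gamma> (s + t))"
  unfolding integral_curve_def
proof (intro conjI allI impI)
  show "continuous_on UNIV (\<lambda>t. \<gamma> (s + t))"
    using \<gamma> unfolding integral_curve_def
    by (intro continuous_on_compose2[of UNIV \<gamma> UNIV "\<lambda>t. s + t"]) (auto intro: continuous_intros)
  fix t :: real assume "t \<ge> 0"
  then have it: "integral_at \<gamma> (s + t)" using \<gamma> s by (simp add: integral_curve_def)
  show "integral_at (\<lambda>t. \<gamma> (s + t)) t"
    unfolding integral_at_def
  proof (intro conjI ballI impI)
    fix c assume c: "c \<in> A" "\<gamma> (s + t) \<in> cdom c"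
    then have d: "((cmap c \<circ> \<gamma>) has_derivative (\<lambda>h. h *\<^sub>R X c (cmap c (\<gamma> (s + t))))) (at (s + t))"
      using it by (simp add: integral_at_def has_vector_derivative_def)
    have "((+) s has_vector_derivative 1) (at t)"
      by (auto intro!: derivative_eq_intros simp: has_vector_derivative_def)
    from has_vector_derivative_compose_has_derivative[OF this d]
    show "((cmap c \<circ> (\<lambda>t. \<gamma> (s + t))) has_vector_derivative X c (cmap c (\<gamma> (s + t)))) (at t)"
      by (simp add: o_def)
  qed (use it in \<open>simp add: integral_at_def\<close>)
qed

lemma flow_add:
  assumes q: "q \<in> \<Omega>" and st: "s \<ge> 0" "t \<ge> 0"
  shows "flow (s + t) q = flow t (flow s q)"
  using flow_eq[OF integral_curve_shift[OF flow_curve(1)[OF q] st(1)] st(2)] by simp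

lemma flow_inj:
  assumes q: "q \<in> \<Omega>" "q' \<in> \<Omega>" and t: "t \<ge> 0" "flow t q = flow t q'"
  shows "q = q'"
  using integral_curve_unique[OF flow_curve(1)[OF q(1)] flow_curve(1)[OF q(2)] t, of 0]
  by (simp add: flow_curve(2)[OF q(1)] flow_curve(2)[OF q(2)])

text \<open>\<open>along_curve\<close> works inside one chart. The pieces can be chained if a lower
  bound for the speed is carried along, because each increment of \<open>F\<close> is governed by
  the speed at its start.\<close>

lemma F_flow:
  assumes q: "q \<in> \<Omega>" and t: "t \<ge> 0"
  shows "F (flow t q) \<ge> F q + speed q * t"
proof -
  let ?\<gamma> = "\<lambda>t. flow t q"
  have loc: "\<exists>e>0. \<forall>a b. 0 \<le> a \<and> t - e \<le> a \<and> a \<le> b \<and> b \<le> t + e \<longrightarrow>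
      speed (?\<gamma> a) \<le> speed (?\<gamma> b) \<and> F (?\<gamma> b) \<ge> F (?\<gamma> a) + speed (?\<gamma> a) * (b - a)" for t
  proof -
    obtain c where c: "c \<in> A" "?\<gamma> t \<in> cdom c" by (rule chart_at)
    obtain e where e: "e > 0" "\<And>s. \<bar>s - t\<bar> \<le> e \<Longrightarrow> ?\<gamma> s \<in> cdom c"
      by (rule continuous_curve_near[OF cont_flow[OF q] open_cdom[OF c(1)] c(2)]) (rule that)
    have "speed (?\<gamma> a) \<le> speed (?\<gamma> b) \<and> F (?\<gamma> b) \<ge> F (?\<gamma> a) + speed (?\<gamma> a) * (b - a)"
      if ab: "0 \<le> a" "t - e \<le> a" "a \<le> b" "b \<le> t + e" for a b
    proof -
      have "integral_at ?\<gamma> s \<and> ?\<gamma> s \<in> cdom c" if "s \<in> {a..b}" for s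
        using e(2)[of s] flow_integral_at[OF q, of s] that ab by auto
      from along_curve[OF c(1) this ab(3)] show ?thesis by blast
    qed
    with e(1) show ?thesis by blast
  qed
  have "speed (?\<gamma> t) \<ge> speed q \<and> F (?\<gamma> t) \<ge> F q + speed q * t"
    using t
  proof (induction t rule: nonneg_real_induct)
    case zero
    show ?case by (simp add: flow_curve(2)[OF q])
  next
    case (right t)
    then have Pt: "speed (?\<gamma> t) \<ge> speed q" "F (?\<gamma> t) \<ge> F q + speed q * t" by auto
    obtain e where e: "e > 0" "\<And>a b. 0 \<le> a \<Longrightarrow> t - e \<le> a \<Longrightarrow> a \<le> b \<Longrightarrow> b \<le> t + e \<Longrightarrow>
      speed (?\<gamma> a) \<le> speed (?\<gamma> b) \<and> F (?\<gamma> b) \<ge> F (?\<gamma> a) + speed (?\<gamma> a) * (b - a)"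
      using loc[of t] by blast
    have "speed (?\<gamma> s) \<ge> speed q \<and> F (?\<gamma> s) \<ge> F q + speed q * s" if s: "t < s" "s < t + e" for s
    proof -
      have "speed (?\<gamma> t) \<le> speed (?\<gamma> s)" "F (?\<gamma> s) \<ge> F (?\<gamma> t) + speed (?\<gamma> t) * (s - t)"
        using e(2)[of t s] s e(1) right(1) by auto
      moreover have "speed q * (s - t) \<le> speed (?\<gamma> t) * (s - t)"
        using Pt(1) s by (intro mult_right_mono) auto
      ultimately show ?thesis using Pt by (simp add: algebra_simps)
    qed
    with e(1) show ?case by blast
  next
    case (limit t)
    obtain e where e: "e > 0" "\<And>a b. 0 \<le> a \<Longrightarrow> t - e \<le> a \<Longrightarrow> a \<le> b \<Longrightarrow> b \<le> t + e \<Longrightarrow>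
      speed (?\<gamma> a) \<le> speed (?\<gamma> b) \<and> F (?\<gamma> b) \<ge> F (?\<gamma> a) + speed (?\<gamma> a) * (b - a)"
      using loc[of t] by blast
    define s where "s = max 0 (t - e)"
    have s: "0 \<le> s" "s < t" "t - e \<le> s" using e(1) limit(1) by (auto simp: s_def)
    have "speed (?\<gamma> s) \<le> speed (?\<gamma> t)" "F (?\<gamma> t) \<ge> F (?\<gamma> s) + speed (?\<gamma> s) * (t - s)"
      using e(2)[of s t] s e(1) by auto
    moreover have Ps: "speed (?\<gamma> s) \<ge> speed q" "F (?\<gamma> s) \<ge> F q + speed q * s" using limit(2)[of s] s by auto
    moreover have "speed q * (t - s) \<le> speed (?\<gamma> s) * (t - s)"
      using Ps(1) s by (intro mult_right_mono) auto
    ultimately show ?case by (simp add: algebra_simps)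
  qed
  then show ?thesis by simp
qed

text \<open>The estimate is stated through preimages, which avoids the measurability of images; the error
  \<open>1 + e\<close> comes from comparing the metric with its values frozen at \<open>q\<close> and at \<open>flow t q\<close>.\<close>

definition volume_expanding :: "'a measure \<Rightarrow> 'a \<Rightarrow> real \<Rightarrow> bool" where
  "volume_expanding \<mu> q t \<longleftrightarrow> (\<forall>e>0. \<exists>W K. open W \<and> compact K \<and> q \<in> W \<and> W \<subseteq> K \<and> K \<subseteq> \<Omega> \<and>
     continuous_on K (flow t) \<and>
     (\<forall>B\<in>sets borel. emeasure \<mu> (K \<inter> flow t -` B) \<le> ennreal (1 + e) * emeasure \<mu> B))"

lemma flow_preimage_borel:
  assumes K: "compact K" "continuous_on K (flow t)" and B: "B \<in> sets borel"
  shows "K \<inter> flow t -` B \<in> sets borel"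
proof -
  have Kb: "K \<in> sets borel" using compact_imp_closed[OF K(1)] by simp
  have "flow t \<in> borel_measurable (restrict_space borel K)"
    by (rule borel_measurable_continuous_on_restrict[OF K(2)])
  from measurable_sets[OF this B] show ?thesis
    using Kb by (simp add: sets_restrict_space_iff space_restrict_space Int_commute)
qed

text \<open>Preimages compose, so the two estimates can be applied one after the other and their
  factors multiply.\<close>

lemma volume_expanding_add:
  assumes q: "q \<in> \<Omega>" and st: "s \<ge> 0" "t \<ge> 0" and \<mu>: "sets \<mu> = sets borel"
    and vs: "volume_expanding \<mu> q s" and vt: "volume_expanding \<mu> (flow s q) t"
  shows "volume_expanding \<mu> q (s + t)"
  unfolding volume_expanding_def
proof (intro allI impI)
  fix e :: real assume e: "e > 0"
  \<comment> \<open>Two factors \<open>1 + e1\<close> multiply to exactly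
    \<open>1 + e\<close>.\<close>
  define e1 where "e1 = sqrt (1 + e) - 1"
  have e1: "e1 > 0" "(1 + e1) * (1 + e1) = 1 + e" using e by (auto simp: e1_def)
  obtain W1 K1 where 1: "open W1" "compact K1" "q \<in> W1" "W1 \<subseteq> K1" "K1 \<subseteq> \<Omega>" "continuous_on K1 (flow s)"
    "\<And>B. B \<in> sets borel \<Longrightarrow> emeasure \<mu> (K1 \<inter> flow s -` B) \<le> ennreal (1 + e1) * emeasure \<mu> B"
    using vs e1(1) unfolding volume_expanding_def by metis
  obtain W2 K2 where 2: "open W2" "compact K2" "flow s q \<in> W2" "W2 \<subseteq> K2" "K2 \<subseteq> \<Omega>" "continuous_on K2 (flow t)"
    "\<And>B. B \<in> sets borel \<Longrightarrow> emeasure \<mu> (K2 \<inter> flow t -` B) \<le> ennreal (1 + e1) * emeasure \<mu> B"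
    using vt e1(1) unfolding volume_expanding_def by metis
  define K where "K = K1 \<inter> flow s -` K2"
  define W where "W = W1 \<inter> flow s -` W2"
  have add: "flow (s + t) p = flow t (flow s p)" if "p \<in> K" for p
    using that 1(5) by (intro flow_add st) (auto simp: K_def)
  have "open W" unfolding W_def
    by (rule continuous_open_preimage[OF continuous_on_subset[OF 1(6,4)] 1(1) 2(1)])
  moreover have "compact K"
  proof -
    have "closedin (top_of_set K1) (K1 \<inter> flow s -` K2)"
      by (rule continuous_closedin_preimage[OF 1(6) compact_imp_closed[OF 2(2)]])
    then show ?thesis unfolding K_def using 1(2) closedin_compact by blast
  qed
  moreover have "q \<in> W" "W \<subseteq> K" "K \<subseteq> \<Omega>" using 1 2 by (auto simp: W_def K_def)
  moreover have "continuous_on K (flow (s + t))"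
  proof -
    have "continuous_on K (\<lambda>p. flow t (flow s p))"
      by (rule continuous_on_compose2[OF 2(6) continuous_on_subset[OF 1(6)]]) (auto simp: K_def)
    then show ?thesis by (rule continuous_on_cong[THEN iffD2, rotated -1]) (simp_all add: add)
  qed
  moreover have "emeasure \<mu> (K \<inter> flow (s + t) -` B) \<le> ennreal (1 + e) * emeasure \<mu> B" if B: "B \<in> sets borel" for B
  proof -
    have "K \<inter> flow (s + t) -` B = K1 \<inter> flow s -` (K2 \<inter> flow t -` B)"
      using add by (auto simp: K_def)
    also have "emeasure \<mu> \<dots> \<le> ennreal (1 + e1) * emeasure \<mu> (K2 \<inter> flow t -` B)"
      by (rule 1(7)[OF flow_preimage_borel[OF 2(2,6) B]])
    also have "\<dots> \<le> ennreal (1 + e1) * (ennreal (1 + e1) * emeasure \<mu> B)"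
      by (intro mult_left_mono 2(7) B) simp
    also have "\<dots> = ennreal (1 + e) * emeasure \<mu> B"
      using e1 by (simp add: mult.assoc[symmetric] ennreal_mult[symmetric] del: ennreal_plus)
    finally show ?thesis .
  qed
  ultimately show "\<exists>W K. open W \<and> compact K \<and> q \<in> W \<and> W \<subseteq> K \<and> K \<subseteq> \<Omega> \<and> continuous_on K (flow (s + t)) \<and>
     (\<forall>B\<in>sets borel. emeasure \<mu> (K \<inter> flow (s + t) -` B) \<le> ennreal (1 + e) * emeasure \<mu> B)"
    by blast
qed

section \<open>Volume comparison for short times and its continuation to all times\<close>

lemma cmap_borel:
  assumes c: "c \<in> A" and E: "E \<in> sets borel" "E \<subseteq> cdom c"
  shows "cmap c ` E \<in> sets borel"
proof -
  have "cinv c \<in> borel_measurable (restrict_space borel (V c))"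
    by (rule borel_measurable_continuous_on_restrict[OF cont_cinv[OF c]])
  from measurable_sets[OF this E(1)] have "cinv c -` E \<inter> V c \<in> sets borel"
    using open_V[OF c] by (simp add: sets_restrict_space_iff space_restrict_space)
  moreover have "cinv c -` E \<inter> V c = cmap c ` E"
  proof
    show "cinv c -` E \<inter> V c \<subseteq> cmap c ` E"
    proof
      fix y assume y: "y \<in> cinv c -` E \<inter> V c"
      then have "y = cmap c (cinv c y)" using cmap_cinv[OF c, of y] by simp
      then show "y \<in> cmap c ` E" by (rule image_eqI) (use y in simp)
    qed
    show "cmap c ` E \<subseteq> cinv c -` E \<inter> V c" using cinv_cmap[OF c] E(2) by auto
  qed
  ultimately show ?thesis by simp
qed

text \<open>\<open>X\<close> is bounded on a coordinate ball, so trajectories that start in a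
  smaller ball need a definite time to leave the larger one, uniformly in the starting
  point.\<close>

lemma flow_box:
  assumes q0: "q0 \<in> \<Omega>"
  obtains c x0 r r' r1 h where "c \<in> A" "q0 \<in> cdom c" "x0 = cmap c q0" "0 < r1" "r1 \<le> r" "r < r'" "cball x0 r' \<subseteq> V1 c" "h > 0"
    "\<And>q t. q \<in> cdom c \<Longrightarrow> cmap c q \<in> ball x0 r1 \<Longrightarrow> 0 \<le> t \<Longrightarrow> t \<le> h \<Longrightarrow>
      flow t q \<in> cdom c \<and> soliton_chart.traj (g c) (Fc c) (cball x0 r) t (\<lambda>s. cmap c (flow s q))"
proof -
  obtain c where c: "c \<in> A" "q0 \<in> cdom c" by (rule chart_at)
  interpret C: soliton_chart "V c" "g c" "Fc c" "scalar_curvature (g c)" by (rule chart[OF c(1)])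
  define x0 where "x0 = cmap c q0"
  have "x0 \<in> V1 c" using q0 \<Omega>_iff[OF c] by (simp add: x0_def)
  then obtain r' where r': "r' > 0" "cball x0 r' \<subseteq> V1 c"
    using open_V1[OF c(1)] unfolding open_contains_cball by auto
  define r where "r = r' / 2"
  have r: "r > 0" "r < r'" "cball x0 r \<subseteq> V1 c" using r' by (auto simp: r_def subset_eq)
  have rV: "cball x0 r \<subseteq> V c" using r(3) V1_subset[OF c(1)] by blast
  have "compact (X c ` cball x0 r)"
    by (intro compact_continuous_image continuous_on_subset[OF C.cont_X r(3)]) simp
  then obtain b where b: "\<And>y. y \<in> cball x0 r \<Longrightarrow> norm (X c y) \<le> b"
    using compact_imp_bounded bounded_iff by (metis image_eqI)
  define B where "B = max b 1"
  have B: "B > 0" "\<And>y. y \<in> cball x0 r \<Longrightarrow> norm (X c y) \<le> B" unfolding B_def using b by (simp_all add: max.coboundedI1)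
  \<comment> \<open>With coordinate speed at most \<open>B\<close>, a trajectory moves at most
    \<open>r / 4\<close> within time \<open>h\<close>; it starts within \<open>r / 2\<close> of
    \<open>x0\<close> and so stays inside the ball of radius \<open>r\<close>.\<close>
  define r1 h where "r1 = r / 2" and "h = r / (4 * B)"
  have rh: "0 < r1" "r1 \<le> r" "h > 0" using r B by (auto simp: r1_def h_def)
  define W where "W = {q \<in> cdom c. cmap c q \<in> ball x0 r}"
  have openW: "open W" unfolding W_def by (rule open_chart_preimage[OF c(1) open_ball])
  \<comment> \<open>Being compact, \<open>K\<close> is closed in the whole manifold; hence a limit
    of points of \<open>W\<close> cannot escape from the domain of the chart.\<close>
  define K where "K = cinv c ` cball x0 r"
  have "compact K" unfolding K_def
    by (intro compact_continuous_image continuous_on_subset[OF cont_cinv[OF c(1)] rV]) simp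
  then have closedK: "closed K" by (rule compact_imp_closed)
  have inK: "q \<in> cdom c \<and> cmap c q \<in> cball x0 r" if "q \<in> K" for q
    using that rV cmap_cinv[OF c(1)] cinv_in[OF c(1)] by (auto simp: K_def)
  have WK: "W \<subseteq> K"
  proof
    fix q assume "q \<in> W"
    then show "q \<in> K" unfolding W_def K_def using cinv_cmap[OF c(1), of q] by (intro image_eqI[of _ _ "cmap c q"]) auto
  qed
  have box: "flow t q \<in> W" if q: "q \<in> cdom c" "cmap c q \<in> ball x0 r1" and t: "0 \<le> t" "t \<le> h" for q t
  proof -
    let ?u = "\<lambda>s. cmap c (flow s q)"
    have q\<Omega>: "q \<in> \<Omega>" using \<Omega>_iff[OF c(1) q(1)] q(2) rh(2) r(3) by (auto simp: subset_eq)
    have "t \<le> h \<longrightarrow> flow t q \<in> W" using t(1)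
    proof (induction t rule: nonneg_real_induct)
      case zero
      then show ?case using q rh by (auto simp: flow_curve(2)[OF q\<Omega>] W_def)
    next
      case (right t)
      show ?case
      proof (cases "t \<le> h")
        case True
        then have "flow t q \<in> W" using right by auto
        then obtain e where "e > 0" "\<And>s. \<bar>s - t\<bar> \<le> e \<Longrightarrow> flow s q \<in> W"
          by (rule continuous_curve_near[OF cont_flow[OF q\<Omega>] openW]) (rule that)
        then show ?thesis by (intro exI[of _ e]) auto
      qed (auto intro: exI[of _ 1])
    next
      case (limit t)
      show ?case
      proof
        assume th: "t \<le> h"
        have "flow t q \<in> K"
        proof (rule Lim_in_closed_set[OF closedK])
          show "((\<lambda>s. flow s q) \<longlongrightarrow> flow t q) (at_left t)"
            using cont_flow[OF q\<Omega>] by (simp add: continuous_on_eq_continuous_at continuous_within filterlim_at_split)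
          show "\<forall>\<^sub>F s in at_left t. flow s q \<in> K"
            using eventually_at_left_real[OF limit(1)]
            by eventually_elim (use limit(2) WK th in auto)
        qed simp
        then have all: "flow s q \<in> K" if "s \<in> {0..t}" for s
          using that limit(2)[of s] WK th by (cases "s = t") auto
        have d: "(?u has_vector_derivative X c (?u s)) (at s)" if "s \<in> {0..t}" for s
          using integral_at_chart(2)[OF flow_integral_at[OF q\<Omega>, of s] c(1)] inK[OF all[OF that]] that by auto
        have "\<exists>s\<in>{0<..<t}. norm (?u t - ?u 0) \<le> norm ((t - 0) *\<^sub>R X c (?u s))"
        proof (rule mvt_general[of 0 t ?u "\<lambda>s h. h *\<^sub>R X c (?u s)"])
          show "continuous_on {0..t} ?u"
            using d by (intro continuous_at_imp_continuous_on ballI has_vector_derivative_continuous)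
          show "(?u has_derivative (\<lambda>h. h *\<^sub>R X c (?u s))) (at s)" if "0 < s" "s < t" for s
            using d[of s] that by (simp add: has_vector_derivative_def)
        qed (use limit in auto)
        then obtain s where s: "s \<in> {0<..<t}" "norm (?u t - ?u 0) \<le> t * norm (X c (?u s))" using limit(1) by auto
        have "norm (X c (?u s)) \<le> B" using B(2) inK[OF all[of s]] s(1) by auto
        then have "t * norm (X c (?u s)) \<le> h * B" using th limit(1) B(1) by (intro mult_mono) auto
        then have "norm (?u t - ?u 0) \<le> r / 4" using s(2) B(1) by (simp add: h_def)
        moreover have "dist x0 (?u 0) < r / 2" using q(2) by (simp add: flow_curve(2)[OF q\<Omega>] r1_def)
        ultimately have "dist x0 (?u t) < r"
          using dist_triangle[of x0 "?u t" "?u 0"] r(1) by (simp add: dist_norm norm_minus_commute)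
        then show "flow t q \<in> W" using inK[OF \<open>flow t q \<in> K\<close>] by (simp add: W_def)
      qed
    qed
    then show ?thesis using t(2) by blast
  qed
  show ?thesis
  proof (rule that[OF c x0_def rh(1,2) r(2) r'(2) rh(3)])
    fix q t assume q: "q \<in> cdom c" "cmap c q \<in> ball x0 r1" and t: "0 \<le> t" "t \<le> h"
    have q\<Omega>: "q \<in> \<Omega>" using \<Omega>_iff[OF c(1) q(1)] q(2) rh(2) r(3) by (auto simp: subset_eq)
    have "cmap c (flow s q) \<in> cball x0 r \<and>
      ((\<lambda>s. cmap c (flow s q)) has_vector_derivative X c (cmap c (flow s q))) (at s within {0..t})" if s: "s \<in> {0..t}" for s
    proof -
      have w: "flow s q \<in> W" using box[OF q, of s] s t by auto
      then have "flow s q \<in> cdom c" by (simp add: W_def)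
      from integral_at_chart(2)[OF flow_integral_at[OF q\<Omega>] c(1) this] s w
      show ?thesis by (auto simp: W_def)
    qed
    moreover have "flow t q \<in> cdom c" using box[OF q t] by (simp add: W_def)
    ultimately show "flow t q \<in> cdom c \<and> C.traj (cball x0 r) t (\<lambda>s. cmap c (flow s q))"
      by (auto simp: C.traj_def)
  qed
qed

text \<open>In a chart the short-time flow is covered by \<open>flow_map_measure\<close>. The same
  \<open>h\<close> serves all points of \<open>W\<close>, which the continuation to a limit time
  relies on.\<close>

lemma volume_expanding_small:
  assumes q0: "q0 \<in> \<Omega>" and \<mu>: "riemannian_volume A g \<mu>"
  obtains W h where "open W" "q0 \<in> W" "h > 0" "\<And>q t. q \<in> W \<Longrightarrow> 0 \<le> t \<Longrightarrow> t \<le> h \<Longrightarrow> volume_expanding \<mu> q t"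
proof -
  obtain c x0 r r' r1 h where c: "c \<in> A" "q0 \<in> cdom c" and x0: "x0 = cmap c q0"
    and r: "0 < r1" "r1 \<le> r" "r < r'" "cball x0 r' \<subseteq> V1 c" and h: "h > 0"
    and box: "\<And>q t. q \<in> cdom c \<Longrightarrow> cmap c q \<in> ball x0 r1 \<Longrightarrow> 0 \<le> t \<Longrightarrow> t \<le> h \<Longrightarrow>
      flow t q \<in> cdom c \<and> soliton_chart.traj (g c) (Fc c) (cball x0 r) t (\<lambda>s. cmap c (flow s q))"
    by (rule flow_box[OF q0]) (rule that)
  interpret C: soliton_chart "V c" "g c" "Fc c" "scalar_curvature (g c)" by (rule chart[OF c(1)])
  have emu: "emeasure \<mu> E = (\<integral>\<^sup>+ x\<in>cmap c ` E. ennreal (sqrt (det (g c x))) \<partial>lborel)"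
    if "E \<in> sets borel" "E \<subseteq> cdom c" for E
    using \<mu> c(1) that by (simp add: riemannian_volume_def)
  have sets: "sets \<mu> = sets borel" using \<mu> by (simp add: riemannian_volume_def)
  define W where "W = {q \<in> cdom c. cmap c q \<in> ball x0 r1}"
  have r1V: "ball x0 r1 \<subseteq> V1 c" using r by (auto simp: subset_eq)
  show ?thesis
  proof (rule that[of W h])
    show "open W" unfolding W_def by (rule open_chart_preimage[OF c(1) open_ball])
    show "q0 \<in> W" using c x0 r(1) by (simp add: W_def)
    fix q t assume q: "q \<in> W" and t: "0 \<le> t" "t \<le> h"
    define x where "x = cmap c q"
    define \<delta> where "\<delta> = r1 - dist x0 x"
    have \<delta>: "\<delta> > 0" using q by (simp add: W_def \<delta>_def x_def)
    have sub: "ball x \<delta> \<subseteq> ball x0 r1"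
    proof
      fix y assume "y \<in> ball x \<delta>"
      then show "y \<in> ball x0 r1" using dist_triangle[of x0 y x] by (simp add: \<delta>_def)
    qed
    have V: "y \<in> V c" if "y \<in> ball x \<delta>" for y using that sub r1V V1_subset[OF c(1)] by blast
    define \<phi> where "\<phi> y = cmap c (flow t (cinv c y))" for y
    have in\<Omega>: "cinv c y \<in> \<Omega>" "cinv c y \<in> cdom c" if "y \<in> ball x \<delta>" for y
      using \<Omega>_iff[OF c(1), of "cinv c y"] cinv_in[OF c(1) V[OF that]] cmap_cinv[OF c(1) V[OF that]] sub r1V that by auto
    have traj: "flow t (cinv c y) \<in> cdom c \<and> C.traj (cball x0 r) t (\<lambda>s. cmap c (flow s (cinv c y)))"
      if y: "y \<in> ball x \<delta>" for y
      by (rule box) (use cmap_cinv[OF c(1) V[OF y]] in\<Omega>[OF y] sub y t in auto)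
    have fl: "\<exists>u. C.traj (cball x0 r) t u \<and> u 0 = y \<and> u t = \<phi> y" if y: "y \<in> ball x \<delta>" for y
      using traj[OF y] by (intro exI[of _ "\<lambda>s. cmap c (flow s (cinv c y))"])
        (simp add: flow_curve(2)[OF in\<Omega>(1)[OF y]] cmap_cinv[OF c(1) V[OF y]] \<phi>_def)
    have cont\<phi>: "continuous_on (ball x \<delta>) \<phi>"
      by (rule C.flow_map_measure(1)[OF r(4,3) t(1) \<delta> fl])
    show "volume_expanding \<mu> q t"
      unfolding volume_expanding_def
    proof (intro allI impI)
      fix e :: real assume e: "e > 0"
      obtain d where d: "d > 0" "d \<le> \<delta>" and all: "\<forall>\<delta>'. 0 < \<delta>' \<and> \<delta>' \<le> d \<longrightarrow> (\<forall>B\<in>sets borel. B \<subseteq> V1 c \<longrightarrow>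
        (\<integral>\<^sup>+ y\<in>ball x \<delta>' \<inter> \<phi> -` B. ennreal (sqrt (det (g c y))) \<partial>lborel) \<le>
          ennreal (1 + e) * (\<integral>\<^sup>+ y\<in>B. ennreal (sqrt (det (g c y))) \<partial>lborel))"
        by (rule exE[OF C.flow_map_measure(2)[OF r(4,3) t(1) \<delta> fl e]], assumption) (elim conjE, rule that)
      have all': "\<forall>B\<in>sets borel. B \<subseteq> V1 c \<longrightarrow>
        (\<integral>\<^sup>+ y\<in>ball x d \<inter> \<phi> -` B. ennreal (sqrt (det (g c y))) \<partial>lborel) \<le>
          ennreal (1 + e) * (\<integral>\<^sup>+ y\<in>B. ennreal (sqrt (det (g c y))) \<partial>lborel)"
        by (rule mp[OF spec[OF all, of d]]) (simp add: d(1))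
      have d3: "(\<integral>\<^sup>+ y\<in>ball x d \<inter> \<phi> -` B. ennreal (sqrt (det (g c y))) \<partial>lborel) \<le>
          ennreal (1 + e) * (\<integral>\<^sup>+ y\<in>B. ennreal (sqrt (det (g c y))) \<partial>lborel)"
        if "B \<in> sets borel" "B \<subseteq> V1 c" for B
        using bspec[OF all' that(1)] that(2) by (rule mp)
      \<comment> \<open>Half the radius gives a compact set inside the ball on which
        \<open>d3\<close> holds.\<close>
      define K where "K = cinv c ` cball x (d / 2)"
      define W' where "W' = {p \<in> cdom c. cmap c p \<in> ball x (d / 2)}"
      have cb: "cball x (d / 2) \<subseteq> ball x d" "ball x d \<subseteq> ball x \<delta>" using d by auto
      then have cV: "cball x (d / 2) \<subseteq> V c" using V by blast
      have Kp: "p \<in> cdom c \<and> p \<in> \<Omega> \<and> cmap c p \<in> ball x d \<and> flow t p \<in> cdom c \<and> flow t p = cinv c (\<phi> (cmap c p))"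
        if "p \<in> K" for p
      proof -
        obtain y where y: "y \<in> cball x (d / 2)" "p = cinv c y" using \<open>p \<in> K\<close> by (auto simp: K_def)
        have yb: "y \<in> ball x d" "y \<in> ball x \<delta>" using y(1) cb by blast+
        have "cmap c p = y" using cmap_cinv[OF c(1) V[OF yb(2)]] y by simp
        then show ?thesis using y in\<Omega>[OF yb(2)] yb traj[OF yb(2)] cinv_cmap[OF c(1)] by (auto simp: \<phi>_def)
      qed
      have \<phi>p: "\<phi> (cmap c p) = cmap c (flow t p)" if "p \<in> K" for p
        unfolding \<phi>_def by (simp only: cinv_cmap[OF c(1) conjunct1[OF Kp[OF that]]])
      have "open W'" unfolding W'_def by (rule open_chart_preimage[OF c(1) open_ball])
      moreover have cK: "compact K" unfolding K_def
        by (intro compact_continuous_image continuous_on_subset[OF cont_cinv[OF c(1)] cV]) simp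
      moreover have "q \<in> W'" using q d(1) by (simp add: W'_def W_def x_def)
      moreover have "W' \<subseteq> K"
      proof
        fix p assume "p \<in> W'"
        then show "p \<in> K" unfolding W'_def K_def using cinv_cmap[OF c(1), of p] by (intro image_eqI[of _ _ "cmap c p"]) auto
      qed
      moreover have "K \<subseteq> \<Omega>" using Kp by blast
      moreover have contK: "continuous_on K (flow t)"
      proof -
        have cm: "continuous_on K (cmap c)" using cont_cmap[OF c(1)] by (rule continuous_on_subset) (use Kp in blast)
        have "continuous_on K (\<lambda>p. \<phi> (cmap c p))"
          by (rule continuous_on_compose2[OF cont\<phi> cm]) (use Kp cb in blast)
        then have "continuous_on K (\<lambda>p. cinv c (\<phi> (cmap c p)))"
        proof (rule continuous_on_compose2[OF cont_cinv[OF c(1)]])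
          show "(\<lambda>p. \<phi> (cmap c p)) ` K \<subseteq> V c"
          proof (rule image_subsetI)
            fix p assume p: "p \<in> K"
            show "\<phi> (cmap c p) \<in> V c" unfolding \<phi>p[OF p] using Kp[OF p] by blast
          qed
        qed
        then show ?thesis by (rule continuous_on_cong[THEN iffD2, rotated -1]) (use Kp in auto)
      qed
      moreover have "emeasure \<mu> (K \<inter> flow t -` B) \<le> ennreal (1 + e) * emeasure \<mu> B" if B: "B \<in> sets borel" for B
      proof -
        define E where "E = K \<inter> flow t -` B"
        \<comment> \<open>From \<open>K\<close> only regular points in the domain of
          \<open>c\<close> are reached, and the chart estimate is available for those.\<close>
        define B1 where "B1 = B \<inter> cdom c \<inter> \<Omega>"
        have B1: "B1 \<in> sets borel" "B1 \<subseteq> cdom c" using B open_cdom[OF c(1)] open_\<Omega> by (auto simp: B1_def)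
        have E: "E \<in> sets borel" "E \<subseteq> cdom c" unfolding E_def
          using flow_preimage_borel[OF cK contK B] Kp by auto
        have sub': "cmap c ` E \<subseteq> ball x d \<inter> \<phi> -` (cmap c ` B1)"
        proof
          fix y assume "y \<in> cmap c ` E"
          then obtain p where p: "p \<in> K" "flow t p \<in> B" "y = cmap c p" by (auto simp: E_def)
          have "flow t p \<in> \<Omega>" using Kp[OF p(1)] t(1) by (blast intro: flow_in)
          moreover have "flow t p \<in> cdom c" using Kp[OF p(1)] by blast
          ultimately have "flow t p \<in> B1" using p(2) unfolding B1_def by blast
          moreover have "\<phi> y = cmap c (flow t p)" unfolding p(3) by (rule \<phi>p[OF p(1)])
          ultimately show "y \<in> ball x d \<inter> \<phi> -` (cmap c ` B1)" using p Kp[OF p(1)] by auto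
        qed
        have "emeasure \<mu> E = (\<integral>\<^sup>+ y\<in>cmap c ` E. ennreal (sqrt (det (g c y))) \<partial>lborel)" by (rule emu[OF E])
        also have "\<dots> \<le> (\<integral>\<^sup>+ y\<in>ball x d \<inter> \<phi> -` (cmap c ` B1). ennreal (sqrt (det (g c y))) \<partial>lborel)"
          using sub' by (intro nn_integral_mono) (auto simp: indicator_def)
        also have "\<dots> \<le> ennreal (1 + e) * (\<integral>\<^sup>+ y\<in>cmap c ` B1. ennreal (sqrt (det (g c y))) \<partial>lborel)"
        proof (rule d3[OF cmap_borel[OF c(1) B1]])
          show "cmap c ` B1 \<subseteq> V1 c" using \<Omega>_iff[OF c(1)] by (auto simp: B1_def)
        qed
        also have "\<dots> = ennreal (1 + e) * emeasure \<mu> B1" by (simp only: emu[OF B1])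
        also have "\<dots> \<le> ennreal (1 + e) * emeasure \<mu> B"
          using B sets by (intro mult_left_mono emeasure_mono) (auto simp: B1_def)
        finally show ?thesis by (simp only: E_def)
      qed
      ultimately show "\<exists>W K. open W \<and> compact K \<and> q \<in> W \<and> W \<subseteq> K \<and> K \<subseteq> \<Omega> \<and> continuous_on K (flow t) \<and>
        (\<forall>B\<in>sets borel. emeasure \<mu> (K \<inter> flow t -` B) \<le> ennreal (1 + e) * emeasure \<mu> B)" by blast
    qed
  qed fact
qed

text \<open>A short flow starting at \<open>flow t q\<close> is composed after a long one starting
  at \<open>q\<close>. At a limit time one stops at \<open>s\<close> just before \<open>t\<close>,
  when the trajectory has already entered the neighbourhood of \<open>flow t q\<close> and the
  remaining time is at most its \<open>h\<close>.\<close>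

lemma volume_expanding:
  assumes q: "q \<in> \<Omega>" and \<mu>: "riemannian_volume A g \<mu>" and t: "t \<ge> 0"
  shows "volume_expanding \<mu> q t"
  using t
proof (induction t rule: nonneg_real_induct)
  case zero
  obtain W h where "open W" "q \<in> W" "h > 0" "\<And>p t. p \<in> W \<Longrightarrow> 0 \<le> t \<Longrightarrow> t \<le> h \<Longrightarrow> volume_expanding \<mu> p t"
    by (rule volume_expanding_small[OF q \<mu>]) (rule that)
  then show ?case by simp
next
  case (right t)
  obtain W h where W: "flow t q \<in> W" "h > 0" "\<And>p t. p \<in> W \<Longrightarrow> 0 \<le> t \<Longrightarrow> t \<le> h \<Longrightarrow> volume_expanding \<mu> p t"
    by (rule volume_expanding_small[OF flow_in[OF q right(1)] \<mu>]) (rule that)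
  have "volume_expanding \<mu> q s" if s: "t < s" "s < t + h" for s
    using volume_expanding_add[OF q right(1), of "s - t" \<mu>] right W(1) W(3)[of "flow t q" "s - t"] s \<mu>
    by (simp add: riemannian_volume_def)
  with W(2) show ?case by blast
next
  case (limit t)
  have t0: "t \<ge> 0" using limit(1) by simp
  obtain W h where W: "open W" "flow t q \<in> W" "h > 0" "\<And>p t. p \<in> W \<Longrightarrow> 0 \<le> t \<Longrightarrow> t \<le> h \<Longrightarrow> volume_expanding \<mu> p t"
    by (rule volume_expanding_small[OF flow_in[OF q t0] \<mu>]) (rule that)
  obtain \<epsilon> where \<epsilon>: "\<epsilon> > 0" "\<And>s. \<bar>s - t\<bar> \<le> \<epsilon> \<Longrightarrow> flow s q \<in> W"
    by (rule continuous_curve_near[OF cont_flow[OF q] W(1,2)]) (rule that)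
  define s where "s = max 0 (t - min \<epsilon> h)"
  have s: "0 \<le> s" "s < t" "t - s \<le> \<epsilon>" "t - s \<le> h" using \<epsilon>(1) W(3) limit(1) by (auto simp: s_def)
  have "volume_expanding \<mu> (flow s q) (t - s)" using W(4) \<epsilon>(2)[of s] s by simp
  then show ?case
    using volume_expanding_add[OF q s(1), of "t - s" \<mu>] limit(2)[OF s(1,2)] s \<mu> by (simp add: riemannian_volume_def)
qed

text \<open>\<open>U\<close> is covered by countably many pieces, and the cutting is done in the
  target: the images of the compact sets are made disjoint, and the corresponding parts of
  \<open>B\<close> are pulled back. The volumes of these parts add up to at most that of
  \<open>B\<close>.\<close>

lemma measure_superlevel:
  assumes \<mu>: "riemannian_volume A g \<mu>" and U: "open U" "U \<subseteq> \<Omega>" and t: "t \<ge> 0"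
    and B: "B \<in> sets borel" "\<And>q. q \<in> U \<Longrightarrow> flow t q \<in> B"
  shows "emeasure \<mu> U \<le> 2 * emeasure \<mu> B"
proof (cases "U = {}")
  case False
  have sets: "sets \<mu> = sets borel" using \<mu> by (simp add: riemannian_volume_def)
  \<comment> \<open>The estimate is fixed at error \<open>1\<close>, the origin of the factor
    2.\<close>
  define good where "good q W K \<longleftrightarrow> open W \<and> compact K \<and> q \<in> W \<and> W \<subseteq> K \<and> K \<subseteq> \<Omega> \<and> continuous_on K (flow t) \<and>
     (\<forall>B\<in>sets borel. emeasure \<mu> (K \<inter> flow t -` B) \<le> ennreal (1 + 1) * emeasure \<mu> B)" for q W K
  have "\<exists>W K. good q W K" if "q \<in> U" for q
  proof -
    have "q \<in> \<Omega>" using that U(2) by blast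
    from volume_expanding[OF this \<mu> t] show ?thesis
      unfolding volume_expanding_def good_def
      by (rule allE[of _ 1]) (erule impE, rule zero_less_one, assumption)
  qed
  then obtain W K where "\<And>q. q \<in> U \<Longrightarrow> good q (W q) (K q)" by metis
  note WK = this[unfolded good_def]
  obtain \<F> where \<F>: "\<F> \<subseteq> W ` U" "countable \<F>" "\<Union>\<F> = \<Union>(W ` U)"
  proof (rule Lindelof[of "W ` U"])
    show "open S" if "S \<in> W ` U" for S using that WK by blast
  qed (rule that)
  have "countable \<F> \<and> \<F> \<subseteq> W ` U" using \<F>(1,2) by simp
  then have "\<exists>C. countable C \<and> C \<subseteq> U \<and> \<F> = W ` C" by (simp only: countable_subset_image)
  then obtain C where C: "countable C" "C \<subseteq> U" "\<F> = W ` C" by (elim exE conjE)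
  have cover: "U \<subseteq> (\<Union>q\<in>C. W q)" using \<F>(3) C(3) WK by blast
  then have "C \<noteq> {}" using False by blast
  define k where "k = from_nat_into C"
  have k: "range k = C" unfolding k_def by (rule range_from_nat_into[OF \<open>C \<noteq> {}\<close> C(1)])
  have kU: "k i \<in> U" for i using k C(2) by blast
  note Ki = WK[OF kU]
  define I where "I i = flow t ` K (k i)" for i
  have I: "I i \<in> sets borel" for i
  proof -
    have "compact (I i)" unfolding I_def using Ki[of i] by (intro compact_continuous_image) auto
    then show ?thesis by (simp add: compact_imp_closed)
  qed
  define D where "D i = B \<inter> disjointed I i" for i
  have "range (disjointed I) \<subseteq> sets borel"
    using I by (intro sets.range_disjointed_sets) auto
  then have D: "D i \<in> sets borel" for i using B(1) by (auto simp: D_def)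
  have "disjoint_family D"
    using disjoint_family_disjointed[of I] by (auto simp: disjoint_family_on_def D_def)
  define E where "E i = K (k i) \<inter> flow t -` D i" for i
  have E: "E i \<in> sets borel" for i
    unfolding E_def using Ki[of i] D by (intro flow_preimage_borel) auto
  have "U \<subseteq> (\<Union>i. E i)"
  proof
    fix q assume q: "q \<in> U"
    from q cover obtain c where c: "c \<in> C" "q \<in> W c" by auto
    from c(1) obtain j where "c = k j" unfolding k[symmetric] by auto
    then have j: "q \<in> K (k j)" using c(2) Ki[of j] by auto
    then have "flow t q \<in> (\<Union>i. I i)" by (auto simp: I_def)
    then have "flow t q \<in> (\<Union>i. disjointed I i)" by (simp only: UN_disjointed_eq)
    then obtain i where i: "flow t q \<in> disjointed I i" by (rule UN_E)
    have "flow t q \<in> I i" by (rule subsetD[OF disjointed_subset i])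
    then obtain q' where q': "q' \<in> K (k i)" "flow t q = flow t q'" by (auto simp: I_def)
    \<comment> \<open>The compact set whose image contains \<open>flow t q\<close> need not be the
      one chosen to cover \<open>q\<close>; injectivity of the flow shows that it contains
      \<open>q\<close> all the same.\<close>
    have "q = q'"
      by (rule flow_inj[OF _ _ t q'(2)]) (use q U(2) q'(1) Ki[of i] in auto)
    then have "q \<in> E i" using q'(1) i B(2)[OF q] by (simp add: E_def D_def)
    then show "q \<in> (\<Union>i. E i)" by blast
  qed
  then have "emeasure \<mu> U \<le> emeasure \<mu> (\<Union>i. E i)"
    using E sets by (intro emeasure_mono) auto
  also have "\<dots> \<le> (\<Sum>i. emeasure \<mu> (E i))"
    using E sets by (intro emeasure_subadditive_countably) auto
  also have "\<dots> \<le> (\<Sum>i. 2 * emeasure \<mu> (D i))"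
  proof (intro suminf_le summableI)
    fix i
    have "emeasure \<mu> (E i) \<le> ennreal (1 + 1) * emeasure \<mu> (D i)"
    proof -
      have "\<forall>B\<in>sets borel. emeasure \<mu> (K (k i) \<inter> flow t -` B) \<le> ennreal (1 + 1) * emeasure \<mu> B"
        using Ki[of i] by (elim conjE)
      then show ?thesis unfolding E_def using D[of i] by (rule bspec)
    qed
    then show "emeasure \<mu> (E i) \<le> 2 * emeasure \<mu> (D i)" by simp
  qed
  also have "\<dots> = 2 * (\<Sum>i. emeasure \<mu> (D i))" by (rule ennreal_suminf_cmult)
  also have "(\<Sum>i. emeasure \<mu> (D i)) = emeasure \<mu> (\<Union>i. D i)"
    using D sets \<open>disjoint_family D\<close> by (intro suminf_emeasure) auto
  also have "2 * \<dots> \<le> 2 * emeasure \<mu> B"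
    using B sets by (intro mult_left_mono emeasure_mono) (auto simp: D_def)
  finally show ?thesis .
qed simp

section \<open>Positivity of volume, critical potentials and superlevel sets\<close>

lemma volume_open_pos:
  assumes \<mu>: "riemannian_volume A g \<mu>" and U: "open U" "U \<noteq> {}"
  shows "emeasure \<mu> U > 0"
proof -
  obtain q where q: "q \<in> U" using U(2) by blast
  obtain c where c: "c \<in> A" "q \<in> cdom c" by (rule chart_at)
  interpret C: soliton_chart "V c" "g c" "Fc c" "scalar_curvature (g c)" by (rule chart[OF c(1)])
  have sets: "sets \<mu> = sets borel" using \<mu> by (simp add: riemannian_volume_def)
  define E where "E = U \<inter> cdom c"
  have E: "E \<in> sets borel" "E \<subseteq> cdom c" using U(1) open_cdom[OF c(1)] by (auto simp: E_def)
  have "cmap c ` E = V c \<inter> cinv c -` U"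
    using cinv_cmap[OF c(1)] cmap_cinv[OF c(1)] cinv_in[OF c(1)] by (auto simp: E_def)
  then have "open (cmap c ` E)"
    using continuous_open_preimage[OF cont_cinv[OF c(1)] open_V[OF c(1)] U(1)] by simp
  moreover have "cmap c q \<in> cmap c ` E" using q c(2) by (auto simp: E_def)
  ultimately obtain r where r: "r > 0" "cball (cmap c q) r \<subseteq> cmap c ` E"
    unfolding open_contains_cball by blast
  let ?K = "cball (cmap c q) r"
  have KV: "?K \<subseteq> V c" using r(2) E(2) by blast
  have "continuous_on ?K (\<lambda>x. det (g c x))"
    unfolding det_def by (intro continuous_intros continuous_on_subset[OF C.cont_G KV])
  then obtain y where y: "y \<in> ?K" "\<And>x. x \<in> ?K \<Longrightarrow> det (g c y) \<le> det (g c x)"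
    using continuous_attains_inf[of ?K "\<lambda>x. det (g c x)"] r(1) by auto
  define m where "m = sqrt (det (g c y))"
  have m: "m > 0" unfolding m_def using pos_def_det_pos[OF C.pos] y(1) KV by auto
  have "0 < ennreal m * emeasure lborel ?K"
  proof -
    have "emeasure lborel ?K \<noteq> 0"
      using content_cball_gt_0_iff[of "cmap c q" r] r(1) by (auto simp: measure_def)
    then show ?thesis using m by (simp add: ennreal_zero_less_mult_iff zero_less_iff_neq_zero)
  qed
  also have "\<dots> = (\<integral>\<^sup>+ x\<in>?K. ennreal m \<partial>lborel)" by (simp add: nn_integral_cmult_indicator)
  also have "\<dots> \<le> (\<integral>\<^sup>+ x\<in>cmap c ` E. ennreal (sqrt (det (g c x))) \<partial>lborel)"
    using r(2) y(2) by (intro nn_integral_mono) (auto simp: indicator_def m_def intro!: ennreal_leI)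
  also have "\<dots> = emeasure \<mu> E" using \<mu> c(1) E by (simp add: riemannian_volume_def)
  also have "\<dots> \<le> emeasure \<mu> U" using U(1) sets by (intro emeasure_mono) (auto simp: E_def)
  finally show ?thesis .
qed

lemma constant_if_no_regular_point:
  assumes "\<Omega> = {}"
  shows "trivial_potential F"
proof -
  have "\<forall>q\<in>UNIV. \<forall>\<^sub>F p in at q within UNIV. F q = F p"
  proof
    fix q
    obtain c where c: "c \<in> A" "q \<in> cdom c" by (rule chart_at)
    interpret C: soliton_chart "V c" "g c" "Fc c" "scalar_curvature (g c)" by (rule chart[OF c(1)])
    have "cmap c q \<in> V c" using c(2) by blast
    then obtain r where r: "r > 0" "ball (cmap c q) r \<subseteq> V c"
      using open_V[OF c(1)] unfolding open_contains_ball by blast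
    have grad0: "coord_grad (Fc c) x = 0" if x: "x \<in> V c" for x
    proof (rule ccontr)
      assume "coord_grad (Fc c) x \<noteq> 0"
      then have "cinv c x \<in> \<Omega>"
        using x by (simp add: \<Omega>_iff[OF c(1) cinv_in[OF c(1) x]] cmap_cinv[OF c(1) x] V1_eq[OF c(1)])
      then show False using assms by blast
    qed
    have "\<exists>k. \<forall>x\<in>ball (cmap c q) r. Fc c x = k"
    proof (rule has_derivative_zero_constant[OF convex_ball])
      fix x assume "x \<in> ball (cmap c q) r"
      then have x: "x \<in> V c" using r(2) by blast
      show "(Fc c has_derivative (\<lambda>h. 0)) (at x within ball (cmap c q) r)"
        using has_derivative_at_withinI[OF C.f_deriv[OF x]] by (simp add: grad0[OF x])
    qed
    then obtain k where k: "\<And>x. x \<in> ball (cmap c q) r \<Longrightarrow> Fc c x = k" by blast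
    define W where "W = {p \<in> cdom c. cmap c p \<in> ball (cmap c q) r}"
    have W: "open W" "q \<in> W"
      unfolding W_def using open_chart_preimage[OF c(1) open_ball] c(2) r(1) by auto
    have "F p = k" if "p \<in> W" for p
      using k[of "cmap c p"] that cinv_cmap[OF c(1), of p] by (simp add: W_def)
    then show "\<forall>\<^sub>F p in at q within UNIV. F q = F p"
      using W by (auto simp: eventually_at_topological intro!: exI[of _ W])
  qed
  then have "F a = F b" for a b
    using connected_local_const[OF atlas(2), of a b F] by blast
  then show ?thesis unfolding trivial_potential_def constant_on_def by blast
qed

text \<open>One open set serves every level: its positive volume is the bound \<open>b\<close>, and
  only the waiting time depends on \<open>m\<close>.\<close>

lemma superlevel_growth:
  assumes F0: "\<And>q. F q \<ge> 0" and \<mu>: "riemannian_volume A g \<mu>" and ne: "\<Omega> \<noteq> {}"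
  obtains b where "b > 0" "\<And>m. m \<ge> 0 \<Longrightarrow> b \<le> 2 * emeasure \<mu> {q. F q \<ge> m}"
proof -
  obtain q0 where q0: "q0 \<in> \<Omega>" using ne by blast
  \<comment> \<open>Half the speed at \<open>q0\<close> leaves room for an open neighbourhood on
    which the speed exceeds \<open>s\<close>; from there \<open>F\<close> gains at least
    \<open>m\<close> by time \<open>m / s\<close>.\<close>
  define s where "s = speed q0 / 2"
  have s: "s > 0" "s < speed q0" using speed_pos[OF q0] by (auto simp: s_def)
  define U where "U = \<Omega> \<inter> speed -` {s<..}"
  have U: "open U" "U \<subseteq> \<Omega>" "q0 \<in> U"
    using continuous_open_preimage[OF continuous_on_subset[OF cont_speed subset_UNIV] open_\<Omega> open_greaterThan]
      q0 s(2) by (auto simp: U_def)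
  show ?thesis
  proof (rule that)
    show "emeasure \<mu> U > 0" using volume_open_pos[OF \<mu> U(1)] U(3) by blast
    fix m :: real assume m: "m \<ge> 0"
    show "emeasure \<mu> U \<le> 2 * emeasure \<mu> {q. F q \<ge> m}"
    proof (rule measure_superlevel[OF \<mu> U(1,2), of "m / s"])
      show "m / s \<ge> 0" using m s(1) by simp
      have "closed {q. F q \<ge> m}" by (intro closed_Collect_le continuous_on_const cont_F)
      then show "{q. F q \<ge> m} \<in> sets borel" by simp
      fix q assume q: "q \<in> U"
      have "m = s * (m / s)" using s(1) by simp
      also have "\<dots> \<le> speed q * (m / s)"
        using q m s(1) by (intro mult_right_mono) (auto simp: U_def)
      also have "\<dots> \<le> F (flow (m / s) q)"
      proof -
        have "F q + speed q * (m / s) \<le> F (flow (m / s) q)"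
          using q U(2) m s(1) by (intro F_flow) auto
        then show ?thesis using F0[of q] by linarith
      qed
      finally show "flow (m / s) q \<in> {q. F q \<ge> m}" by simp
    qed
  qed
qed

end

section \<open>Contradiction with integrability\<close>

theorem corollary1p7:
  fixes A :: "('a::{t2_space, second_countable_topology}, 'n::finite) chart set"
    and g :: "('a, 'n) chart \<Rightarrow> real ^ 'n \<Rightarrow> real ^ 'n ^ 'n"
    and F :: "'a \<Rightarrow> real"
    and p :: real
  assumes "steady_gradient_yamabe_soliton A g F"
    and "complete_riemannian A g"
    and "nonneg_scalar_curvature A g"
    and "\<forall>q. F q \<ge> 0"
    and "p \<ge> 0"
    and "in_Lp A g F p"
  shows "trivial_potential F"
proof (rule ccontr)
  interpret steady_soliton A g F using assms(1-3) by unfold_locales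
  assume "\<not> trivial_potential F"
  then have ne: "\<Omega> \<noteq> {}" using constant_if_no_regular_point by blast
  obtain \<mu> where \<mu>: "riemannian_volume A g \<mu>" "(\<integral>\<^sup>+ q. ennreal (F q powr p) \<partial>\<mu>) < \<infinity>"
    using assms(6) unfolding in_Lp_def by blast
  have sets: "sets \<mu> = sets borel" using \<mu>(1) by (simp add: riemannian_volume_def)
  \<comment> \<open>\<open>Suc\<close> starts the levels at 1, where \<open>F q powr p\<close> is at
    least 1 for every \<open>p \<ge> 0\<close>, including 0; the integral then bounds the volume of
    \<open>B 0\<close>.\<close>
  define B where "B m = {q. F q \<ge> real (Suc m)}" for m
  have B: "B m \<in> sets \<mu>" for m
  proof -
    have "closed (B m)" unfolding B_def by (intro closed_Collect_le continuous_on_const cont_F)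
    then show ?thesis using sets by simp
  qed
  have F0: "F q \<ge> 0" for q using assms(4) by blast
  obtain b where b: "b > 0" "\<And>m. m \<ge> 0 \<Longrightarrow> b \<le> 2 * emeasure \<mu> {q. F q \<ge> m}"
    by (rule superlevel_growth[OF F0 \<mu>(1) ne]) (rule that)
  have fin: "emeasure \<mu> (B 0) < \<infinity>"
  proof -
    have "emeasure \<mu> (B 0) = (\<integral>\<^sup>+ q. indicator (B 0) q \<partial>\<mu>)"
      by (rule nn_integral_indicator[OF B, symmetric])
    also have "\<dots> \<le> (\<integral>\<^sup>+ q. ennreal (F q powr p) \<partial>\<mu>)"
    proof (rule nn_integral_mono)
      fix q
      have "1 \<le> F q powr p" if "q \<in> B 0" using that assms(5) by (simp add: B_def ge_one_powr_ge_zero)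
      then show "indicator (B 0) q \<le> ennreal (F q powr p)" by (auto simp: indicator_def)
    qed
    also have "\<dots> < \<infinity>" by (rule \<mu>(2))
    finally show ?thesis .
  qed
  \<comment> \<open>Continuity of the measure from above, which rests on the finite volume of
    \<open>B 0\<close>; real-valuedness of \<open>F\<close> makes the intersection empty.\<close>
  have "(\<lambda>m. emeasure \<mu> (B m)) \<longlonglongrightarrow> emeasure \<mu> (\<Inter>m. B m)"
  proof (rule Lim_emeasure_decseq)
    show "range B \<subseteq> sets \<mu>" using B by blast
    show "decseq B" by (auto simp: decseq_def B_def)
    fix m
    have "emeasure \<mu> (B m) \<le> emeasure \<mu> (B 0)" by (rule emeasure_mono[OF _ B]) (auto simp: B_def)
    then show "emeasure \<mu> (B m) \<noteq> \<infinity>" using fin by (auto simp: top_unique)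
  qed
  moreover have "(\<Inter>m. B m) = {}"
  proof -
    have "\<exists>m. q \<notin> B m" for q
    proof -
      obtain n where "F q < real n" using reals_Archimedean2 by blast
      then have "q \<notin> B n" by (simp add: B_def)
      then show ?thesis by blast
    qed
    then show ?thesis by blast
  qed
  ultimately have "(\<lambda>m. emeasure \<mu> (B m)) \<longlonglongrightarrow> 0" by simp
  then have "(\<lambda>m. 2 * emeasure \<mu> (B m)) \<longlonglongrightarrow> 2 * 0" by (intro ennreal_tendsto_cmult) auto
  moreover have "b \<le> 2 * emeasure \<mu> (B m)" for m unfolding B_def by (rule b(2)) simp
  ultimately have "b \<le> 2 * 0" by (intro LIMSEQ_le_const[where X = "\<lambda>m. 2 * emeasure \<mu> (B m)"]) auto
  then show False using b(1) by simp
qed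

end
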